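(* Let $F\in\mathcal{S}^{\sharp}$, let $Z_F$ be its generalised Hardy $Z$-function, and let $k$ be a non-negative integer. Under the assumption of the Riemann Hypothesis for $F(s)$, we have \[ \frac{d}{dt}\frac{Z_F^{(k+1)}}{Z_F^{(k)}}(t)=-\sum_{\gamma_k}\frac{1}{(t-\gamma_k)^2}+O_k(t^{-1}), \] where $\gamma_k$ runs over the zeros of $Z_F^{(k)}(t)$, counted with multiplicity.
   Context: Write $s=\sigma+it$. The extended Selberg class $\mathcal{S}^{\sharp}$ is the set of functions $F$ such that: (S1) $F(s)=\sum_{n\ge1}a_F(n)n^{-s}$, absolutely convergent for $\sigma>1$, with $a_F(1)=1$; (S2) there is an integer $m\ge0$ such that $(s-1)^mF(s)$ extends to an entire function of finite order; the smallest such $m$ is denoted $m_F$; (S3) there exist an integer $r\ge0$, real numbers $Q>0$, $\lambda_j>0$, complex numbers $\mu_j$ with $\Re\mu_j\ge0$ $(1\le j\le r)$ and $\omega\in\mathbb{C}$ with $|\omega|=1$ such that, with the gamma factor $\gamma(s)=Q^s\prod_{j=1}^r\Gamma(\lambda_js+\mu_j)$, the function $\xi_F(s)=s^{m_F}(s-1)^{m_F}\gamma(s)F(s)$ satisfies $\xi_F(s)=\omega\overline{\xi_F(1-\overline{s})}$. Put $H(s)=\omega\overline{\gamma(1-\overline{s})}/\gamma(s)$, so that $F(s)=H(s)\overline{F(1-\overline{s})}$ and $|H(1/2+it)|=1$ for real $t$. Let $\theta_F:\mathbb{R}\to\mathbb{R}$ be a smooth function with $H(1/2+it)=e^{-2i\theta_F(t)}$,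 and define $Z_F(t)=e^{i\theta_F(t)}F(1/2+it)$ for $t\in\mathbb{R}$; this is a real-valued function of the real variable $t$. The subscript $k$ in $O_k$ means that the implied constant depends on $k$. The Riemann Hypothesis (RH) for $F$: every non-trivial zero of $F$, i.e. every zero of $\xi_F$, lies on the line $\Re s=1/2$. *)

theory Defs
  imports "HOL-Complex_Analysis.Complex_Analysis"
begin

section \<open>The extended Selberg class\<close>

text \<open>
  A member of the class is a function on the whole complex plane, namely the meromorphic
  continuation of its Dirichlet series. The condition \<open>nicely_meromorphic_on\<close> in the definition of
  the class below only normalises the value at \<open>1\<close>: it is \<open>0\<close> if \<open>1\<close> is a pole, and the limit
  otherwise.
\<close>

definition normalised_Dirichlet_series :: "(complex \<Rightarrow> complex) \<Rightarrow> bool" where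
  "normalised_Dirichlet_series F \<longleftrightarrow>
     (\<exists>a :: nat \<Rightarrow> complex. a 1 = 1 \<and>
        (\<forall>s. Re s > 1 \<longrightarrow>
           (\<lambda>n. norm (a n * of_nat n powr (- s))) summable_on {1..} \<and>
           F s = (\<Sum>\<^sub>\<infinity>n\<in>{1..}. a n * of_nat n powr (- s))))"

definition entire_of_finite_order :: "(complex \<Rightarrow> complex) \<Rightarrow> bool" where
  "entire_of_finite_order G \<longleftrightarrow>
     G holomorphic_on UNIV \<and>
     (\<exists>\<rho>::real. (\<lambda>z. norm (G z)) \<in> O[at_infinity](\<lambda>z. exp (norm z powr \<rho>)))"

definition polar_bound :: "(complex \<Rightarrow> complex) \<Rightarrow> nat \<Rightarrow> bool" where
  "polar_bound F m \<longleftrightarrow>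
     (\<exists>G. entire_of_finite_order G \<and> (\<forall>s. s \<noteq> 1 \<longrightarrow> G s = (s - 1) ^ m * F s))"

definition polar_order :: "(complex \<Rightarrow> complex) \<Rightarrow> nat" where
  "polar_order F = (LEAST m. polar_bound F m)"

definition gamma_factor ::
    "nat \<Rightarrow> real \<Rightarrow> (nat \<Rightarrow> real) \<Rightarrow> (nat \<Rightarrow> complex) \<Rightarrow> complex \<Rightarrow> complex" where
  "gamma_factor r Q lam mu s =
     of_real Q powr s * (\<Prod>j=1..r. Gamma (of_real (lam j) * s + mu j))"

text \<open>
  In the library, \<open>Gamma\<close> takes the value \<open>0\<close> at its poles, so the literal product would have
  spurious zeros at the trivial zeros of \<open>F\<close>. The operator \<open>remove_sings\<close> turns the product into
  the meromorphic function that it denotes.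
\<close>

definition completed ::
    "nat \<Rightarrow> real \<Rightarrow> (nat \<Rightarrow> real) \<Rightarrow> (nat \<Rightarrow> complex) \<Rightarrow> (complex \<Rightarrow> complex) \<Rightarrow> complex \<Rightarrow> complex"
  where
  "completed r Q lam mu F =
     remove_sings (\<lambda>s. s ^ polar_order F * (s - 1) ^ polar_order F * gamma_factor r Q lam mu s * F s)"

definition functional_equation ::
    "nat \<Rightarrow> real \<Rightarrow> (nat \<Rightarrow> real) \<Rightarrow> (nat \<Rightarrow> complex) \<Rightarrow> complex \<Rightarrow> (complex \<Rightarrow> complex) \<Rightarrow> bool"
  where
  "functional_equation r Q lam mu \<omega> F \<longleftrightarrow>
     Q > 0 \<and> (\<forall>j\<in>{1..r}. lam j > 0 \<and> Re (mu j) \<ge> 0) \<and> norm \<omega> = 1 \<and>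
     (\<forall>s. completed r Q lam mu F s = \<omega> * cnj (completed r Q lam mu F (1 - cnj s)))"

definition extended_Selberg_class :: "(complex \<Rightarrow> complex) set" where
  "extended_Selberg_class =
     {F. F nicely_meromorphic_on UNIV \<and>
         normalised_Dirichlet_series F \<and>
         (\<exists>m. polar_bound F m) \<and>
         (\<exists>r Q lam mu \<omega>. functional_equation r Q lam mu \<omega> F)}"

definition Riemann_Hypothesis ::
    "nat \<Rightarrow> real \<Rightarrow> (nat \<Rightarrow> real) \<Rightarrow> (nat \<Rightarrow> complex) \<Rightarrow> (complex \<Rightarrow> complex) \<Rightarrow> bool" where
  "Riemann_Hypothesis r Q lam mu F \<longleftrightarrow>
     (\<forall>s. completed r Q lam mu F s = 0 \<longrightarrow> Re s = 1 / 2)"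


section \<open>The generalised Hardy function\<close>

definition H_factor ::
    "nat \<Rightarrow> real \<Rightarrow> (nat \<Rightarrow> real) \<Rightarrow> (nat \<Rightarrow> complex) \<Rightarrow> complex \<Rightarrow> complex \<Rightarrow> complex" where
  "H_factor r Q lam mu \<omega> s =
     \<omega> * cnj (gamma_factor r Q lam mu (1 - cnj s)) / gamma_factor r Q lam mu s"

definition smooth :: "(real \<Rightarrow> real) \<Rightarrow> bool" where
  "smooth f \<longleftrightarrow> (\<forall>n t. (deriv ^^ n) f differentiable (at t))"

definition Hardy_phase ::
    "nat \<Rightarrow> real \<Rightarrow> (nat \<Rightarrow> real) \<Rightarrow> (nat \<Rightarrow> complex) \<Rightarrow> complex \<Rightarrow> (real \<Rightarrow> real) \<Rightarrow> bool" where
  "Hardy_phase r Q lam mu \<omega> \<theta> \<longleftrightarrow>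
     smooth \<theta> \<and>
     (\<forall>t. H_factor r Q lam mu \<omega> (Complex (1 / 2) t) = exp (- (2 * \<i> * of_real (\<theta> t))))"

text \<open>
  The product is real; lemma \<open>of_real_Hardy_Z\<close> below shows that taking the real part loses nothing.
\<close>

definition Hardy_Z :: "(complex \<Rightarrow> complex) \<Rightarrow> (real \<Rightarrow> real) \<Rightarrow> real \<Rightarrow> real" where
  "Hardy_Z F \<theta> t = Re (exp (\<i> * of_real (\<theta> t)) * F (Complex (1 / 2) t))"

text \<open>The multiplicity of a zero \<open>x\<close>; it is only meaningful if some derivative does not vanish at \<open>x\<close>.\<close>

definition zero_mult :: "(real \<Rightarrow> real) \<Rightarrow> real \<Rightarrow> nat" where
  "zero_mult f x = (LEAST n. (deriv ^^ n) f x \<noteq> 0)"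

lemma gamma_factor_analytic:
  assumes "Q > 0" "\<forall>j\<in>{1..r}. lam j > 0 \<and> Re (mu j) \<ge> 0" "Re s > 0"
  shows "gamma_factor r Q lam mu analytic_on {s}" "gamma_factor r Q lam mu s \<noteq> 0"
proof -
  have np: "of_real (lam j) * s + mu j \<notin> \<int>\<^sub>\<le>\<^sub>0" if "j \<in> {1..r}" for j
  proof -
    have "lam j * Re s > 0" "Re (mu j) \<ge> 0" using assms that by auto
    hence "Re (of_real (lam j) * s + mu j) > 0" by simp
    thus ?thesis by (metis nonpos_Ints_cases Re_complex_of_real linorder_not_le of_int_le_0_iff of_real_of_int_eq)
  qed
  have "(\<lambda>s. of_real Q powr s * (\<Prod>j=1..r. Gamma (of_real (lam j) * s + mu j))) analytic_on {s}"
    using np assms(1) by (auto intro!: analytic_intros)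
  thus "gamma_factor r Q lam mu analytic_on {s}"
    unfolding gamma_factor_def [abs_def] .
  show "gamma_factor r Q lam mu s \<noteq> 0"
    using np assms(1) by (auto simp: gamma_factor_def Gamma_eq_zero_iff)
qed

lemma of_real_Hardy_Z:
  assumes F: "F \<in> extended_Selberg_class"
    and fe: "functional_equation r Q lam mu \<omega> F"
    and \<theta>: "Hardy_phase r Q lam mu \<omega> \<theta>"
  shows "of_real (Hardy_Z F \<theta> t) = exp (\<i> * of_real (\<theta> t)) * F (Complex (1 / 2) t)"
proof -
  define s where "s = Complex (1 / 2) t"
  define m where "m = polar_order F"
  define g where "g = gamma_factor r Q lam mu"
  have s: "Re s > 0" "s \<noteq> 1" "1 - cnj s = s" "s \<noteq> 0"
    by (auto simp: s_def complex_eq_iff)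
  have g: "g analytic_on {s}" "g s \<noteq> 0"
    using gamma_factor_analytic[of Q r lam mu s] fe s(1)
    by (auto simp: g_def functional_equation_def)
  have Fan: "F analytic_on {s}"
  proof -
    obtain k G where G: "entire_of_finite_order G" "\<And>z. z \<noteq> 1 \<Longrightarrow> G z = (z - 1) ^ k * F z"
      using F by (auto simp: extended_Selberg_class_def polar_bound_def)
    have "(\<lambda>z. G z / (z - 1) ^ k) holomorphic_on - {1}"
      using G(1) by (auto simp: entire_of_finite_order_def intro!: holomorphic_intros
                          intro: holomorphic_on_subset)
    hence "F holomorphic_on - {1}"
      by (rule holomorphic_transform) (use G(2) in auto)
    thus ?thesis using s(2) by (intro holomorphic_on_imp_analytic_at[of _ "- {1}"]) auto
  qed
  have "(\<lambda>s. s ^ m * (s - 1) ^ m * g s * F s) analytic_on {s}"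
    using g(1) Fan by (intro analytic_intros) auto
  hence c: "completed r Q lam mu F s = s ^ m * (s - 1) ^ m * g s * F s"
    by (simp add: completed_def m_def g_def)
  have "completed r Q lam mu F s = \<omega> * cnj (completed r Q lam mu F s)"
    using fe s(3) unfolding functional_equation_def by metis
  moreover have "cnj (s ^ m * (s - 1) ^ m) = s ^ m * (s - 1) ^ m"
  proof -
    have "cnj s = - (s - 1)" "cnj (s - 1) = - s" using s(3) by (auto simp: complex_eq_iff)
    hence "cnj s * cnj (s - 1) = s * (s - 1)" by (simp only: minus_mult_minus mult.commute)
    thus ?thesis by (metis complex_cnj_mult complex_cnj_power power_mult_distrib)
  qed
  ultimately have "(s ^ m * (s - 1) ^ m) * (g s * F s) =
      (s ^ m * (s - 1) ^ m) * (\<omega> * cnj (g s) * cnj (F s))"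
    unfolding c by (metis (no_types, opaque_lifting) complex_cnj_mult mult.assoc mult.left_commute)
  hence "g s * F s = \<omega> * cnj (g s) * cnj (F s)"
    using s by simp
  hence "F s = H_factor r Q lam mu \<omega> s * cnj (F s)"
    using g(2) unfolding H_factor_def s(3) g_def by (simp add: field_simps)
  also have "H_factor r Q lam mu \<omega> s = exp (- (2 * \<i> * of_real (\<theta> t)))"
    using \<theta> by (simp add: Hardy_phase_def s_def)
  finally have "exp (\<i> * of_real (\<theta> t)) * F s =
      exp (\<i> * of_real (\<theta> t)) * exp (- (2 * \<i> * of_real (\<theta> t))) * cnj (F s)"
    by simp
  also have "\<dots> = exp (- (\<i> * of_real (\<theta> t))) * cnj (F s)"
    by (simp flip: exp_add)
  also have "\<dots> = cnj (exp (\<i> * of_real (\<theta> t)) * F s)"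
    by (simp add: exp_cnj)
  finally have "exp (\<i> * of_real (\<theta> t)) * F s \<in> \<real>"
    by (metis Reals_cnj_iff)
  thus ?thesis unfolding Hardy_Z_def s_def by (rule of_real_Re)
qed

end

theory Submission
  imports Defs "HOL-Real_Asymp.Real_Asymp"
begin

text \<open>
  On the critical line, \<open>Z = \<Xi> / g\<close> with \<open>\<Xi>\<close> the completed function and
  \<open>(log g)'' = O(1 / t\<^sup>2)\<close>. Since \<open>\<Xi>\<close> has order one and, by RH, only real zeros,
  \<open>Im (\<Xi>' / \<Xi>) (w) = - Im w * (\<Sum> 1 / |w - \<gamma>|\<^sup>2)\<close>, which settles \<open>k = 0\<close>.

  The step from \<open>f = Z\<^sup>(\<^sup>k\<^sup>)\<close> to \<open>f'\<close> needs no Hadamard product for \<open>f'\<close>. In a cone around the real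
  axis, far from the origin, \<open>- f' / f\<close> maps the upper half-plane to itself, so there \<open>f'\<close> has only
  real zeros and they interlace with those of \<open>f\<close>. Hence \<open>log (- f' / f)\<close>, corrected by the
  logarithms of its zeros and poles in a disc of radius \<open>R\<close> comparable to \<open>t\<close>, has bounded imaginary part, and its
  second derivative is \<open>O(1 / R\<^sup>2)\<close>; interlacing also bounds the contribution of the zeros outside the
  disc by \<open>O(1 / R\<^sup>2)\<close>. The error therefore stays \<open>O(1 / t\<^sup>2)\<close> for every \<open>k\<close>.
\<close>

section \<open>Multiplicities and factorisation\<close>

text \<open>The cone is forced by the size of the error: \<open>O(1 / R^2)\<close> is as good as
  \<open>O(1 / t^2)\<close> only if \<open>R\<close> is comparable to \<open>t\<close>, so every
  hypothesis on \<open>f\<close> has to hold in discs of such a radius, and each differentiation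
  narrows the cone by a fixed factor. Imaginary parts are used because all terms of the sum over the
  zeros then have one sign: convergence along discs already gives unconditional summability, and a
  term \<open>b * z\<close> with real \<open>b\<close> in the logarithm leaves no trace. All errors
  are kept proportional to \<open>Im w\<close>, so that dividing by \<open>Im w\<close> and letting
  it tend to 0 yields the derivative of \<open>f' / f\<close> on the axis. The sign of
  \<open>Im (f' / f)\<close> is known only where the sum beats the error \<open>C / t^2\<close>.
  Hence a lower bound \<open>A / |t|\<close> for the sum is carried along. It starts from the region
  far to the right of the critical line, where the Gamma factors, or \<open>Q > 1\<close>, keep
  \<open>Re (X' / X)\<close> above a positive constant. With \<open>r = 0\<close> and
  \<open>Q \<le> 1\<close> there is no such bound, but then \<open>F\<close> is 1 on the critical
  line and \<open>Z\<close> is constant.\<close>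

definition zmult :: "(complex \<Rightarrow> complex) \<Rightarrow> complex \<Rightarrow> nat" where
  "zmult f z = nat (zorder f z)"

lemma zmult_eqI:
  assumes "open U" "z \<in> U" "g holomorphic_on U" "g z \<noteq> 0" "\<And>w. w \<in> U \<Longrightarrow> f w = (w - z) ^ n * g w"
  shows "zmult f z = n"
proof -
  have "zorder f z = int n"
    by (rule zorder_eqI[of U z g]) (use assms in \<open>auto simp: mult.commute\<close>)
  thus ?thesis by (simp add: zmult_def)
qed

lemma zmult_factor:
  assumes f: "f holomorphic_on U" "open U" "connected U" "z \<in> U" "w0 \<in> U" "f w0 \<noteq> 0"
  obtains g where "g holomorphic_on U" "g z \<noteq> 0" "\<And>w. w \<in> U \<Longrightarrow> f w = (w - z) ^ zmult f z * g w"
proof -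
  define n where "n = zmult f z"
  define p where "p = zor_poly f z"
  obtain r where r: "r > 0" "cball z r \<subseteq> U" "p holomorphic_on cball z r"
    "\<And>w. w \<in> cball z r \<Longrightarrow> f w = p w * (w - z) ^ n" "\<And>w. w \<in> cball z r \<Longrightarrow> p w \<noteq> 0"
    using zorder_exist_zero[OF f(1-4)] f(5,6) unfolding n_def p_def zmult_def by blast
  \<comment> \<open>\<open>zorder_exist_zero\<close> describes the cofactor only on a small ball;
    the quotient \<open>f w / (w - z) ^ n\<close> continues it to all of \<open>U\<close>.\<close>
  define g where "g = (\<lambda>w. if w \<in> ball z r then p w else f w / (w - z) ^ n)"
  have "g holomorphic_on ball z r"
    by (rule holomorphic_transform[of p]) (use r(3) in \<open>auto simp: g_def intro: holomorphic_on_subset\<close>)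
  moreover have "g holomorphic_on (U - {z})"
  proof (rule holomorphic_transform[of "\<lambda>w. f w / (w - z) ^ n"])
    show "(\<lambda>w. f w / (w - z) ^ n) holomorphic_on U - {z}"
      using f(1) by (auto intro!: holomorphic_intros intro: holomorphic_on_subset)
    show "f w / (w - z) ^ n = g w" if "w \<in> U - {z}" for w
      using that r(4)[of w] by (auto simp: g_def)
  qed
  ultimately have "g holomorphic_on (ball z r \<union> (U - {z}))"
    using f(2) by (intro holomorphic_on_Un) auto
  moreover have "ball z r \<union> (U - {z}) = U" using r by auto
  ultimately have "g holomorphic_on U" by simp
  moreover have "g z \<noteq> 0" using r by (auto simp: g_def)
  moreover have "f w = (w - z) ^ n * g w" if "w \<in> U" for w
    using r(4)[of w] r(1) by (auto simp: g_def)
  ultimately show ?thesis using that unfolding n_def by blast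
qed

lemma zmult_pos_iff:
  assumes f: "f holomorphic_on U" "open U" "connected U" "z \<in> U" "w0 \<in> U" "f w0 \<noteq> 0"
  shows "zmult f z > 0 \<longleftrightarrow> f z = 0"
proof -
  obtain g where g: "g holomorphic_on U" "g z \<noteq> 0" "\<And>w. w \<in> U \<Longrightarrow> f w = (w - z) ^ zmult f z * g w"
    using zmult_factor[OF f] by blast
  show ?thesis using g(2) g(3)[OF f(4)] by (cases "zmult f z = 0") auto
qed

lemma zmult_factor_finite:
  assumes f: "f holomorphic_on U" "open U" "connected U" "w0 \<in> U" "f w0 \<noteq> 0"
    and S: "finite S" "S \<subseteq> U"
  obtains h where "h holomorphic_on U" "\<And>z. z \<in> S \<Longrightarrow> h z \<noteq> 0"
    "\<And>w. w \<in> U \<Longrightarrow> f w = (\<Prod>z\<in>S. (w - z) ^ zmult f z) * h w"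
proof -
  have "\<exists>h. h holomorphic_on U \<and> (\<forall>z\<in>S. h z \<noteq> 0) \<and> (\<forall>w\<in>U. f w = (\<Prod>z\<in>S. (w - z) ^ zmult f z) * h w)"
    using S
  proof (induction S rule: finite_induct)
    case empty
    thus ?case using f by auto
  next
    case (insert a S)
    then obtain h where h: "h holomorphic_on U" "\<forall>z\<in>S. h z \<noteq> 0"
      "\<And>w. w \<in> U \<Longrightarrow> f w = (\<Prod>z\<in>S. (w - z) ^ zmult f z) * h w" by auto
    have "h w0 \<noteq> 0" using h(3)[OF f(4)] f(5) by auto
    then obtain g where g: "g holomorphic_on U" "g a \<noteq> 0" "\<And>w. w \<in> U \<Longrightarrow> h w = (w - a) ^ zmult h a * g w"
      using zmult_factor[of h U a w0] h(1) f insert.prems by auto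
    \<comment> \<open>The factors already split off do not vanish at \<open>a\<close>, so
      \<open>f\<close> and the remaining cofactor \<open>h\<close> have the same multiplicity
      there.\<close>
    have "zmult f a = zmult h a"
    proof (rule zmult_eqI[of U _ "\<lambda>w. (\<Prod>z\<in>S. (w - z) ^ zmult f z) * g w"])
      show "(\<lambda>w. (\<Prod>z\<in>S. (w - z) ^ zmult f z) * g w) holomorphic_on U"
        using g by (auto intro!: holomorphic_intros)
      show "(\<Prod>z\<in>S. (a - z) ^ zmult f z) * g a \<noteq> 0"
        using g insert.hyps by auto
      show "f w = (w - a) ^ zmult h a * ((\<Prod>z\<in>S. (w - z) ^ zmult f z) * g w)" if "w \<in> U" for w
        using h(3)[OF that] g(3)[OF that] by simp
    qed (use f insert.prems in auto)
    moreover have "g z \<noteq> 0" if "z \<in> S" for z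
      using that h(2) g(3)[of z] insert.prems by auto
    moreover have "f w = (\<Prod>z\<in>insert a S. (w - z) ^ zmult f z) * g w" if "w \<in> U" for w
      using h(3)[OF that] g(3)[OF that] insert.hyps \<open>zmult f a = zmult h a\<close> by simp
    ultimately show ?case using g by blast
  qed
  thus ?thesis using that by blast
qed

lemma has_field_derivative_prod_power:
  fixes z :: "'a \<Rightarrow> complex"
  assumes "finite S" "\<And>a. a \<in> S \<Longrightarrow> w \<noteq> z a"
  shows "((\<lambda>w. \<Prod>a\<in>S. (w - z a) ^ k a) has_field_derivative
           (\<Prod>a\<in>S. (w - z a) ^ k a) * (\<Sum>a\<in>S. of_nat (k a) / (w - z a))) (at w)"
  using assms
proof (induction S rule: finite_induct)
  case (insert a S)
  have "((\<lambda>w. (w - z a) ^ k a) has_field_derivative (w - z a) ^ k a * (of_nat (k a) / (w - z a))) (at w)"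
  proof (cases "k a")
    case (Suc n)
    have "((\<lambda>w. (w - z a) ^ Suc n) has_field_derivative of_nat (Suc n) * (w - z a) ^ n) (at w)"
      by (rule derivative_eq_intros refl | simp)+
    moreover have "(w - z a) ^ k a * (of_nat (k a) / (w - z a)) = of_nat (Suc n) * (w - z a) ^ n"
      using insert.prems Suc by (simp add: field_simps)
    ultimately show ?thesis by (simp only: Suc)
  qed simp
  from DERIV_mult[OF this insert.IH] insert show ?case
    by (simp add: algebra_simps)
qed simp

lemma logderiv_prod_power:
  fixes z :: "'a \<Rightarrow> complex"
  assumes "finite S" "open U" "w \<in> U" "h holomorphic_on U" "f w \<noteq> 0"
    "\<And>w. w \<in> U \<Longrightarrow> f w = (\<Prod>a\<in>S. (w - z a) ^ k a) * h w" "\<And>a. a \<in> S \<Longrightarrow> w \<noteq> z a"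
  shows "deriv f w / f w = (\<Sum>a\<in>S. of_nat (k a) / (w - z a)) + deriv h w / h w"
proof -
  define p where "p = (\<lambda>w. \<Prod>a\<in>S. (w - z a) ^ k a)"
  have 1: "(h has_field_derivative deriv h w) (at w)"
    using assms holomorphic_derivI by blast
  have "((\<lambda>w. p w * h w) has_field_derivative
       p w * deriv h w + (p w * (\<Sum>a\<in>S. of_nat (k a) / (w - z a))) * h w) (at w)"
    unfolding p_def by (rule DERIV_mult'[OF has_field_derivative_prod_power[OF assms(1,7)] 1])
  moreover have "((\<lambda>w. p w * h w) has_field_derivative D) (at w) \<longleftrightarrow> (f has_field_derivative D) (at w)" for D
    by (rule DERIV_cong_ev) (use assms in \<open>auto simp: p_def intro!: eventually_mono[OF eventually_nhds_in_open[of U w]]\<close>)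
  ultimately have "deriv f w = p w * deriv h w + (p w * (\<Sum>a\<in>S. of_nat (k a) / (w - z a))) * h w"
    by (simp add: DERIV_imp_deriv)
  moreover have "f w = p w * h w" "f w \<noteq> 0" using assms by (auto simp: p_def)
  ultimately show ?thesis by (simp add: divide_simps) (simp add: algebra_simps)
qed

section \<open>Sums of monotone functions over interlacing sets\<close>

lemma interlace_finite_antimono:
  fixes P N :: "real set" and \<phi> :: "real \<Rightarrow> real"
  assumes "finite P" "P \<subseteq> I" "is_interval I"
    "\<And>p p'. p \<in> P \<Longrightarrow> p' \<in> P \<Longrightarrow> p < p' \<Longrightarrow> \<exists>n\<in>N. p < n \<and> n < p'"
    "\<And>x y. x \<in> I \<Longrightarrow> y \<in> I \<Longrightarrow> x \<le> y \<Longrightarrow> \<phi> y \<le> \<phi> x" "\<And>x. x \<in> I \<Longrightarrow> \<phi> x \<le> B" "0 \<le> B"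
  shows "\<exists>N0. finite N0 \<and> N0 \<subseteq> N \<inter> I \<and> sum \<phi> P \<le> sum \<phi> N0 + B"
proof -
  \<comment> \<open>Every point of \<open>P\<close> except the smallest is charged to a point of
    \<open>N\<close> between it and its predecessor, where \<open>\<phi>\<close> is at least as
    large; the smallest point costs \<open>B\<close>. The added clause, that each chosen point lies
    below some point of \<open>P\<close>, makes the next choice new, since that one exceeds
    \<open>Max P\<close>.\<close>
  have "\<exists>N0. finite N0 \<and> N0 \<subseteq> N \<inter> I \<and> (\<forall>n\<in>N0. \<exists>p\<in>P. n < p) \<and> sum \<phi> P \<le> sum \<phi> N0 + B"
    using assms(1,2,4)
  proof (induction P rule: finite_linorder_max_induct)
    case empty
    show ?case using assms(7) by (intro exI[of _ "{}"]) auto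
  next
    case (insert b P)
    have bI: "b \<in> I" using insert by auto
    have nb: "b \<notin> P" using insert.hyps by auto
    show ?case
    proof (cases "P = {}")
      case True
      show ?thesis using True assms(6)[OF bI] by (intro exI[of _ "{}"]) auto
    next
      case False
      obtain N0 where N0: "finite N0" "N0 \<subseteq> N \<inter> I" "\<forall>n\<in>N0. \<exists>p\<in>P. n < p" "sum \<phi> P \<le> sum \<phi> N0 + B"
        using insert.IH insert.prems by auto
      define a where "a = Max P"
      have a: "a \<in> P" "\<And>p. p \<in> P \<Longrightarrow> p \<le> a" using False insert.hyps by (auto simp: a_def)
      obtain n where n: "n \<in> N" "a < n" "n < b" using insert.prems(2)[of a b] a insert.hyps by auto
      have nI: "n \<in> I" using assms(3) a(1) bI insert.prems n by (meson insertCI is_interval_1 less_eq_real_def subsetD)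
      have "n \<notin> N0" using N0(3) a n by force
      moreover have "\<phi> b \<le> \<phi> n" using assms(5)[OF nI bI] n by simp
      moreover have "\<forall>n\<in>N0. \<exists>p\<in>insert b P. n < p" using N0(3) by auto
      ultimately show ?thesis using N0 n nb insert.hyps nI
        by (intro exI[of _ "insert n N0"]) auto
    qed
  qed
  thus ?thesis by blast
qed

lemma interlace_finite:
  fixes P N :: "real set" and \<phi> :: "real \<Rightarrow> real"
  assumes "finite P" "P \<subseteq> I" "is_interval I"
    "\<And>p p'. p \<in> P \<Longrightarrow> p' \<in> P \<Longrightarrow> p < p' \<Longrightarrow> \<exists>n\<in>N. p < n \<and> n < p'"
    and mono: "antimono_on I \<phi> \<or> mono_on I \<phi>"
    and B: "\<And>x. x \<in> I \<Longrightarrow> \<phi> x \<le> B" "0 \<le> B"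
  shows "\<exists>N0. finite N0 \<and> N0 \<subseteq> N \<inter> I \<and> sum \<phi> P \<le> sum \<phi> N0 + B"
  using mono
proof
  assume "antimono_on I \<phi>"
  thus ?thesis using interlace_finite_antimono[OF assms(1-4) _ B] by (auto simp: monotone_on_def)
next
  assume m: "mono_on I \<phi>"
  have "\<exists>N0. finite N0 \<and> N0 \<subseteq> uminus ` N \<inter> uminus ` I \<and> (\<Sum>x\<in>uminus ` P. \<phi> (- x)) \<le> (\<Sum>x\<in>N0. \<phi> (- x)) + B"
  proof (rule interlace_finite_antimono)
    fix p p' assume "p \<in> uminus ` P" "p' \<in> uminus ` P" "p < p'"
    then obtain n where "n \<in> N" "- p' < n" "n < - p" using assms(4)[of "-p'" "-p"] by auto
    thus "\<exists>n\<in>uminus ` N. p < n \<and> n < p'" by (intro bexI[of _ "-n"]) auto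
  qed (use assms m in \<open>auto simp: monotone_on_def\<close>)
  then obtain N0 where N0: "finite N0" "N0 \<subseteq> uminus ` N \<inter> uminus ` I" "(\<Sum>x\<in>uminus ` P. \<phi> (- x)) \<le> (\<Sum>x\<in>N0. \<phi> (- x)) + B" by blast
  have "(\<Sum>x\<in>uminus ` P. \<phi> (- x)) = sum \<phi> P" by (subst sum.reindex) auto
  moreover have "sum \<phi> (uminus ` N0) = (\<Sum>x\<in>N0. \<phi> (- x))" by (subst sum.reindex) auto
  ultimately show ?thesis using N0 by (intro exI[of _ "uminus ` N0"]) auto
qed

lemma interlace_infsum:
  fixes P N :: "real set" and \<phi> :: "real \<Rightarrow> real"
  assumes "P \<subseteq> I" "N \<subseteq> I" "is_interval I"
    "\<And>p p'. p \<in> P \<Longrightarrow> p' \<in> P \<Longrightarrow> p < p' \<Longrightarrow> \<exists>n\<in>N. p < n \<and> n < p'"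
    and mono: "antimono_on I \<phi> \<or> mono_on I \<phi>"
    and B: "\<And>x. x \<in> I \<Longrightarrow> \<phi> x \<le> B" "\<And>x. x \<in> I \<Longrightarrow> 0 \<le> \<phi> x" "0 \<le> B"
    and sm: "\<phi> summable_on N"
  shows "\<phi> summable_on P" "infsum \<phi> P \<le> infsum \<phi> N + B"
proof -
  have bd: "sum \<phi> P0 \<le> infsum \<phi> N + B" if "finite P0" "P0 \<subseteq> P" for P0
  proof -
    have "\<exists>N0. finite N0 \<and> N0 \<subseteq> N \<inter> I \<and> sum \<phi> P0 \<le> sum \<phi> N0 + B"
    proof (rule interlace_finite[OF that(1) _ assms(3) _ mono B(1,3)])
      show "P0 \<subseteq> I" using that assms(1) by blast
      show "\<exists>n\<in>N. p < n \<and> n < p'" if "p \<in> P0" "p' \<in> P0" "p < p'" for p p'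
        using assms(4)[of p p'] that \<open>P0 \<subseteq> P\<close> by blast
    qed
    then obtain N0 where N0: "finite N0" "N0 \<subseteq> N \<inter> I" "sum \<phi> P0 \<le> sum \<phi> N0 + B"
      by blast
    have "sum \<phi> N0 \<le> infsum \<phi> N"
      by (rule finite_sum_le_infsum[OF sm N0(1)]) (use N0(2) B(2) assms(2) in blast)+
    thus ?thesis using N0 by simp
  qed
  have nn: "0 \<le> \<phi> x" if "x \<in> P" for x using B(2) assms(1) that by blast
  have ev: "\<forall>\<^sub>F F in finite_subsets_at_top P. sum \<phi> F \<le> infsum \<phi> N + B"
    by (rule eventually_finite_subsets_at_top_weakI[OF bd])
  show 1: "\<phi> summable_on P"
    by (rule nonneg_bounded_partial_sums_imp_summable_on[OF nn ev])
  show "infsum \<phi> P \<le> infsum \<phi> N + B"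
    by (rule infsum_le_finite_sums[OF 1 bd])
qed

text \<open>Interlacing is only known beyond \<open>a\<close> on either side. The interval is cut
  into a middle piece with finitely many points, estimated term by term, and two outer pieces, where
  the weights are 1 and the two sums differ by at most \<open>B\<close>. What matters is that
  \<open>K\<close> depends on none of \<open>I\<close>, \<open>\<phi>\<close> and
  \<open>B\<close>.\<close>

lemma interlace_weighted_bound:
  fixes P N :: "real set" and \<nu> :: "real \<Rightarrow> real"
  assumes a: "0 \<le> a" and fin: "finite (P \<inter> {-a..a})" "finite (N \<inter> {-a..a})"
    and \<nu>: "\<And>x. 0 \<le> \<nu> x" "\<And>x. x \<in> N \<Longrightarrow> \<bar>x\<bar> > a \<Longrightarrow> \<nu> x = 1"
    and PN: "\<And>p p'. p \<in> P \<Longrightarrow> p' \<in> P \<Longrightarrow> p < p' \<Longrightarrow> a < p \<or> p' < - a \<Longrightarrow> \<exists>n\<in>N. p < n \<and> n < p'"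
    and NP: "\<And>p p'. p \<in> N \<Longrightarrow> p' \<in> N \<Longrightarrow> p < p' \<Longrightarrow> a < p \<or> p' < - a \<Longrightarrow> \<exists>n\<in>P. p < n \<and> n < p'"
  obtains K where "K > 0"
    "\<And>I \<phi> B. is_interval I \<Longrightarrow> antimono_on I \<phi> \<or> mono_on I \<phi> \<Longrightarrow> (\<And>x. x \<in> I \<Longrightarrow> 0 \<le> \<phi> x) \<Longrightarrow>
       (\<And>x. x \<in> I \<Longrightarrow> \<phi> x \<le> B) \<Longrightarrow> 0 \<le> B \<Longrightarrow> \<phi> summable_on (P \<inter> I) \<Longrightarrow>
       (\<lambda>x. \<nu> x * \<phi> x) summable_on (N \<inter> I) \<and>
       \<bar>(\<Sum>\<^sub>\<infinity>x\<in>N \<inter> I. \<nu> x * \<phi> x) - (\<Sum>\<^sub>\<infinity>x\<in>P \<inter> I. \<phi> x)\<bar> \<le> K * B"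
proof -
  \<comment> \<open>Cardinality and total weight pay for the middle piece, the summand 2 for the two
    outer ones.\<close>
  define K where "K = real (card (P \<inter> {-a..a})) + sum \<nu> (N \<inter> {-a..a}) + 2"
  have K: "K > 0" using \<nu> by (auto simp: K_def intro!: add_nonneg_pos add_nonneg_nonneg sum_nonneg)
  have "(\<lambda>x. \<nu> x * \<phi> x) summable_on (N \<inter> I) \<and>
       \<bar>(\<Sum>\<^sub>\<infinity>x\<in>N \<inter> I. \<nu> x * \<phi> x) - (\<Sum>\<^sub>\<infinity>x\<in>P \<inter> I. \<phi> x)\<bar> \<le> K * B"
    if I: "is_interval I" and m: "antimono_on I \<phi> \<or> mono_on I \<phi>" and nn: "\<And>x. x \<in> I \<Longrightarrow> 0 \<le> \<phi> x"
      and le: "\<And>x. x \<in> I \<Longrightarrow> \<phi> x \<le> B" and B: "0 \<le> B" and sm: "\<phi> summable_on (P \<inter> I)" for I \<phi> B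
  proof -
    have piece: "(\<lambda>x. \<nu> x * \<phi> x) summable_on (N \<inter> J) \<and>
       \<bar>(\<Sum>\<^sub>\<infinity>x\<in>N \<inter> J. \<nu> x * \<phi> x) - (\<Sum>\<^sub>\<infinity>x\<in>P \<inter> J. \<phi> x)\<bar> \<le> B"
      if J: "is_interval J" "J \<subseteq> I" "J \<subseteq> {a<..} \<or> J \<subseteq> {..<- a}" "J \<inter> {-a..a} = {}" for J
    proof -
      have mJ: "antimono_on J \<phi> \<or> mono_on J \<phi>" using m J(2) by (blast intro: monotone_on_subset)
      have leJ: "\<phi> x \<le> B" "0 \<le> \<phi> x" if "x \<in> J" for x using le nn J(2) that by auto
      have smJ: "\<phi> summable_on (P \<inter> J)"
        by (rule summable_on_subset_banach[OF sm]) (use J(2) in blast)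
      have 1: "\<exists>n\<in>P \<inter> J. p < n \<and> n < p'" if pp: "p \<in> N \<inter> J" "p' \<in> N \<inter> J" "p < p'" for p p'
      proof -
        have "a < p \<or> p' < - a" using pp(1,2) J(3) by (meson IntD2 greaterThan_iff lessThan_iff subsetD)
        then obtain n where n: "n \<in> P" "p < n" "n < p'" using NP[of p p'] pp by blast
        have "n \<in> J"
          by (rule mem_is_interval_1_I[OF J(1), of p p']) (use pp n in auto)
        thus ?thesis using n by blast
      qed
      have 2: "\<exists>n\<in>N \<inter> J. p < n \<and> n < p'" if pp: "p \<in> P \<inter> J" "p' \<in> P \<inter> J" "p < p'" for p p'
      proof -
        have "a < p \<or> p' < - a" using pp(1,2) J(3) by (meson IntD2 greaterThan_iff lessThan_iff subsetD)
        then obtain n where n: "n \<in> N" "p < n" "n < p'" using PN[of p p'] pp by blast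
        have "n \<in> J"
          by (rule mem_is_interval_1_I[OF J(1), of p p']) (use pp n in auto)
        thus ?thesis using n by blast
      qed
      have A: "\<phi> summable_on (N \<inter> J)" "infsum \<phi> (N \<inter> J) \<le> infsum \<phi> (P \<inter> J) + B"
        using interlace_infsum[OF Int_lower2 Int_lower2 J(1) 1 mJ leJ B smJ] by blast+
      have C: "infsum \<phi> (P \<inter> J) \<le> infsum \<phi> (N \<inter> J) + B"
        using interlace_infsum(2)[OF Int_lower2 Int_lower2 J(1) 2 mJ leJ B A(1)] by blast
      have eq: "\<nu> x * \<phi> x = \<phi> x" if "x \<in> N \<inter> J" for x
      proof -
        have "\<bar>x\<bar> > a" using that J(4) by (auto simp: abs_if)
        thus ?thesis using \<nu>(2) that by simp
      qed
      have "(\<lambda>x. \<nu> x * \<phi> x) summable_on (N \<inter> J)" by (rule iffD2[OF summable_on_cong[OF eq] A(1)])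
      moreover have "(\<Sum>\<^sub>\<infinity>x\<in>N \<inter> J. \<nu> x * \<phi> x) = infsum \<phi> (N \<inter> J)" using eq by (rule infsum_cong)
      ultimately show ?thesis using A C by (simp add: abs_le_iff)
    qed
    define I0 where "I0 = I \<inter> {-a..a}"
    define I1 where "I1 = I \<inter> {a<..}"
    define I2 where "I2 = I \<inter> {..<-a}"
    have parts: "I = I0 \<union> I1 \<union> I2" "I0 \<inter> I1 = {}" "(I0 \<union> I1) \<inter> I2 = {}"
      using a by (auto simp: I0_def I1_def I2_def)
    have int: "is_interval I1" "is_interval I2"
      using I by (auto simp: I1_def I2_def is_interval_1) 
    have p1: "(\<lambda>x. \<nu> x * \<phi> x) summable_on (N \<inter> I1) \<and>
       \<bar>(\<Sum>\<^sub>\<infinity>x\<in>N \<inter> I1. \<nu> x * \<phi> x) - (\<Sum>\<^sub>\<infinity>x\<in>P \<inter> I1. \<phi> x)\<bar> \<le> B"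
      by (rule piece[OF int(1)]) (auto simp: I1_def)
    have p2: "(\<lambda>x. \<nu> x * \<phi> x) summable_on (N \<inter> I2) \<and>
       \<bar>(\<Sum>\<^sub>\<infinity>x\<in>N \<inter> I2. \<nu> x * \<phi> x) - (\<Sum>\<^sub>\<infinity>x\<in>P \<inter> I2. \<phi> x)\<bar> \<le> B"
      by (rule piece[OF int(2)]) (auto simp: I2_def)
    have f0: "finite (P \<inter> I0)" "finite (N \<inter> I0)"
      by (rule finite_subset[OF _ fin(1)] finite_subset[OF _ fin(2)], auto simp: I0_def)+
    have "(\<Sum>x\<in>N \<inter> I0. \<nu> x * \<phi> x) \<le> (\<Sum>x\<in>N \<inter> I0. \<nu> x * B)"
      using le \<nu> by (intro sum_mono mult_left_mono) (auto simp: I0_def)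
    also have "\<dots> \<le> sum \<nu> (N \<inter> {-a..a}) * B"
      unfolding sum_distrib_right[symmetric] using \<nu> B fin
      by (intro mult_right_mono sum_mono2) (auto simp: I0_def)
    finally have n0: "(\<Sum>x\<in>N \<inter> I0. \<nu> x * \<phi> x) \<le> sum \<nu> (N \<inter> {-a..a}) * B" .
    have "(\<Sum>x\<in>P \<inter> I0. \<phi> x) \<le> (\<Sum>x\<in>P \<inter> I0. B)"
      using le by (intro sum_mono) (auto simp: I0_def)
    also have "\<dots> \<le> (\<Sum>x\<in>P \<inter> {-a..a}. B)"
      using B fin by (intro sum_mono2) (auto simp: I0_def)
    finally have p0: "(\<Sum>x\<in>P \<inter> I0. \<phi> x) \<le> real (card (P \<inter> {-a..a})) * B" by simp
    have nn0: "0 \<le> (\<Sum>x\<in>P \<inter> I0. \<phi> x)" "0 \<le> (\<Sum>x\<in>N \<inter> I0. \<nu> x * \<phi> x)"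
      using nn \<nu> by (auto intro!: sum_nonneg mult_nonneg_nonneg simp: I0_def)
    have K0: "\<bar>(\<Sum>x\<in>N \<inter> I0. \<nu> x * \<phi> x) - (\<Sum>x\<in>P \<inter> I0. \<phi> x)\<bar> + 2 * B \<le> K * B"
      using n0 p0 nn0 B by (auto simp: K_def algebra_simps abs_le_iff)
    have sub: "\<phi> summable_on (P \<inter> J)" if "J \<subseteq> I" for J
      by (rule summable_on_subset_banach[OF sm]) (use that in blast)
    have split: "infsum g (S \<inter> I) = infsum g (S \<inter> I0) + infsum g (S \<inter> I1) + infsum g (S \<inter> I2) \<and> g summable_on S \<inter> I"
      if "g summable_on (S \<inter> I0)" "g summable_on (S \<inter> I1)" "g summable_on (S \<inter> I2)" for g :: "real \<Rightarrow> real" and S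
    proof -
      have a: "g summable_on (S \<inter> I0 \<union> S \<inter> I1)" "infsum g (S \<inter> I0 \<union> S \<inter> I1) = infsum g (S \<inter> I0) + infsum g (S \<inter> I1)"
        using summable_on_Un_disjoint[OF that(1,2)] infsum_Un_disjoint[OF that(1,2)] parts by auto
      have "g summable_on ((S \<inter> I0 \<union> S \<inter> I1) \<union> S \<inter> I2)" 
        "infsum g ((S \<inter> I0 \<union> S \<inter> I1) \<union> S \<inter> I2) = infsum g (S \<inter> I0 \<union> S \<inter> I1) + infsum g (S \<inter> I2)"
        using summable_on_Un_disjoint[OF a(1) that(3)] infsum_Un_disjoint[OF a(1) that(3)] parts by auto
      moreover have "(S \<inter> I0 \<union> S \<inter> I1) \<union> S \<inter> I2 = S \<inter> I" using parts by auto
      ultimately show ?thesis using a by simp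
    qed
    have sP: "infsum \<phi> (P \<inter> I) = sum \<phi> (P \<inter> I0) + infsum \<phi> (P \<inter> I1) + infsum \<phi> (P \<inter> I2)"
      using split[of \<phi> P] sub parts(1) f0 by auto
    have sN: "infsum (\<lambda>x. \<nu> x * \<phi> x) (N \<inter> I) = (\<Sum>x\<in>N \<inter> I0. \<nu> x * \<phi> x) + infsum (\<lambda>x. \<nu> x * \<phi> x) (N \<inter> I1) + infsum (\<lambda>x. \<nu> x * \<phi> x) (N \<inter> I2)
       \<and> (\<lambda>x. \<nu> x * \<phi> x) summable_on N \<inter> I"
      using split[of "\<lambda>x. \<nu> x * \<phi> x" N] p1 p2 f0 by auto
    show ?thesis using sN sP p1 p2 K0 by (auto simp: abs_le_iff)
  qed
  thus ?thesis using that K by blast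
qed

section \<open>Functions with only real zeros\<close>

lemma Borel_Caratheodory_half:
  assumes g: "g holomorphic_on ball 0 R" "g 0 = 0" "\<And>z. z \<in> ball 0 R \<Longrightarrow> Re (g z) < A"
    and w: "norm w \<le> R / 2" "R > 0"
  shows "norm (g w) \<le> 2 * A"
proof -
  have A: "A > 0" using g(3)[of 0] g(2) w by auto
  \<comment> \<open>The map \<open>u / (2 * A - u)\<close> sends the half-plane
    \<open>Re u < A\<close> into the unit disc and fixes 0, so the Schwarz lemma applies after
    scaling by \<open>R\<close>; at \<open>norm w \<le> R / 2\<close> it gives a quotient of modulus
    at most 1/2.\<close>
  define \<phi> where "\<phi> = (\<lambda>z. g (of_real R * z) / (of_real (2 * A) - g (of_real R * z)))"
  have in_ball: "of_real R * z \<in> ball 0 R" if "norm z < 1" for z :: complex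
    using that w by (simp add: norm_mult)
  have ne: "of_real (2 * A) - g (of_real R * z) \<noteq> 0" if "norm z < 1" for z
  proof
    assume "of_real (2 * A) - g (of_real R * z) = 0"
    hence "Re (g (of_real R * z)) = 2 * A" by (metis Re_complex_of_real eq_iff_diff_eq_0)
    thus False using g(3)[OF in_ball[OF that]] A by simp
  qed
  have lt: "norm (g z) < norm (of_real (2 * A) - g z)" if "z \<in> ball 0 R" for z
  proof -
    have "(norm (of_real (2 * A) - g z))\<^sup>2 - (norm (g z))\<^sup>2 = 4 * A * (A - Re (g z))"
      unfolding cmod_power2 by (simp add: power2_eq_square algebra_simps)
    also have "\<dots> > 0" using A g(3)[OF that] by simp
    finally show ?thesis by (simp add: power2_less_imp_less)
  qed
  have "\<phi> holomorphic_on ball 0 1"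
    unfolding \<phi>_def
  proof (intro holomorphic_intros)
    show "(\<lambda>z. g (of_real R * z)) holomorphic_on ball 0 1"
      by (rule holomorphic_on_compose_gen[of "\<lambda>z. of_real R * z" _ g "ball 0 R", unfolded o_def])
         (use g in_ball in \<open>auto intro!: holomorphic_intros\<close>)
    thus "(\<lambda>z. g (of_real R * z)) holomorphic_on ball 0 1" .
  qed (use ne in auto)
  moreover have "\<phi> 0 = 0" by (simp add: \<phi>_def g)
  moreover have "norm (\<phi> z) < 1" if "norm z < 1" for z
    unfolding \<phi>_def norm_divide using lt[OF in_ball[OF that]] 
    by (smt (verit, best) divide_less_eq_1_pos norm_ge_zero)
  moreover have "norm (w / of_real R) < 1" using w by (simp add: norm_divide divide_simps)
  ultimately have "norm (\<phi> (w / of_real R)) \<le> norm (w / of_real R)" by (rule Schwarz_Lemma(1))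
  also have "\<dots> \<le> 1 / 2" using w by (simp add: norm_divide divide_simps)
  finally have "norm (g w) / norm (of_real (2 * A) - g w) \<le> 1 / 2"
    using w by (simp add: \<phi>_def norm_divide)
  moreover have "norm (of_real (2 * A) - g w) > 0" using lt[of w] w by (smt (verit) norm_ge_zero mem_ball_0 field_sum_of_halves)
  ultimately have "2 * norm (g w) \<le> norm (of_real (2 * A) - g w)" by (simp add: divide_simps)
  also have "\<dots> \<le> 2 * A + norm (g w)" using A by (metis abs_of_pos mult_pos_pos norm_of_real norm_triangle_ineq4 zero_less_numeral)
  finally show ?thesis by simp
qed

text \<open>A zero-free \<open>h\<close> has a holomorphic logarithm \<open>g\<close> whose real
  part exceeds \<open>Re (g 0)\<close> by at most \<open>a - b\<close>. Borel-Caratheodory turns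
  this into a bound for \<open>g - g 0\<close>, and Cauchy's estimate on discs of radius
  \<open>R / 4\<close> bounds its second derivative, which is the derivative of
  \<open>deriv h / h\<close>.\<close>

lemma deriv_logderiv_le:
  assumes h: "h holomorphic_on ball 0 R" "\<And>z. z \<in> ball 0 R \<Longrightarrow> h z \<noteq> 0"
    and E: "\<And>z. z \<in> ball 0 R \<Longrightarrow> norm (h z) \<le> exp a" "exp b \<le> norm (h 0)"
    and R: "R > 0" "norm w < R / 4"
  shows "norm (deriv (\<lambda>z. deriv h z / h z) w) \<le> 96 * (a - b + 1) / R\<^sup>2"
proof -
  obtain g where g: "g holomorphic_on ball 0 R" "\<And>z. z \<in> ball 0 R \<Longrightarrow> exp (g z) = h z"
    using holomorphic_logarithm_exists[of "ball 0 R" h 0] h R by auto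
  have ab: "exp b \<le> exp a" by (rule order_trans[OF E(2) E(1)]) (use R in simp)
  \<comment> \<open>The extra 1 makes the bound on the real part strict; below, \<open>3 * A\<close>
    replaces \<open>2 * A\<close> for the same reason, and \<open>2 * 3 * 16 = 96\<close> gives the
    constant.\<close>
  define A where "A = a - b + 1"
  have A: "A > 0" using ab by (simp add: A_def)
  have Re: "Re (g z - g 0) < A" if "z \<in> ball 0 R" for z
  proof -
    have "exp (Re (g z)) \<le> exp a" using E(1)[OF that] g(2)[OF that] by (metis norm_exp_eq_Re)
    moreover have "exp b \<le> exp (Re (g 0))" using E(2) g(2)[of 0] R by (metis norm_exp_eq_Re centre_in_ball)
    ultimately show ?thesis by (simp add: A_def)
  qed
  have bd: "norm (g z - g 0) \<le> 2 * A" if "norm z \<le> R / 2" for z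
    by (rule Borel_Caratheodory_half[of _ R]) (use g Re that R in \<open>auto intro!: holomorphic_intros\<close>)
  have ev: "eventually (\<lambda>z. deriv h z / h z = deriv g z) (nhds w)"
  proof -
    have "eventually (\<lambda>z. z \<in> ball 0 R) (nhds w)" using R by (intro eventually_nhds_in_open) auto
    thus ?thesis
    proof eventually_elim
      case (elim z)
      have "((\<lambda>z. exp (g z)) has_field_derivative exp (g z) * deriv g z) (at z)"
        by (rule DERIV_fun_exp holomorphic_derivI[OF g(1)])+ (use elim in auto)
      moreover have "((\<lambda>z. exp (g z)) has_field_derivative D) (at z) \<longleftrightarrow> (h has_field_derivative D) (at z)" for D
        by (rule DERIV_cong_ev) (use g elim in \<open>auto intro!: eventually_mono[OF eventually_nhds_in_open[of "ball 0 R" z]]\<close>)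
      ultimately have "deriv h z = exp (g z) * deriv g z" by (simp add: DERIV_imp_deriv)
      thus ?case using g(2)[OF elim] h(2)[OF elim] by simp
    qed
  qed
  have "deriv (\<lambda>z. deriv h z / h z) w = (deriv ^^ 2) g w"
    using deriv_cong_ev[OF ev refl] by (simp add: numeral_2_eq_2)
  also have "norm \<dots> \<le> fact 2 * (3 * A) / (R / 4) ^ 2"
  proof (rule Cauchy_higher_deriv_bound)
    have sub: "cball w (R / 4) \<subseteq> cball 0 (R / 2)"
      using R by (intro cball_subset_cball_iff[THEN iffD2]) (auto simp: dist_norm)
    have sub': "cball w (R / 4) \<subseteq> ball 0 R"
      by (rule subset_trans[OF sub]) (use R in auto)
    show "g holomorphic_on ball w (R / 4)"
      using sub' by (intro holomorphic_on_subset[OF g(1)]) auto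
    show "continuous_on (cball w (R / 4)) g"
      by (intro holomorphic_on_imp_continuous_on holomorphic_on_subset[OF g(1)] sub')
    show "g u \<in> ball (g 0) (3 * A)" if "u \<in> ball w (R / 4)" for u
    proof -
      have "norm u \<le> R / 2" using sub that by force
      thus ?thesis using bd[of u] A by (simp add: dist_norm norm_minus_commute)
    qed
  qed (use R in auto)
  also have "\<dots> = 96 * A / R\<^sup>2" using R by (simp add: power2_eq_square field_simps)
  finally show ?thesis by (simp add: A_def)
qed

text \<open>For a symmetric \<open>g\<close> the difference of the values at \<open>w\<close> and
  its conjugate is \<open>2 * \<i> * Im (g w)\<close>, so a derivative bound yields a bound
  proportional to \<open>Im w\<close>. This is how error terms of holomorphic origin acquire the
  factor \<open>y\<close>.\<close>

lemma Im_le_deriv_bound: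
  assumes "convex S" "w \<in> S" "cnj w \<in> S" "g (cnj w) = cnj (g w)"
    and "\<And>z. z \<in> S \<Longrightarrow> (g has_field_derivative g' z) (at z)" "\<And>z. z \<in> S \<Longrightarrow> norm (g' z) \<le> B"
  shows "\<bar>Im (g w)\<bar> \<le> B * \<bar>Im w\<bar>"
proof -
  have "norm (g w - g (cnj w)) \<le> B * norm (w - cnj w)"
    by (rule field_differentiable_bound[OF assms(1) has_field_derivative_at_within[OF assms(5)] assms(6)]) (use assms in auto)
  moreover have "g w - g (cnj w) = 2 * \<i> * of_real (Im (g w))" "w - cnj w = 2 * \<i> * of_real (Im w)"
    by (auto simp: assms(4) complex_eq_iff)
  ultimately show ?thesis by (simp add: norm_mult)
qed

lemma deriv_cnj:
  assumes "open U" "w \<in> U" "f holomorphic_on U" "\<And>z. z \<in> U \<Longrightarrow> cnj z \<in> U" "\<And>z. z \<in> U \<Longrightarrow> f (cnj z) = cnj (f z)"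
  shows "deriv f (cnj w) = cnj (deriv f w)"
proof -
  have "(f has_field_derivative deriv f w) (at w)" using assms holomorphic_derivI by blast
  hence "((cnj \<circ> f \<circ> cnj) has_field_derivative cnj (deriv f w)) (at (cnj w))"
    using has_field_derivative_cnj_cnj[of f "deriv f w" "cnj w"] by simp
  moreover have "((cnj \<circ> f \<circ> cnj) has_field_derivative D) (at (cnj w)) \<longleftrightarrow> (f has_field_derivative D) (at (cnj w))" for D
    by (rule DERIV_cong_ev) (use assms in \<open>auto intro!: eventually_mono[OF eventually_nhds_in_open[of U "cnj w"]]\<close>)
  ultimately show ?thesis by (simp add: DERIV_imp_deriv)
qed

section \<open>Entire functions with real zeros: Blaschke quotient and sum over the zeros\<close>

locale real_rooted_entire =
  fixes f :: "complex \<Rightarrow> complex"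
  assumes holo: "f holomorphic_on UNIV"
    and cnj: "\<And>z. f (cnj z) = cnj (f z)"
    and zeros: "\<And>z. f z = 0 \<Longrightarrow> Im z = 0"
    and growth: "\<And>e. e > 0 \<Longrightarrow> \<exists>C. \<forall>z. norm (f z) \<le> C * exp (e * (norm z)\<^sup>2)"
    and f0: "f 0 \<noteq> 0"
begin

abbreviation m :: "real \<Rightarrow> nat" where "m x \<equiv> zmult f (of_real x)"

definition Z :: "real \<Rightarrow> real set" where "Z R = {x. \<bar>x\<bar> < R \<and> f (of_real x) = 0}"

lemma finite_Z: "finite (Z R)"
proof -
  have "finite {z \<in> cball 0 R. f z = 0}"
  proof (cases "f constant_on UNIV")
    case True
    then obtain c where "f = (\<lambda>_. c)" by (auto simp: constant_on_def)
    thus ?thesis using f0 by simp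
  next
    case False
    thus ?thesis by (intro holomorphic_compact_finite_zeros[OF holo]) auto
  qed
  hence "finite (Re ` {z \<in> cball 0 R. f z = 0})" by simp
  moreover have "Z R \<subseteq> Re ` {z \<in> cball 0 R. f z = 0}"
  proof
    fix x assume "x \<in> Z R"
    thus "x \<in> Re ` {z \<in> cball 0 R. f z = 0}"
      by (intro image_eqI[of _ _ "of_real x"]) (auto simp: Z_def)
  qed
  ultimately show ?thesis by (rule finite_subset[rotated])
qed

lemma Z_nonzero: "x \<in> Z R \<Longrightarrow> x \<noteq> 0"
  using f0 by (auto simp: Z_def)

text \<open>\<open>k\<close> is \<open>f\<close> divided by the Blaschke product of its zeros in the
  disc of radius \<open>R\<close>: on the circle both have the same modulus, so the bound
  \<open>E\<close> passes to \<open>k\<close> inside by the maximum principle. At 0 the quotient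
  exceeds \<open>f\<close> by Jensen's product, and its logarithmic derivative differs by the zeros
  and their mirror images \<open>R^2 / x\<close>.\<close>

lemma blaschke:
  assumes R: "R > 0" and E: "\<And>z. norm z = R \<Longrightarrow> norm (f z) \<le> E"
  obtains k where "k holomorphic_on UNIV" "\<And>z. z \<in> ball 0 R \<Longrightarrow> k z \<noteq> 0"
    "\<And>z. z \<in> ball 0 R \<Longrightarrow> norm (k z) \<le> E"
    "norm (k 0) = norm (f 0) * (\<Prod>x\<in>Z R. (R / \<bar>x\<bar>) ^ m x)"
    "\<And>w. w \<in> ball 0 R \<Longrightarrow> f w \<noteq> 0 \<Longrightarrow> deriv k w / k w = deriv f w / f w -
        (\<Sum>x\<in>Z R. of_nat (m x) * (1 / (w - of_real x) + of_real x / (of_real (R\<^sup>2) - of_real x * w)))"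
proof -
  define S where "S = complex_of_real ` Z R"
  obtain h where h: "h holomorphic_on UNIV" "\<And>z. z \<in> S \<Longrightarrow> h z \<noteq> 0"
    "\<And>w. f w = (\<Prod>z\<in>S. (w - z) ^ zmult f z) * h w"
    using zmult_factor_finite[OF holo _ _ _ f0, of S] finite_Z[of R] by (auto simp: S_def)
  have fh: "f w = (\<Prod>x\<in>Z R. (w - of_real x) ^ m x) * h w" for w
    using h(3)[of w] by (simp add: S_def prod.reindex inj_on_def)
  \<comment> \<open>The mirror images \<open>R^2 / x\<close> are written as monic linear factors so
    that \<open>logderiv_prod_power\<close> applies to \<open>k\<close>; the constant
    \<open>c\<close> restores the Blaschke normalisation, as \<open>k_alt\<close> shows.\<close>
  define c :: complex where "c = (\<Prod>x\<in>Z R. (- of_real x / of_real R) ^ m x)"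
  define k where "k = (\<lambda>w. (\<Prod>x\<in>Z R. (w - of_real (R\<^sup>2 / x)) ^ m x) * (c * h w))"
  have k_alt: "k w = (\<Prod>x\<in>Z R. ((of_real (R\<^sup>2) - of_real x * w) / of_real R) ^ m x) * h w" for w
  proof -
    have "(w - of_real (R\<^sup>2 / x)) * (- of_real x / of_real R) = (of_real (R\<^sup>2) - of_real x * w) / of_real R"
      if "x \<in> Z R" for x
      using Z_nonzero[OF that] R by (simp add: field_simps)
    thus ?thesis by (simp add: k_def c_def mult_ac flip: prod.distrib power_mult_distrib)
  qed
  have k1: "k holomorphic_on UNIV" unfolding k_def using h(1) by (intro holomorphic_intros)
  have ne: "of_real (R\<^sup>2) - of_real x * w \<noteq> 0" if "x \<in> Z R" "w \<in> ball 0 R" for x and w :: complex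
  proof
    assume "of_real (R\<^sup>2) - of_real x * w = 0"
    hence "norm (of_real (R\<^sup>2) :: complex) = norm (of_real x * w)" by simp
    hence "R\<^sup>2 = \<bar>x\<bar> * norm w" by (simp add: norm_mult norm_power)
    moreover have "\<bar>x\<bar> * norm w < R * R" using that by (intro mult_strict_mono') (auto simp: Z_def)
    ultimately show False by (simp add: power2_eq_square)
  qed
  have h_ne: "h w \<noteq> 0" if "w \<in> ball 0 R" for w
  proof
    assume hw: "h w = 0"
    hence fw: "f w = 0" by (simp add: fh)
    hence "w = of_real (Re w)" using zeros by (simp add: complex_eq_iff)
    moreover have "\<bar>Re w\<bar> < R" using that abs_Re_le_cmod[of w] by simp
    ultimately have "w \<in> S" using fw by (auto simp: S_def Z_def image_iff intro!: bexI[of _ "Re w"])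
    thus False using h(2) hw by blast
  qed
  have k2: "k z \<noteq> 0" if "z \<in> ball 0 R" for z
    using ne[OF _ that] h_ne[OF that] R finite_Z by (auto simp: k_alt)
  have kE: "norm (k z) \<le> E" if "norm z = R" for z
  proof -
    have "norm ((of_real (R\<^sup>2) - of_real x * z) / of_real R) = norm (z - of_real x)" for x
    proof -
      have "of_real (R\<^sup>2) = z * cnj z" using that by (simp add: complex_norm_square[symmetric])
      hence "of_real (R\<^sup>2) - of_real x * z = z * cnj (z - of_real x)" by (simp add: algebra_simps)
      hence "norm (of_real (R\<^sup>2) - of_real x * z) = R * norm (z - of_real x)"
        by (metis norm_mult complex_mod_cnj that)
      thus ?thesis using R by (simp add: norm_divide)
    qed
    hence "norm (k z) = norm (f z)" by (simp add: k_alt fh norm_mult norm_power prod_norm[symmetric])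
    thus ?thesis using E that by simp
  qed
  have k3: "norm (k z) \<le> E" if "z \<in> ball 0 R" for z
    by (rule maximum_modulus_frontier[of k "ball 0 R"])
       (use k1 kE that R in \<open>auto simp: frontier_ball intro: holomorphic_on_subset holomorphic_on_imp_continuous_on\<close>)
  have k4: "norm (k 0) = norm (f 0) * (\<Prod>x\<in>Z R. (R / \<bar>x\<bar>) ^ m x)"
  proof -
    have "norm (k 0) = norm (h 0) * (\<Prod>x\<in>Z R. R ^ m x)" using R
      by (simp add: k_alt norm_mult norm_power norm_divide prod_norm[symmetric] power2_eq_square)
    also have "(\<Prod>x\<in>Z R. R ^ m x) = (\<Prod>x\<in>Z R. \<bar>x\<bar> ^ m x) * (\<Prod>x\<in>Z R. (R / \<bar>x\<bar>) ^ m x)"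
      using Z_nonzero by (auto simp flip: prod.distrib power_mult_distrib intro!: prod.cong)
    finally show ?thesis by (simp add: fh norm_mult norm_power prod_norm[symmetric])
  qed
  have k5: "deriv k w / k w = deriv f w / f w -
        (\<Sum>x\<in>Z R. of_nat (m x) * (1 / (w - of_real x) + of_real x / (of_real (R\<^sup>2) - of_real x * w)))"
    if w: "w \<in> ball 0 R" "f w \<noteq> 0" for w
  proof -
    have c: "c \<noteq> 0" using Z_nonzero R finite_Z by (auto simp: c_def)
    have dh: "deriv (\<lambda>w. c * h w) w = c * deriv h w"
      by (rule deriv_cmult) (use h(1) in \<open>auto simp: holomorphic_on_def\<close>)
    have "w \<noteq> of_real (R\<^sup>2 / x)" if "x \<in> Z R" for x
      using ne[OF that w(1)] Z_nonzero[OF that] by (auto simp: field_simps)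
    hence "deriv k w / k w = (\<Sum>x\<in>Z R. of_nat (m x) / (w - of_real (R\<^sup>2 / x))) + deriv (\<lambda>w. c * h w) w / (c * h w)"
      by (intro logderiv_prod_power[OF finite_Z open_UNIV]) (use h(1) k2[OF w(1)] in \<open>auto simp: k_def intro!: holomorphic_intros\<close>)
    also have "deriv (\<lambda>w. c * h w) w / (c * h w) = deriv h w / h w" using c dh by simp
    also have "(\<Sum>x\<in>Z R. of_nat (m x) / (w - of_real (R\<^sup>2 / x))) = - (\<Sum>x\<in>Z R. of_nat (m x) * (of_real x / (of_real (R\<^sup>2) - of_real x * w)))"
      unfolding sum_negf[symmetric]
    proof (intro sum.cong refl)
      fix x assume x: "x \<in> Z R"
      have "w - of_real (R\<^sup>2 / x) = - ((of_real (R\<^sup>2) - of_real x * w) / of_real x)"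
        using Z_nonzero[OF x] by (simp add: field_simps)
      thus "of_nat (m x) / (w - of_real (R\<^sup>2 / x)) = - (of_nat (m x) * (of_real x / (of_real (R\<^sup>2) - of_real x * w)))"
        by simp
    qed
    finally have 1: "deriv k w / k w = deriv h w / h w - (\<Sum>x\<in>Z R. of_nat (m x) * (of_real x / (of_real (R\<^sup>2) - of_real x * w)))"
      by simp
    have "deriv f w / f w = (\<Sum>x\<in>Z R. of_nat (m x) / (w - of_real x)) + deriv h w / h w"
      by (rule logderiv_prod_power[OF finite_Z open_UNIV UNIV_I h(1) w(2) fh]) (use w(2) in \<open>auto simp: Z_def\<close>)
    thus ?thesis using 1 by (simp add: sum.distrib algebra_simps)
  qed
  show ?thesis using that[OF k1 k2 k3 k4 k5] by blast
qed

text \<open>Jensen's inequality: in the Blaschke quotient for radius \<open>2 * R\<close> each zero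
  of modulus below \<open>R\<close> contributes a factor of at least 2 at the origin, and the
  product is bounded by the maximum of \<open>f\<close> on the larger circle.\<close>

lemma count_zeros:
  assumes R: "R > 0" and C: "C > 0" "\<And>z. norm (f z) \<le> C * exp (d * (norm z)\<^sup>2)"
  shows "real (\<Sum>x\<in>Z R. m x) * ln 2 \<le> ln C + 4 * d * R\<^sup>2 - ln (norm (f 0))"
proof -
  define E where "E = C * exp (d * (2 * R)\<^sup>2)"
  have pos: "2 * R > 0" using R by simp
  have bd: "norm (f z) \<le> E" if "norm z = 2 * R" for z using C(2)[of z] that by (simp add: E_def)
  obtain k :: "complex \<Rightarrow> complex" where k: "\<And>z. z \<in> ball 0 (2 * R) \<Longrightarrow> norm (k z) \<le> E"
     "norm (k 0) = norm (f 0) * (\<Prod>x\<in>Z (2 * R). (2 * R / \<bar>x\<bar>) ^ m x)"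
    by (rule blaschke[OF pos bd], assumption, rule that; assumption)
  have "2 ^ (\<Sum>x\<in>Z R. m x) = (\<Prod>x\<in>Z R. (2::real) ^ m x)" by (simp add: power_sum)
  also have "\<dots> \<le> (\<Prod>x\<in>Z R. (2 * R / \<bar>x\<bar>) ^ m x)"
    using Z_nonzero by (intro prod_mono conjI power_mono) (auto simp: Z_def field_simps)
  also have "\<dots> \<le> (\<Prod>x\<in>Z (2 * R). (2 * R / \<bar>x\<bar>) ^ m x)"
  proof (rule prod_mono2[OF finite_Z])
    show "Z R \<subseteq> Z (2 * R)" using R by (auto simp: Z_def)
    show "1 \<le> (2 * R / \<bar>x\<bar>) ^ m x" if "x \<in> Z (2 * R) - Z R" for x
      using that Z_nonzero[of x "2 * R"] by (intro one_le_power) (auto simp: Z_def divide_simps)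
    show "0 \<le> (2 * R / \<bar>x\<bar>) ^ m x" for x using R by simp
  qed
  finally have "norm (f 0) * 2 ^ (\<Sum>x\<in>Z R. m x) \<le> norm (k 0)"
    unfolding k(2) by (intro mult_left_mono) auto
  also have "\<dots> \<le> E" using k(1) R by simp
  finally have le: "norm (f 0) * 2 ^ (\<Sum>x\<in>Z R. m x) \<le> E" .
  have "ln (norm (f 0) * 2 ^ (\<Sum>x\<in>Z R. m x)) \<le> ln E"
    using le f0 by (intro ln_mono) auto
  moreover have "ln E = ln C + 4 * d * R\<^sup>2"
    using C by (simp add: E_def ln_mult power2_eq_square)
  moreover have "ln (norm (f 0) * 2 ^ (\<Sum>x\<in>Z R. m x)) = ln (norm (f 0)) + real (\<Sum>x\<in>Z R. m x) * ln 2"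
    using f0 by (simp add: ln_mult ln_realpow)
  ultimately show ?thesis by simp
qed


lemma m_eq_0: "f (of_real x) \<noteq> 0 \<Longrightarrow> m x = 0"
  using zmult_pos_iff[OF holo, of "of_real x" 0] f0 by auto

text \<open>On a disc of large radius \<open>R\<close>, \<open>f\<close> splits into a zero-free
  quotient and its Blaschke product. Growth below every \<open>exp (d * R^2)\<close> keeps
  \<open>ln E\<close> and the number of zeros at a multiple of \<open>d * R^2\<close> plus a
  constant, so the quotient and the mirror images contribute a multiple of \<open>d\<close> plus
  \<open>O(1 / R^2)\<close> to \<open>Im (f' / f) / Im w\<close>. Only the zeros themselves
  remain.\<close>

lemma Im_logderiv_approx:
  assumes w: "Im w \<noteq> 0" and e: "e > 0"
  shows "\<exists>R0. \<forall>R\<ge>R0. \<bar>Im (deriv f w / f w) / Im w + (\<Sum>x\<in>Z R. real (m x) / ((Re w - x)\<^sup>2 + (Im w)\<^sup>2))\<bar> \<le> e"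
proof -
  \<comment> \<open>The quotient costs \<open>96 * d\<close> and the mirror images
    \<open>32 * d\<close>, together \<open>e / 4\<close>; the terms of size \<open>D / R^2\<close>
    are at most \<open>e / 2\<close> for \<open>R \<ge> R0\<close>.\<close>
  define d where "d = e / 512"
  have d: "d > 0" using e by (simp add: d_def)
  obtain C where C: "\<And>z. norm (f z) \<le> C * exp (d * (norm z)\<^sup>2)" using growth[OF d] by blast
  have C0: "C > 0" using C[of 0] f0 by (simp add: order.strict_trans2[of 0 "norm (f 0)"])
  define b where "b = ln (norm (f 0))"
  define D where "D = \<bar>96 * (ln C - b + 1) + 8 * (ln C - b)\<bar>"
  define R0 where "R0 = 1 + 4 * norm w + 2 * D / e"
  have "\<bar>Im (deriv f w / f w) / Im w + (\<Sum>x\<in>Z R. real (m x) / ((Re w - x)\<^sup>2 + (Im w)\<^sup>2))\<bar> \<le> e" if R: "R \<ge> R0" for R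
  proof -
    have "D \<ge> 0" by (simp add: D_def)
    hence "0 \<le> 2 * D / e" using e by simp
    hence R1: "R \<ge> 1" "4 * norm w < R" "2 * D / e \<le> R"
      using R[unfolded R0_def] norm_ge_zero[of w] by linarith+
    have Rsq: "R \<le> R\<^sup>2" "R > 0" using R1 by (auto simp: power2_eq_square)
    have "D * 2 \<le> R * e" using R1(3) e by (simp add: pos_divide_le_eq mult.commute)
    also have "\<dots> \<le> R\<^sup>2 * e" using Rsq e by (intro mult_right_mono) auto
    finally have DR: "D / R\<^sup>2 \<le> e / 2" using Rsq by (simp add: field_simps)
    define E where "E = C * exp (d * R\<^sup>2)"
    have bd: "norm (f z) \<le> E" if "norm z = R" for z using C[of z] that by (simp add: E_def)
    define T where "T = (\<lambda>w. \<Sum>x\<in>Z R. of_nat (m x) * (1 / (w - of_real x) + of_real x / (of_real (R\<^sup>2) - of_real x * w)) :: complex)"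
    obtain k where k: "k holomorphic_on UNIV" "\<And>z. z \<in> ball 0 R \<Longrightarrow> k z \<noteq> 0"
      "\<And>z. z \<in> ball 0 R \<Longrightarrow> norm (k z) \<le> E"
      "norm (k 0) = norm (f 0) * (\<Prod>x\<in>Z R. (R / \<bar>x\<bar>) ^ m x)"
      "\<And>w. w \<in> ball 0 R \<Longrightarrow> f w \<noteq> 0 \<Longrightarrow> deriv k w / k w = deriv f w / f w - T w"
      by (rule blaschke[OF Rsq(2) bd], assumption, rule that, assumption+, unfold T_def, assumption)
    have fw: "f w \<noteq> 0" "f (cnj w) \<noteq> 0" using zeros[of w] zeros[of "cnj w"] w by auto
    have wR: "w \<in> ball 0 R" "cnj w \<in> ball 0 R" using R1 Rsq by auto
    define L where "L = (\<lambda>z. deriv k z / k z)"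
    have Lcnj: "L (cnj w) = cnj (L w)"
    proof -
      have "deriv f (cnj w) = cnj (deriv f w)" by (rule deriv_cnj[OF open_UNIV]) (use holo cnj in auto)
      thus ?thesis unfolding L_def k(5)[OF wR(1) fw(1)] k(5)[OF wR(2) fw(2)] by (simp add: T_def cnj)
    qed
    have kb: "exp b \<le> norm (k 0)"
    proof -
      have "1 \<le> (\<Prod>x\<in>Z R. (R / \<bar>x\<bar>) ^ m x)"
      proof (intro prod_ge_1 one_le_power)
        fix x assume "x \<in> Z R" thus "1 \<le> R / \<bar>x\<bar>" using Z_nonzero[of x R] by (auto simp: Z_def divide_simps)
      qed
      hence "norm (f 0) * 1 \<le> norm (k 0)" unfolding k(4) by (rule mult_left_mono) auto
      thus ?thesis using f0 by (simp add: b_def)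
    qed
    have kE: "norm (k z) \<le> exp (ln C + d * R\<^sup>2)" if "z \<in> ball 0 R" for z
      using k(3)[OF that] C0 by (simp add: E_def exp_add)
    define B where "B = 96 * (ln C + d * R\<^sup>2 - b + 1) / R\<^sup>2"
    have "\<bar>Im (L w)\<bar> \<le> B * \<bar>Im w\<bar>"
    proof (rule Im_le_deriv_bound[of "ball 0 (R / 4)"])
      fix z :: complex assume z: "z \<in> ball 0 (R / 4)"
      hence zR: "z \<in> ball 0 R" using Rsq by auto
      have "L holomorphic_on ball 0 R" unfolding L_def
        by (intro holomorphic_intros holomorphic_deriv) (use k in \<open>auto intro: holomorphic_on_subset\<close>)
      thus "(L has_field_derivative deriv L z) (at z)" using zR holomorphic_derivI by blast
      show "norm (deriv L z) \<le> B" unfolding L_def B_def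
        by (rule deriv_logderiv_le[where h = k and R = R and a = "ln C + d * R\<^sup>2" and b = b, OF _ k(2) kE kb Rsq(2)]) (use k(1) z in \<open>auto intro: holomorphic_on_subset\<close>)
    qed (use Lcnj R1 in auto)
    hence 1: "\<bar>Im (L w) / Im w\<bar> \<le> B" using w by (simp add: divide_simps)
    define q where "q = (\<lambda>x. x\<^sup>2 / (norm (of_real (R\<^sup>2) - of_real x * w))\<^sup>2)"
    have ImT: "Im (T w) / Im w = (\<Sum>x\<in>Z R. real (m x) * q x) - (\<Sum>x\<in>Z R. real (m x) / ((Re w - x)\<^sup>2 + (Im w)\<^sup>2))"
      unfolding T_def Im_sum sum_divide_distrib sum_subtractf[symmetric]
    proof (intro sum.cong refl)
      fix x
      have a: "Im (1 / (w - of_real x)) = - Im w / ((Re w - x)\<^sup>2 + (Im w)\<^sup>2)"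
        by (simp add: Im_divide)
      have b: "Im (of_real x / (of_real (R\<^sup>2) - of_real x * w)) = Im w * q x"
        by (simp add: Im_divide q_def cmod_power2) (simp add: power2_eq_square)
      have "Im (of_nat (m x) * (1 / (w - of_real x) + of_real x / (of_real (R\<^sup>2) - of_real x * w))) =
        real (m x) * (- Im w / ((Re w - x)\<^sup>2 + (Im w)\<^sup>2) + Im w * q x)"
        using a b by simp
      thus "Im (of_nat (m x) * (1 / (w - of_real x) + of_real x / (of_real (R\<^sup>2) - of_real x * w))) / Im w =
        real (m x) * q x - real (m x) / ((Re w - x)\<^sup>2 + (Im w)\<^sup>2)"
        using w by (simp add: field_simps)
    qed
    define N where "N = real (\<Sum>x\<in>Z R. m x)"
    have N: "N * ln 2 \<le> ln C + 4 * d * R\<^sup>2 - b"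
      unfolding N_def b_def by (rule count_zeros[OF Rsq(2) C0 C])
    have "1 / 2 \<le> ln (2::real)" by (subst ln_ge_iff) (use exp_half_le2 in auto)
    hence "N * (1 / 2) \<le> N * ln 2" by (intro mult_left_mono) (auto simp: N_def intro!: sum_nonneg)
    hence N': "N \<le> 2 * (ln C + 4 * d * R\<^sup>2 - b)" using N by simp
    have "(\<Sum>x\<in>Z R. real (m x) * q x) \<le> (\<Sum>x\<in>Z R. real (m x) * (4 / R\<^sup>2))"
    proof (intro sum_mono mult_left_mono)
      fix x assume x: "x \<in> Z R"
      have "\<bar>x\<bar> * norm w \<le> R * (R / 2)" using x R1 by (intro mult_mono) (auto simp: Z_def)
      hence "R\<^sup>2 / 2 \<le> norm (of_real (R\<^sup>2) :: complex) - norm (of_real x * w)"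
        using Rsq by (simp add: norm_mult norm_power power2_eq_square)
      also have "\<dots> \<le> norm (of_real (R\<^sup>2) - of_real x * w)" by (rule norm_triangle_ineq2)
      finally have ge: "R\<^sup>2 / 2 \<le> norm (of_real (R\<^sup>2) - of_real x * w)" .
      have "x\<^sup>2 \<le> R\<^sup>2" using x Rsq by (auto simp: Z_def abs_le_square_iff[symmetric])
      moreover have "(R\<^sup>2 / 2)\<^sup>2 \<le> (norm (of_real (R\<^sup>2) - of_real x * w))\<^sup>2" using ge by (intro power_mono) auto
      ultimately have "q x \<le> R\<^sup>2 / (R\<^sup>2 / 2)\<^sup>2" unfolding q_def using Rsq by (intro frac_le) auto
      also have "\<dots> = 4 / R\<^sup>2" using Rsq by (simp add: power2_eq_square field_simps)
      finally show "q x \<le> 4 / R\<^sup>2" .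
    qed auto
    also have "\<dots> = N * (4 / R\<^sup>2)" by (simp only: N_def of_nat_sum sum_distrib_right)
    also have "\<dots> \<le> 2 * (ln C + 4 * d * R\<^sup>2 - b) * (4 / R\<^sup>2)" using N' by (intro mult_right_mono) auto
    finally have q: "(\<Sum>x\<in>Z R. real (m x) * q x) \<le> 8 * (ln C + 4 * d * R\<^sup>2 - b) / R\<^sup>2" by simp
    have q0: "0 \<le> (\<Sum>x\<in>Z R. real (m x) * q x)" by (intro sum_nonneg) (auto simp: q_def)
    have tot: "B + 8 * (ln C + 4 * d * R\<^sup>2 - b) / R\<^sup>2 \<le> e"
    proof -
      have "B + 8 * (ln C + 4 * d * R\<^sup>2 - b) / R\<^sup>2 = (96 * (ln C - b + 1) + 8 * (ln C - b)) / R\<^sup>2 + 128 * d"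
        using Rsq by (simp add: B_def field_simps)
      also have "\<dots> \<le> D / R\<^sup>2 + 128 * d" by (intro add_right_mono divide_right_mono) (auto simp: D_def)
      also have "\<dots> \<le> e" using DR e by (simp add: d_def)
      finally show ?thesis .
    qed
    have "Im (deriv f w / f w) = Im (L w) + Im (T w)" unfolding L_def k(5)[OF wR(1) fw(1)] by simp
    hence fin: "Im (deriv f w / f w) / Im w + (\<Sum>x\<in>Z R. real (m x) / ((Re w - x)\<^sup>2 + (Im w)\<^sup>2)) =
      Im (L w) / Im w + (\<Sum>x\<in>Z R. real (m x) * q x)"
      using ImT by (simp add: add_divide_distrib)
    show ?thesis unfolding fin using 1 q q0 tot by linarith
  qed
  thus ?thesis by blast
qed

text \<open>The approximation only gives convergence over growing discs; as the terms are
  nonnegative, the limit dominates every finite partial sum and summability is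
  unconditional.\<close>

lemma Im_logderiv_has_sum:
  assumes w: "Im w \<noteq> 0"
  shows "((\<lambda>x. real (m x) / ((Re w - x)\<^sup>2 + (Im w)\<^sup>2)) has_sum (- Im (deriv f w / f w) / Im w)) UNIV"
proof -
  define \<phi> where "\<phi> = (\<lambda>x. real (m x) / ((Re w - x)\<^sup>2 + (Im w)\<^sup>2))"
  define s where "s = - Im (deriv f w / f w) / Im w"
  have nn: "0 \<le> \<phi> x" for x by (auto simp: \<phi>_def)
  have approx: "\<exists>R0. \<forall>R\<ge>R0. \<bar>sum \<phi> (Z R) - s\<bar> \<le> e" if "e > 0" for e
    using Im_logderiv_approx[OF w that] by (simp add: \<phi>_def s_def add.commute)
  have le: "sum \<phi> F \<le> s" if F: "finite F" for F
  proof (rule field_le_epsilon)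
    fix e :: real assume "e > 0"
    then obtain R0 where R0: "\<And>R. R \<ge> R0 \<Longrightarrow> \<bar>sum \<phi> (Z R) - s\<bar> \<le> e" using approx by blast
    define R where "R = max R0 (1 + (\<Sum>x\<in>F. \<bar>x\<bar>))"
    have "sum \<phi> F = sum \<phi> (F \<inter> {x. f (of_real x) = 0})"
      by (rule sum.mono_neutral_right[OF F]) (auto simp: \<phi>_def m_eq_0)
    also have "\<dots> \<le> sum \<phi> (Z R)"
    proof (rule sum_mono2[OF finite_Z])
      show "F \<inter> {x. f (of_real x) = 0} \<subseteq> Z R"
      proof
        fix x assume x: "x \<in> F \<inter> {x. f (of_real x) = 0}"
        hence "\<bar>x\<bar> \<le> (\<Sum>x\<in>F. \<bar>x\<bar>)" using F by (intro member_le_sum) auto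
        thus "x \<in> Z R" using x by (auto simp: Z_def R_def)
      qed
    qed (use nn in auto)
    also have "\<dots> \<le> s + e" using R0[of R] by (simp add: R_def abs_le_iff)
    finally show "sum \<phi> F \<le> s + e" .
  qed
  have sm: "\<phi> summable_on UNIV"
    by (rule nonneg_bounded_partial_sums_imp_summable_on[where C = s])
       (use nn le in \<open>auto intro!: eventually_finite_subsets_at_top_weakI\<close>)
  have "infsum \<phi> UNIV \<le> s" by (rule infsum_le_finite_sums[OF sm]) (use le in auto)
  moreover have "s \<le> infsum \<phi> UNIV"
  proof (rule field_le_epsilon)
    fix e :: real assume "e > 0"
    then obtain R0 where R0: "\<And>R. R \<ge> R0 \<Longrightarrow> \<bar>sum \<phi> (Z R) - s\<bar> \<le> e" using approx by blast
    have "s \<le> sum \<phi> (Z R0) + e" using R0[of R0] by (simp add: abs_le_iff)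
    also have "sum \<phi> (Z R0) \<le> infsum \<phi> UNIV"
      by (rule finite_sum_le_infsum[OF sm finite_Z]) (use nn in auto)
    finally show "s \<le> infsum \<phi> UNIV + e" by simp
  qed
  ultimately have "infsum \<phi> UNIV = s" by simp
  thus ?thesis using has_sum_infsum[OF sm] by (simp add: \<phi>_def s_def)
qed

end

lemma zero_islimpt_reals: "0 islimpt range complex_of_real"
  unfolding islimpt_approachable
proof (intro allI impI)
  fix e :: real assume "e > 0"
  thus "\<exists>x'\<in>range complex_of_real. x' \<noteq> 0 \<and> dist x' 0 < e"
    by (intro bexI[of _ "of_real (e / 2)"] rangeI) auto
qed

text \<open>A translation along the real axis moves a point where \<open>f\<close> does not vanish
  to the origin; such a real point exists, since otherwise the identity theorem would give
  \<open>f \<i> = 0\<close>. The shift may double the quadratic exponent, whence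
  \<open>e / 2\<close>.\<close>

theorem real_rooted_Im_logderiv:
  assumes holo: "f holomorphic_on UNIV"
    and cnj: "\<And>z. f (cnj z) = cnj (f z)"
    and zeros: "\<And>z. f z = 0 \<Longrightarrow> Im z = 0"
    and growth: "\<And>e. e > 0 \<Longrightarrow> \<exists>C. \<forall>z. norm (f z) \<le> C * exp (e * (norm z)\<^sup>2)"
    and w: "Im w \<noteq> 0"
  shows "((\<lambda>x. real (zmult f (of_real x)) / ((Re w - x)\<^sup>2 + (Im w)\<^sup>2)) has_sum (- Im (deriv f w / f w) / Im w)) UNIV"
proof -
  have "\<exists>c. f (of_real c) \<noteq> 0"
  proof (rule ccontr)
    assume "\<nexists>c. f (of_real c) \<noteq> 0"
    hence *: "f (of_real c) = 0" for c by auto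
    have "f \<i> = 0"
    proof (rule analytic_continuation[OF holo, of "range of_real" 0])
      show "0 islimpt range complex_of_real" by (rule zero_islimpt_reals)
    qed (use * in auto)
    thus False using zeros by force
  qed
  then obtain c where c: "f (of_real c) \<noteq> 0" by blast
  define g where "g = (\<lambda>z. f (z + of_real c))"
  interpret real_rooted_entire g
  proof
    show "g holomorphic_on UNIV" unfolding g_def
      by (rule holomorphic_on_compose_gen[of "\<lambda>z. z + of_real c" _ f UNIV, unfolded o_def])
         (use holo in \<open>auto intro!: holomorphic_intros\<close>)
    show "g (cnj z) = cnj (g z)" for z using cnj[of "z + of_real c"] by (simp add: g_def)
    show "g z = 0 \<Longrightarrow> Im z = 0" for z using zeros[of "z + of_real c"] by (simp add: g_def)
    show "g 0 \<noteq> 0" using c by (simp add: g_def)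
    show "\<exists>C. \<forall>z. norm (g z) \<le> C * exp (e * (norm z)\<^sup>2)" if "e > 0" for e
    proof -
      have "e / 2 > 0" using that by simp
      from growth[OF this] obtain C where C: "\<And>z. norm (f z) \<le> C * exp (e / 2 * (norm z)\<^sup>2)" by blast
      have C0: "C > 0" using C[of "of_real c"] c by (smt (verit, best) zero_less_norm_iff mult_nonpos_nonneg exp_ge_zero)
      have "norm (g z) \<le> C * exp (e * c\<^sup>2) * exp (e * (norm z)\<^sup>2)" for z
      proof -
        have "norm (z + of_real c) \<le> norm z + \<bar>c\<bar>" by (metis norm_of_real norm_triangle_ineq)
        hence "(norm (z + of_real c))\<^sup>2 \<le> (norm z + \<bar>c\<bar>)\<^sup>2" by (intro power_mono) auto
        also have "\<dots> \<le> 2 * (norm z)\<^sup>2 + 2 * c\<^sup>2"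
          using sum_squares_bound[of "norm z" "\<bar>c\<bar>"] by (simp add: power2_sum)
        finally have "e / 2 * (norm (z + of_real c))\<^sup>2 \<le> e / 2 * (2 * (norm z)\<^sup>2 + 2 * c\<^sup>2)"
          using that by (intro mult_left_mono) auto
        hence "e / 2 * (norm (z + of_real c))\<^sup>2 \<le> e * c\<^sup>2 + e * (norm z)\<^sup>2" by (simp add: algebra_simps)
        hence "exp (e / 2 * (norm (z + of_real c))\<^sup>2) \<le> exp (e * c\<^sup>2) * exp (e * (norm z)\<^sup>2)"
          by (simp flip: exp_add)
        hence "C * exp (e / 2 * (norm (z + of_real c))\<^sup>2) \<le> C * (exp (e * c\<^sup>2) * exp (e * (norm z)\<^sup>2))"
          using C0 by (intro mult_left_mono) auto
        thus ?thesis using C[of "z + of_real c"] by (simp add: g_def mult_ac)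
      qed
      thus ?thesis by blast
    qed
  qed
  have mult: "zmult g (of_real x) = zmult f (of_real (x + c))" for x
    using zorder_shift[of g "of_real x"] zorder_shift[of f "of_real (x + c)"]
    by (simp add: zmult_def g_def add_ac)
  have dg: "deriv g z = deriv f (z + of_real c)" for z
  proof -
    have "(f has_field_derivative deriv f (z + of_real c)) (at (z + of_real c))"
      using assms(1) holomorphic_derivI by blast
    hence "(g has_field_derivative deriv f (z + of_real c)) (at z)"
      unfolding g_def by (simp add: DERIV_shift)
    thus ?thesis by (rule DERIV_imp_deriv)
  qed
  define v where "v = w - of_real c"
  have "((\<lambda>x. real (zmult f (of_real (x + c))) / ((Re w - (x + c))\<^sup>2 + (Im w)\<^sup>2)) has_sum (- Im (deriv f w / f w) / Im w)) UNIV"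
    using Im_logderiv_has_sum[of v] w unfolding mult dg by (simp add: v_def g_def algebra_simps)
  thus ?thesis
    by (subst (asm) has_sum_reindex_bij_betw[where g = "\<lambda>x. x + c" and f = "\<lambda>x. real (zmult f (of_real x)) / ((Re w - x)\<^sup>2 + (Im w)\<^sup>2)" and A = UNIV and B = UNIV])
       (auto intro!: bij_betwI[of _ _ _ "\<lambda>x. x - c"])
qed

section \<open>Logarithmic derivatives with almost all zeros real\<close>

text \<open>A double cone around the real axis, opened up at the origin by the summand 1 so that it
  is a connected open set containing all reals: factorisation and the identity theorem apply to it
  as a whole.\<close>

definition bowtie :: "real \<Rightarrow> complex set" where
  "bowtie d = {w. \<bar>Im w\<bar> < d * (1 + \<bar>Re w\<bar>)}"

lemma open_bowtie: "open (bowtie d)"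
  unfolding bowtie_def by (intro open_Collect_less continuous_intros)

lemma of_real_in_bowtie [simp]: "d > 0 \<Longrightarrow> of_real x \<in> bowtie d"
  by (auto simp: bowtie_def add_pos_nonneg)

lemma cnj_in_bowtie [simp]: "cnj w \<in> bowtie d \<longleftrightarrow> w \<in> bowtie d"
  by (auto simp: bowtie_def)

lemma connected_bowtie: "connected (bowtie d)"
proof (cases "d > 0")
  case True
  have "starlike (bowtie d)"
    unfolding starlike_def
  proof (intro bexI ballI)
    show "0 \<in> bowtie d" using of_real_in_bowtie[OF True, of 0] by simp
    fix w assume w: "w \<in> bowtie d"
    show "closed_segment 0 w \<subseteq> bowtie d"
    proof
      fix z assume "z \<in> closed_segment 0 w"
      then obtain u where u: "0 \<le> u" "u \<le> 1" "z = of_real u * w"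
        by (auto simp: closed_segment_def scaleR_conv_of_real)
      have "\<bar>Im z\<bar> = u * \<bar>Im w\<bar>" "\<bar>Re z\<bar> = u * \<bar>Re w\<bar>" using u by (auto simp: abs_mult)
      moreover have "u * \<bar>Im w\<bar> < d * (1 + u * \<bar>Re w\<bar>)"
      proof (cases "u = 0")
        case False
        have "u * \<bar>Im w\<bar> < u * (d * (1 + \<bar>Re w\<bar>))" using w u False by (intro mult_strict_left_mono) (auto simp: bowtie_def)
        also have "\<dots> = d * (u + u * \<bar>Re w\<bar>)" by (simp add: algebra_simps)
        also have "\<dots> \<le> d * (1 + u * \<bar>Re w\<bar>)" using True u by (intro mult_left_mono) auto
        finally show ?thesis .
      qed (use True in auto)
      ultimately show "z \<in> bowtie d" by (simp add: bowtie_def)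
    qed
  qed
  thus ?thesis by (rule starlike_imp_connected)
next
  case False
  have le: "d * (1 + \<bar>Re w\<bar>) \<le> 0" for w using False by (intro mult_nonpos_nonneg) auto
  have "w \<notin> bowtie d" for w
  proof
    assume "w \<in> bowtie d"
    hence "\<bar>Im w\<bar> < d * (1 + \<bar>Re w\<bar>)" by (simp add: bowtie_def)
    thus False using le[of w] by linarith
  qed
  hence "bowtie d = {}" by blast
  thus ?thesis by simp
qed

section \<open>Derivative bounds for functions with bounded imaginary part\<close>

lemma norm_deriv_le_of_Im_bounded:
  assumes G: "G holomorphic_on ball t R" and R: "R > 0"
    and B: "\<And>w. w \<in> ball t R \<Longrightarrow> \<bar>Im (G w) - a\<bar> \<le> B"
    and w: "w \<in> ball t (3 * R / 4)"
  shows "norm (deriv G w) \<le> 8 * exp (2 * B) / R"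
proof -
  \<comment> \<open>\<open>h\<close> has modulus \<open>exp (Im (G w) - a)\<close>, which lies
    between \<open>exp (- B)\<close> and \<open>exp B\<close>: Cauchy's estimate for
    \<open>h\<close> bounds \<open>deriv G\<close> after division by this modulus, and no bound for
    the real part of \<open>G\<close> enters.\<close>
  define h where "h = (\<lambda>w. exp (- \<i> * (G w - \<i> * of_real a)))"
  have h: "h holomorphic_on ball t R" unfolding h_def using G by (intro holomorphic_intros)
  have nh: "norm (h w) = exp (Im (G w) - a)" for w by (simp add: h_def)
  have wR: "w \<in> ball t R" using w R by auto
  have sub: "cball w (R / 4 * (1/2)) \<subseteq> ball t R"
  proof
    fix z assume "z \<in> cball w (R / 4 * (1/2))"
    hence "dist t z \<le> dist t w + R / 8" using dist_triangle[of t z w] by simp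
    thus "z \<in> ball t R" using w R by simp
  qed
  have B0: "B \<ge> 0" using B[OF wR] by linarith
  have "norm ((deriv ^^ 1) h w) \<le> fact 1 * (exp B) / (R / 4 * (1/2)) ^ 1"
  proof (rule Cauchy_inequality)
    show "h holomorphic_on ball w (R / 4 * (1/2))" using sub by (intro holomorphic_on_subset[OF h]) auto
    show "continuous_on (cball w (R / 4 * (1/2))) h"
      by (intro holomorphic_on_imp_continuous_on holomorphic_on_subset[OF h] sub)
    show "norm (h z) \<le> exp B" if "norm (w - z) = R / 4 * (1/2)" for z
    proof -
      have "z \<in> ball t R" using sub that by (auto simp: dist_norm)
      thus ?thesis using B[of z] by (simp add: nh abs_le_iff)
    qed
  qed (use R in auto)
  hence dh: "norm (deriv h w) \<le> exp B * 8 / R" using R by (simp add: field_simps)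
  have "(G has_field_derivative deriv G w) (at w)" using holomorphic_derivI[OF G] wR by auto
  hence "(h has_field_derivative h w * (- \<i> * deriv G w)) (at w)"
    unfolding h_def by (auto intro!: derivative_eq_intros)
  hence "deriv h w = h w * (- \<i> * deriv G w)" by (rule DERIV_imp_deriv)
  hence "norm (deriv h w) = exp (Im (G w) - a) * norm (deriv G w)" by (simp add: norm_mult nh)
  moreover have "exp (- B) \<le> exp (Im (G w) - a)" using B[OF wR] by (simp add: abs_le_iff)
  ultimately have "exp (- B) * norm (deriv G w) \<le> exp B * 8 / R"
    using dh by (smt (verit) mult_right_mono norm_ge_zero)
  hence le: "exp B * (exp (- B) * norm (deriv G w)) \<le> exp B * (exp B * 8 / R)" by (intro mult_left_mono) auto
  have "exp B * (exp (- B) * norm (deriv G w)) = norm (deriv G w)"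
    by (simp add: exp_minus)
  moreover have "exp B * (exp B * 8 / R) = 8 * exp (2 * B) / R"
    by (simp add: exp_double power2_eq_square)
  ultimately show ?thesis using le by (simp only:)
qed

lemma norm_deriv2_le_of_Im_bounded:
  assumes G: "G holomorphic_on ball t R" and R: "R > 0"
    and B: "\<And>w. w \<in> ball t R \<Longrightarrow> \<bar>Im (G w) - a\<bar> \<le> B"
    and w: "w \<in> ball t (R / 2)"
  shows "norm (deriv (deriv G) w) \<le> 64 * exp (2 * B) / R\<^sup>2"
proof -
  have sub: "cball w (R / 8) \<subseteq> ball t (3 * R / 4)"
  proof
    fix z assume "z \<in> cball w (R / 8)"
    hence "dist t z \<le> dist t w + R / 8" using dist_triangle[of t z w] by simp
    thus "z \<in> ball t (3 * R / 4)" using w R by simp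
  qed
  have sub': "cball w (R / 8) \<subseteq> ball t R" using sub R by (auto simp: subset_iff)
  have dG: "deriv G holomorphic_on ball t R" by (intro holomorphic_deriv G) auto
  have "norm ((deriv ^^ 1) (deriv G) w) \<le> fact 1 * (8 * exp (2 * B) / R) / (R / 8) ^ 1"
  proof (rule Cauchy_inequality)
    show "deriv G holomorphic_on ball w (R / 8)" using sub' by (intro holomorphic_on_subset[OF dG]) auto
    show "continuous_on (cball w (R / 8)) (deriv G)"
      by (intro holomorphic_on_imp_continuous_on holomorphic_on_subset[OF dG] sub')
    show "norm (deriv G z) \<le> 8 * exp (2 * B) / R" if "norm (w - z) = R / 8" for z
      by (rule norm_deriv_le_of_Im_bounded[OF G R B]) (use sub that in \<open>auto simp: dist_norm\<close>)
  qed (use R in auto)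
  thus ?thesis by (simp add: power2_eq_square)
qed

text \<open>All kernels with \<open>y \<noteq> 0\<close> are dominated by multiples of
  \<open>1 / (1 + x^2)\<close>, so one summability hypothesis serves for every point off the
  axis.\<close>

lemma kernel_le:
  fixes t x y :: real
  assumes "y \<noteq> 0"
  shows "1 / ((t - x)\<^sup>2 + y\<^sup>2) \<le> (2 + (1 + 2 * t\<^sup>2) / y\<^sup>2) * (1 / (1 + x\<^sup>2))"
proof -
  have y: "y\<^sup>2 > 0" using assms by simp
  have "x\<^sup>2 \<le> 2 * (t - x)\<^sup>2 + 2 * t\<^sup>2"
    using sum_squares_bound[of "x - t" t] by (simp add: power2_eq_square algebra_simps)
  hence "1 + x\<^sup>2 \<le> 2 * (t - x)\<^sup>2 + (1 + 2 * t\<^sup>2)" by simp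
  also have "\<dots> \<le> (2 + (1 + 2 * t\<^sup>2) / y\<^sup>2) * ((t - x)\<^sup>2 + y\<^sup>2)"
  proof -
    define a where "a = 1 + 2 * t\<^sup>2"
    have "(2 + a / y\<^sup>2) * ((t - x)\<^sup>2 + y\<^sup>2) = 2 * (t - x)\<^sup>2 + 2 * y\<^sup>2 + a / y\<^sup>2 * (t - x)\<^sup>2 + a"
      using y by (simp add: field_simps)
    moreover have "0 \<le> a / y\<^sup>2 * (t - x)\<^sup>2" by (auto simp: a_def)
    ultimately show ?thesis using y unfolding a_def by linarith
  qed
  finally show ?thesis using y by (simp add: divide_simps add_pos_nonneg add_nonneg_pos mult.commute split: if_splits)
qed

lemma summable_kernel:
  fixes \<mu> :: "real \<Rightarrow> real"
  assumes "(\<lambda>x. \<mu> x / (1 + x\<^sup>2)) summable_on UNIV" "\<And>x. \<mu> x \<ge> 0" "y \<noteq> 0"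
  shows "(\<lambda>x. \<mu> x / ((t - x)\<^sup>2 + y\<^sup>2)) summable_on UNIV"
proof (rule summable_on_comparison_test)
  show "(\<lambda>x. (2 + (1 + 2 * t\<^sup>2) / y\<^sup>2) * (\<mu> x / (1 + x\<^sup>2))) summable_on UNIV"
    by (intro summable_on_cmult_right assms)
  show "\<mu> x / ((t - x)\<^sup>2 + y\<^sup>2) \<le> (2 + (1 + 2 * t\<^sup>2) / y\<^sup>2) * (\<mu> x / (1 + x\<^sup>2))" for x
    using mult_left_mono[OF kernel_le[OF assms(3), of t x] assms(2)[of x]] by (simp add: mult_ac)
  show "0 \<le> \<mu> x / ((t - x)\<^sup>2 + y\<^sup>2)" for x using assms by simp
qed

text \<open>The derivative in \<open>u\<close> is \<open>Im w / |w - u|^2\<close>. Monotonicity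
  makes this argument function an admissible test function for interlacing sets.\<close>

lemma Im_Ln_diff_mono:
  assumes "Im w > 0" "u \<le> v"
  shows "Im (Ln (w - of_real u)) \<le> Im (Ln (w - of_real v))"
proof -
  have "\<exists>y. ((\<lambda>u. Im (Ln (w - of_real u))) has_real_derivative y) (at x) \<and> y \<ge> 0" for x
  proof -
    have np: "w - of_real x \<notin> \<real>\<^sub>\<le>\<^sub>0" using assms by (auto simp: complex_nonpos_Reals_iff)
    have "((\<lambda>z. Ln (w - z)) has_field_derivative (- 1 / (w - of_real x))) (at (of_real x))"
      using np by (auto intro!: derivative_eq_intros simp: inverse_eq_divide)
    hence "((\<lambda>u. Ln (w - of_real u)) has_vector_derivative (- 1 / (w - of_real x))) (at x)"
      by (rule has_vector_derivative_real_field)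
    hence "((\<lambda>u. Im (Ln (w - of_real u))) has_vector_derivative Im (- 1 / (w - of_real x))) (at x)"
      by (rule bounded_linear.has_vector_derivative[OF bounded_linear_Im])
    moreover have "Im (- 1 / (w - of_real x)) \<ge> 0" using assms by (simp add: Im_divide)
    ultimately show ?thesis unfolding has_real_derivative_iff_has_vector_derivative by blast
  qed
  thus ?thesis by (intro DERIV_nonneg_imp_nondecreasing[OF assms(2)]) auto
qed

text \<open>Multiplied by \<open>y / pi\<close>, this is the Poisson integral of the counting
  measure of the real zeros. It may run over all reals, as \<open>zmult\<close> vanishes off the
  zeros. The value at \<open>y = 0\<close> is meant for points \<open>t\<close> that are not zeros
  of \<open>f\<close>.\<close>

definition zsum :: "(complex \<Rightarrow> complex) \<Rightarrow> real \<Rightarrow> real \<Rightarrow> real" where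
  "zsum f t y = (\<Sum>\<^sub>\<infinity>x. real (zmult f (of_real x)) / ((t - x)\<^sup>2 + y\<^sup>2))"

text \<open>
  As \<open>x / 0 = 0\<close>, the assumptions \<open>zsum_ge\<close> and \<open>Im_q\<close> together rule out zeros of \<open>f\<close> and of \<open>deriv f\<close> off
  the real axis in the cone \<open>y \<le> c * \<bar>t\<bar>\<close> far from the origin. The lower bound \<open>zsum_ge\<close> is only demanded at
  the edge of the cone: there it survives a change of the zeros by an interlacing set.
\<close>

locale near_real_rooted =
  fixes d :: real and f :: "complex \<Rightarrow> complex" and c T A C :: real
  assumes d: "d > 0" and c: "0 < c" "c \<le> d" "c \<le> 1" and T: "T \<ge> 1" and A: "A > 0" and C: "C \<ge> 0"
    and holo: "f holomorphic_on bowtie d"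
    and sym: "\<And>w. w \<in> bowtie d \<Longrightarrow> f (cnj w) = cnj (f w)"
    and sm: "(\<lambda>x. real (zmult f (of_real x)) / (1 + x\<^sup>2)) summable_on UNIV"
    and zsum_ge: "\<And>t. \<bar>t\<bar> \<ge> T \<Longrightarrow> A / \<bar>t\<bar> \<le> zsum f t (c * \<bar>t\<bar>)"
    and Im_q: "\<And>t y. \<bar>t\<bar> \<ge> T \<Longrightarrow> 0 < y \<Longrightarrow> y \<le> c * \<bar>t\<bar> \<Longrightarrow>
      \<bar>Im (deriv f (Complex t y) / f (Complex t y)) + y * zsum f t y\<bar> \<le> C * y / t\<^sup>2"
begin

section \<open>Real zeros of \<open>f\<close> and of \<open>deriv f\<close>: signs, monotonicity,
  interlacing\<close>

abbreviation m :: "real \<Rightarrow> nat" where "m x \<equiv> zmult f (of_real x)"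
abbreviation m' :: "real \<Rightarrow> nat" where "m' x \<equiv> zmult (deriv f) (of_real x)"

definition q :: "complex \<Rightarrow> complex" where "q = (\<lambda>w. deriv f w / f w)"

text \<open>Beyond this point the error \<open>C / t^2\<close> uses up at most half of the lower
  bound \<open>A / |t|\<close>.\<close>

definition T1 :: real where "T1 = T + 2 * C / A"

lemma T1: "T1 \<ge> T" "T1 \<ge> 1" "T1 > 0"
proof -
  have "0 \<le> 2 * C / A" using A C by simp
  thus "T1 \<ge> T" "T1 \<ge> 1" "T1 > 0" using T unfolding T1_def by linarith+
qed

lemma in_bowtie: "0 \<le> y \<Longrightarrow> y \<le> c * \<bar>t\<bar> \<Longrightarrow> Complex t y \<in> bowtie d"
proof -
  assume y: "0 \<le> y" "y \<le> c * \<bar>t\<bar>"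
  have "c * \<bar>t\<bar> \<le> d * \<bar>t\<bar>" using c by (intro mult_right_mono) auto
  thus ?thesis using y d unfolding bowtie_def by (auto simp: algebra_simps)
qed

lemma sm_kernel: "y \<noteq> 0 \<Longrightarrow> (\<lambda>x. real (m x) / ((t - x)\<^sup>2 + y\<^sup>2)) summable_on UNIV"
  by (rule summable_kernel[OF sm]) auto

lemma zsum_antimono: "0 < y \<Longrightarrow> y \<le> y' \<Longrightarrow> zsum f t y' \<le> zsum f t y"
  unfolding zsum_def
  by (intro infsum_mono sm_kernel divide_left_mono add_left_mono power_mono)
     (auto intro!: mult_pos_pos add_nonneg_pos)

text \<open>The kernel sum decreases in \<open>y\<close>, so the lower bound at the edge of the cone
  holds throughout it. The result keeps the factor \<open>y\<close>, which leaves a strict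
  inequality for the derivative of \<open>q\<close> on the axis.\<close>

lemma Im_q_neg:
  assumes t: "\<bar>t\<bar> \<ge> T1" and y: "0 < y" "y \<le> c * \<bar>t\<bar>"
  shows "Im (q (Complex t y)) \<le> - (y * (A / (2 * \<bar>t\<bar>)))"
proof -
  have tT: "\<bar>t\<bar> \<ge> T" "\<bar>t\<bar> > 0" using t T1 by linarith+
  have "2 * C / A \<le> \<bar>t\<bar>" using t T1 T unfolding T1_def by linarith
  hence "2 * C \<le> \<bar>t\<bar> * A" using A by (simp add: divide_simps mult.commute)
  hence "C / \<bar>t\<bar> \<le> A / 2" using tT by (simp add: pos_divide_le_eq mult.commute)
  hence "C / \<bar>t\<bar> / \<bar>t\<bar> \<le> A / 2 / \<bar>t\<bar>" by (rule divide_right_mono) auto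
  hence CA: "C / t\<^sup>2 \<le> A / (2 * \<bar>t\<bar>)" by (simp add: power2_eq_square)
  have "A / \<bar>t\<bar> \<le> zsum f t y" using zsum_ge[OF tT(1)] zsum_antimono[OF y, of t] by linarith
  hence "A / (2 * \<bar>t\<bar>) + C / t\<^sup>2 \<le> zsum f t y" using CA by simp
  hence "y * (A / (2 * \<bar>t\<bar>) + C / t\<^sup>2) \<le> y * zsum f t y" using y by (intro mult_left_mono) auto
  moreover have "Im (q (Complex t y)) + y * zsum f t y \<le> C * y / t\<^sup>2"
    using Im_q[OF tT(1) y] unfolding q_def by linarith
  ultimately show ?thesis by (simp add: algebra_simps)
qed

lemma Im_q_neg':
  assumes t: "\<bar>t\<bar> \<ge> T1" and y: "0 < y" "y \<le> c * \<bar>t\<bar>"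
  shows "Im (q (Complex t y)) < 0" "f (Complex t y) \<noteq> 0" "deriv f (Complex t y) \<noteq> 0"
proof -
  have "0 < y * (A / (2 * \<bar>t\<bar>))" using y t T1 A by (intro mult_pos_pos divide_pos_pos) auto
  thus *: "Im (q (Complex t y)) < 0" using Im_q_neg[OF assms] by linarith
  show "f (Complex t y) \<noteq> 0" "deriv f (Complex t y) \<noteq> 0" using * by (auto simp: q_def)
qed

lemma holo': "deriv f holomorphic_on bowtie d"
  by (intro holomorphic_deriv holo open_bowtie)

lemma sym': "w \<in> bowtie d \<Longrightarrow> deriv f (cnj w) = cnj (deriv f w)"
  by (rule deriv_cnj[OF open_bowtie _ holo]) (auto simp: sym)

definition w0 :: complex where "w0 = Complex T1 (c * T1)"

lemma w0: "w0 \<in> bowtie d" "f w0 \<noteq> 0" "deriv f w0 \<noteq> 0"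
  unfolding w0_def using Im_q_neg'[of T1 "c * T1"] in_bowtie[of "c * T1" T1] T1 c by auto

lemma m_pos: "m x > 0 \<longleftrightarrow> f (of_real x) = 0"
  by (rule zmult_pos_iff[OF holo open_bowtie connected_bowtie _ w0(1,2)]) (use d in auto)

lemma m'_pos: "m' x > 0 \<longleftrightarrow> deriv f (of_real x) = 0"
  by (rule zmult_pos_iff[OF holo' open_bowtie connected_bowtie _ w0(1,3)]) (use d in auto)

definition P :: "real set" where "P = {x. f (of_real x) = 0}"
text \<open>Zeros that \<open>deriv f\<close> inherits from multiple zeros of \<open>f\<close> are
  left out: these points are the genuine zeros of \<open>q\<close>, as those of \<open>P\<close> are
  its poles.\<close>

definition N :: "real set" where "N = {x. deriv f (of_real x) = 0 \<and> f (of_real x) \<noteq> 0}"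

lemma real_f: "Im (f (of_real x)) = 0" "Im (deriv f (of_real x)) = 0"
proof -
  have *: "Im z = 0" if "z = cnj z" for z using that by (simp add: complex_eq_iff)
  show "Im (f (of_real x)) = 0" "Im (deriv f (of_real x)) = 0"
    using sym[of "of_real x"] sym'[of "of_real x"] d by (auto intro!: *)
qed

lemma finite_real_zeros:
  assumes "g holomorphic_on bowtie d" "w \<in> bowtie d" "g w \<noteq> 0"
  shows "finite {x::real. a \<le> x \<and> x \<le> b \<and> g (of_real x) = 0}"
proof (cases "\<exists>x. g (of_real x) = 0")
  case True
  then obtain x0 :: real where x0: "g (of_real x0) = 0" by blast
  have "finite {z \<in> of_real ` {a..b}. g z = 0}"
  proof (rule holomorphic_compact_finite_zeros[OF assms(1) open_bowtie connected_bowtie])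
    show "compact (complex_of_real ` {a..b})"
      by (intro compact_continuous_image continuous_intros compact_Icc)
    show "complex_of_real ` {a..b} \<subseteq> bowtie d" using d by auto
    show "\<not> g constant_on bowtie d"
    proof
      assume "g constant_on bowtie d"
      then obtain b where b: "\<And>z. z \<in> bowtie d \<Longrightarrow> g z = b" by (auto simp: constant_on_def)
      show False using b[OF assms(2)] b[of "of_real x0"] x0 assms(3) d by simp
    qed
  qed
  hence "finite (Re ` {z \<in> of_real ` {a..b}. g z = 0})" by (rule finite_imageI)
  moreover have "{x. a \<le> x \<and> x \<le> b \<and> g (of_real x) = 0} \<subseteq> Re ` {z \<in> of_real ` {a..b}. g z = 0}"
  proof
    fix x assume "x \<in> {x. a \<le> x \<and> x \<le> b \<and> g (of_real x) = 0}"
    thus "x \<in> Re ` {z \<in> of_real ` {a..b}. g z = 0}" by (intro image_eqI[of _ _ "of_real x"]) auto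
  qed
  ultimately show ?thesis by (rule finite_subset[rotated])
qed auto

lemma finite_PN: "finite (P \<inter> {a..b})" "finite (N \<inter> {a..b})"
proof -
  have "P \<inter> {a..b} = {x. a \<le> x \<and> x \<le> b \<and> f (of_real x) = 0}" by (auto simp: P_def)
  thus "finite (P \<inter> {a..b})" using finite_real_zeros[OF holo w0(1,2)] by simp
  have "N \<inter> {a..b} \<subseteq> {x. a \<le> x \<and> x \<le> b \<and> deriv f (of_real x) = 0}" by (auto simp: N_def)
  thus "finite (N \<inter> {a..b})" by (rule finite_subset) (rule finite_real_zeros[OF holo' w0(1,3)])
qed

lemma real_deriv:
  assumes "(g has_field_derivative g') (at (of_real x))"
  shows "((\<lambda>x. Re (g (of_real x))) has_real_derivative Re g') (at x)"
  unfolding has_real_derivative_iff_has_vector_derivative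
  by (rule bounded_linear.has_vector_derivative[OF bounded_linear_Re has_vector_derivative_real_field[OF assms]])

lemma f_real_deriv: "((\<lambda>x. Re (f (of_real x))) has_real_derivative Re (deriv f (of_real x))) (at x)"
  by (rule real_deriv[OF holomorphic_derivI[OF holo open_bowtie]]) (use d in auto)

lemma q_deriv:
  assumes "w \<in> bowtie d" "f w \<noteq> 0"
  shows "(q has_field_derivative deriv q w) (at w)"
proof -
  have "(q has_field_derivative ((deriv (deriv f) w * f w - deriv f w * deriv f w) / (f w * f w))) (at w)"
    unfolding q_def by (rule DERIV_divide holomorphic_derivI[OF holo open_bowtie] holomorphic_derivI[OF holo' open_bowtie] assms)+
  thus ?thesis by (simp add: DERIV_imp_deriv)
qed

lemma q_real_deriv:
  assumes "f (of_real x) \<noteq> 0"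
  shows "((\<lambda>x. Re (q (of_real x))) has_real_derivative Re (deriv q (of_real x))) (at x)"
  by (rule real_deriv[OF q_deriv]) (use assms d in auto)

text \<open>\<open>q\<close> is real on the axis, so \<open>Im q / y\<close> is the imaginary part
  of a difference quotient in the direction \<open>\<i>\<close>, and
  \<open>Im (\<i> * q') = Re q'\<close>.\<close>

lemma Im_q_tendsto:
  assumes "f (of_real t) \<noteq> 0"
  shows "((\<lambda>y. Im (q (Complex t y)) / y) \<longlongrightarrow> Re (deriv q (of_real t))) (at_right 0)"
proof -
  have "(q has_field_derivative deriv q (of_real t)) (at (of_real t + \<i> * of_real 0))"
    using q_deriv[of "of_real t"] assms d by simp
  moreover have "((\<lambda>z. of_real t + \<i> * z) has_field_derivative \<i>) (at (of_real 0))"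
    by (auto intro!: derivative_eq_intros)
  ultimately have "((\<lambda>z. q (of_real t + \<i> * z)) has_field_derivative deriv q (of_real t) * \<i>) (at (of_real 0))"
    by (rule DERIV_chain2)
  hence "((\<lambda>y. q (of_real t + \<i> * of_real y)) has_vector_derivative deriv q (of_real t) * \<i>) (at 0)"
    by (rule has_vector_derivative_real_field)
  hence "((\<lambda>y. Im (q (of_real t + \<i> * of_real y))) has_real_derivative Im (deriv q (of_real t) * \<i>)) (at 0)"
    unfolding has_real_derivative_iff_has_vector_derivative
    by (rule bounded_linear.has_vector_derivative[OF bounded_linear_Im])
  hence "((\<lambda>y. (Im (q (of_real t + \<i> * of_real y)) - Im (q (of_real t))) / y) \<longlongrightarrow> Re (deriv q (of_real t))) (at 0)"
    by (simp add: has_field_derivative_iff)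
  moreover have "Im (q (of_real t)) = 0" using real_f[of t] by (simp add: q_def Im_divide)
  moreover have "of_real t + \<i> * of_real y = Complex t y" for y by (simp add: complex_eq_iff)
  ultimately have "((\<lambda>y. Im (q (Complex t y)) / y) \<longlongrightarrow> Re (deriv q (of_real t))) (at 0)" by simp
  thus ?thesis by (rule filterlim_mono) (auto simp: at_le)
qed

lemma q_deriv_neg:
  assumes "f (of_real t) \<noteq> 0" "\<bar>t\<bar> \<ge> T1"
  shows "Re (deriv q (of_real t)) < 0"
proof -
  have t0: "\<bar>t\<bar> > 0" using assms T1 by linarith
  have "eventually (\<lambda>y. y \<in> {0<..<c * \<bar>t\<bar>}) (at_right 0)"
    by (rule eventually_at_rightI[of 0 "c * \<bar>t\<bar>"]) (use c t0 in auto)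
  hence "eventually (\<lambda>y. Im (q (Complex t y)) / y \<le> - (A / (2 * \<bar>t\<bar>))) (at_right 0)"
  proof eventually_elim
    case (elim y)
    thus ?case using Im_q_neg[OF assms(2), of y] by (simp add: pos_divide_le_eq mult.commute)
  qed
  hence "Re (deriv q (of_real t)) \<le> - (A / (2 * \<bar>t\<bar>))"
    by (intro tendsto_upperbound[OF Im_q_tendsto[OF assms(1)]]) auto
  thus ?thesis using A t0 by (smt (verit) divide_pos_pos)
qed

text \<open>Beyond \<open>T1\<close> the function \<open>q\<close> is strictly decreasing between
  its poles and so has at most one zero there; two new zeros without a pole in between would
  contradict this by Rolle's theorem.\<close>

lemma N_P_interlace:
  assumes "p \<in> N" "p' \<in> N" "p < p'" "T1 < p \<or> p' < - T1"
  shows "\<exists>n\<in>P. p < n \<and> n < p'"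
proof (rule ccontr)
  assume *: "\<not> ?thesis"
  have nz: "f (of_real x) \<noteq> 0" if "p \<le> x" "x \<le> p'" for x
  proof (cases "x = p \<or> x = p'")
    case False
    hence "p < x" "x < p'" using that by auto
    thus ?thesis using * by (auto simp: P_def)
  qed (use assms in \<open>auto simp: N_def\<close>)
  have "\<exists>z>p. z < p' \<and> Re (q (of_real p')) - Re (q (of_real p)) = (p' - p) * Re (deriv q (of_real z))"
    by (rule MVT2[OF assms(3) q_real_deriv[OF nz]])
  then obtain z where z: "p < z" "z < p'" "Re (q (of_real p')) - Re (q (of_real p)) = (p' - p) * Re (deriv q (of_real z))"
    by blast
  have "q (of_real p) = 0" "q (of_real p') = 0" using assms by (auto simp: q_def N_def)
  hence "Re (deriv q (of_real z)) = 0" using z assms(3) by simp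
  moreover have "\<bar>z\<bar> \<ge> T1" using z assms(4) by auto
  ultimately show False using q_deriv_neg[OF nz[of z]] z by auto
qed

lemma P_N_interlace:
  assumes "p \<in> P" "p' \<in> P" "p < p'"
  shows "\<exists>n\<in>N. p < n \<and> n < p'"
proof -
  have fin: "finite (P \<inter> {p<..p'})" by (rule finite_subset[OF _ finite_PN(1)[of p p']]) auto
  \<comment> \<open>\<open>s\<close> is the next zero of \<open>f\<close> after \<open>p\<close>, so
    that the point found by Rolle's theorem is no zero of \<open>f\<close> and belongs to
    \<open>N\<close>.\<close>
  define s where "s = Min (P \<inter> {p<..p'})"
  have "s \<in> P \<inter> {p<..p'}" unfolding s_def by (rule Min_in[OF fin]) (use assms in auto)
  hence s: "s \<in> P" "p < s" "s \<le> p'" by auto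
  have nz: "f (of_real x) \<noteq> 0" if "p < x" "x < s" for x
  proof
    assume "f (of_real x) = 0"
    hence "x \<in> P \<inter> {p<..p'}" using that s by (auto simp: P_def)
    hence "s \<le> x" unfolding s_def by (rule Min_le[OF fin])
    thus False using that by simp
  qed
  have "\<exists>z>p. z < s \<and> Re (f (of_real s)) - Re (f (of_real p)) = (s - p) * Re (deriv f (of_real z))"
    by (rule MVT2[OF s(2) f_real_deriv])
  then obtain z where z: "p < z" "z < s" "Re (f (of_real s)) - Re (f (of_real p)) = (s - p) * Re (deriv f (of_real z))"
    by blast
  have "f (of_real p) = 0" "f (of_real s) = 0" using assms s by (auto simp: P_def)
  hence "Re (deriv f (of_real z)) = 0" using z by simp
  thus ?thesis using s z nz[of z] real_f[of z] by (intro bexI[of _ z]) (auto simp: N_def complex_eq_iff)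
qed

lemma m'_P: "x \<in> P \<Longrightarrow> m' x = m x - 1"
proof -
  assume x: "x \<in> P"
  have an: "f analytic_on {of_real x}"
    by (rule holomorphic_on_imp_analytic_at[OF holo open_bowtie]) (use d in simp)
  have "zorder (deriv f) (of_real x) = zorder f (of_real x) - 1"
  proof (rule zorder_deriv_minus_1)
    show "isolated_singularity_at f (of_real x)" "not_essential f (of_real x)"
      using an by (auto intro: isolated_singularity_at_analytic not_essential_analytic)
    show "zorder f (of_real x) \<noteq> 0" using m_pos[of x] x by (auto simp: P_def zmult_def)
    show "\<exists>\<^sub>F w in at (complex_of_real x). f w \<noteq> 0"
    proof -
      obtain g where g: "g holomorphic_on bowtie d" "g (of_real x) \<noteq> 0" "\<And>w. w \<in> bowtie d \<Longrightarrow> f w = (w - of_real x) ^ m x * g w"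
        using zmult_factor[OF holo open_bowtie connected_bowtie _ w0(1,2), of "of_real x"] d by auto
      have "isCont g (of_real x)"
        using holomorphic_on_imp_analytic_at[OF g(1) open_bowtie] d by (intro analytic_at_imp_isCont) auto
      hence "eventually (\<lambda>w. g w \<noteq> 0) (at (of_real x))"
        using g(2) by (simp add: isCont_def tendsto_imp_eventually_ne)
      moreover have "eventually (\<lambda>w. w \<in> bowtie d - {of_real x}) (at (of_real x))"
        by (rule eventually_at_in_open) (use open_bowtie d in auto)
      ultimately have "eventually (\<lambda>w. f w \<noteq> 0) (at (of_real x))"
        by eventually_elim (auto simp: g(3))
      thus ?thesis by (simp add: eventually_frequently)
    qed
  qed
  thus ?thesis by (auto simp: zmult_def nat_diff_distrib)
qed

text \<open>At a new zero \<open>q' = f'' / f\<close>, and \<open>q'\<close> does not vanish beyond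
  \<open>T1\<close>.\<close>

lemma m'_N:
  assumes x: "x \<in> N" "\<bar>x\<bar> > T1"
  shows "m' x = 1"
proof -
  have fx: "f (of_real x) \<noteq> 0" "deriv f (of_real x) = 0" using x by (auto simp: N_def)
  have xO: "of_real x \<in> bowtie d" using d by simp
  have "(q has_field_derivative ((deriv (deriv f) (of_real x) * f (of_real x) - deriv f (of_real x) * deriv f (of_real x)) / (f (of_real x) * f (of_real x)))) (at (of_real x))"
    unfolding q_def by (rule DERIV_divide holomorphic_derivI[OF holo open_bowtie] holomorphic_derivI[OF holo' open_bowtie] xO fx(1))+
  hence "deriv q (of_real x) = deriv (deriv f) (of_real x) / f (of_real x)"
    using fx by (simp add: DERIV_imp_deriv)
  moreover have "deriv q (of_real x) \<noteq> 0" using q_deriv_neg[OF fx(1)] x by auto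
  ultimately have "deriv (deriv f) (of_real x) \<noteq> 0" by auto
  hence "zorder (deriv f) (of_real x) = 1"
    using fx(2) by (intro zorder_zero_eqI[OF holo' open_bowtie xO]) auto
  thus ?thesis by (simp add: zmult_def)
qed

text \<open>From \<open>f\<close> to \<open>deriv f\<close> the multiplicity changes by minus one on
  \<open>P\<close> plus this weight. On \<open>N\<close> it is 1 beyond \<open>T1\<close>, but it
  can be larger near the origin.\<close>

definition \<nu> :: "real \<Rightarrow> real" where "\<nu> x = (if x \<in> N then real (m' x) else 0)"

lemma m'_eq: "real (m' x) = real (m x) - indicator P x + \<nu> x"
proof (cases "x \<in> P")
  case True
  hence "m x > 0" "x \<notin> N" using m_pos[of x] by (auto simp: P_def N_def)
  thus ?thesis using m'_P[OF True] True by (simp add: \<nu>_def of_nat_diff)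
next
  case False
  hence "m x = 0" using m_pos[of x] by (auto simp: P_def)
  moreover have "m' x = 0" if "x \<notin> N" using that False m'_pos[of x] by (auto simp: P_def N_def)
  ultimately show ?thesis using False by (auto simp: \<nu>_def)
qed

end

section \<open>Exchanging the zeros of \<open>f\<close> for those of \<open>deriv f\<close>\<close>

lemma zmult_factor_real:
  assumes f: "f holomorphic_on U" "open U" "connected U" "w0 \<in> U" "f w0 \<noteq> 0"
    and S: "finite S" "of_real ` S \<subseteq> U"
  obtains h where "h holomorphic_on U" "\<And>x. x \<in> S \<Longrightarrow> h (of_real x) \<noteq> 0"
    "\<And>w. w \<in> U \<Longrightarrow> f w = (\<Prod>x\<in>S. (w - of_real x) ^ zmult f (of_real x)) * h w"
proof -
  obtain h where h: "h holomorphic_on U" "\<And>z. z \<in> of_real ` S \<Longrightarrow> h z \<noteq> 0"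
    "\<And>w. w \<in> U \<Longrightarrow> f w = (\<Prod>z\<in>of_real ` S. (w - z) ^ zmult f z) * h w"
    using zmult_factor_finite[OF f finite_imageI[OF S(1)] S(2)] by blast
  have "(\<Prod>z\<in>of_real ` S. (w - z) ^ zmult f z) = (\<Prod>x\<in>S. (w - of_real x) ^ zmult f (of_real x))" for w
    by (simp add: prod.reindex inj_on_def)
  thus ?thesis using that[of h] h by auto
qed

context near_real_rooted
begin

text \<open>A predicate on the constant alone, quantified over all intervals and test functions, so
  that one \<open>K\<close> serves every \<open>t\<close>, \<open>y\<close> and \<open>R\<close>
  below.\<close>

definition interlace_const :: "real \<Rightarrow> bool" where
  "interlace_const K \<longleftrightarrow> K > 0 \<and> (\<forall>I \<phi> B. is_interval I \<longrightarrow> antimono_on I \<phi> \<or> mono_on I \<phi> \<longrightarrow> (\<forall>x\<in>I. 0 \<le> \<phi> x) \<longrightarrow>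
       (\<forall>x\<in>I. \<phi> x \<le> B) \<longrightarrow> 0 \<le> B \<longrightarrow> \<phi> summable_on (P \<inter> I) \<longrightarrow>
       (\<lambda>x. \<nu> x * \<phi> x) summable_on (N \<inter> I) \<and>
       \<bar>(\<Sum>\<^sub>\<infinity>x\<in>N \<inter> I. \<nu> x * \<phi> x) - (\<Sum>\<^sub>\<infinity>x\<in>P \<inter> I. \<phi> x)\<bar> \<le> K * B)"

lemma interlace_const_ex: "\<exists>K. interlace_const K"
proof -
  have 1: "0 \<le> \<nu> x" for x by (simp add: \<nu>_def)
  have 2: "\<nu> x = 1" if "x \<in> N" "\<bar>x\<bar> > T1" for x using m'_N[OF that] that by (simp add: \<nu>_def)
  have 3: "\<exists>n\<in>N. p < n \<and> n < p'" if "p \<in> P" "p' \<in> P" "p < p'" "T1 < p \<or> p' < - T1" for p p'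
    using P_N_interlace that by blast
  have 4: "0 \<le> T1" using T1 by simp
  show ?thesis
  proof (rule interlace_weighted_bound[OF 4 finite_PN 1 2 3 N_P_interlace])
    fix K :: real
    assume K: "K > 0" "\<And>I \<phi> B. is_interval I \<Longrightarrow> antimono_on I \<phi> \<or> mono_on I \<phi> \<Longrightarrow> (\<And>x. x \<in> I \<Longrightarrow> 0 \<le> \<phi> x) \<Longrightarrow>
       (\<And>x. x \<in> I \<Longrightarrow> \<phi> x \<le> B) \<Longrightarrow> 0 \<le> B \<Longrightarrow> \<phi> summable_on (P \<inter> I) \<Longrightarrow>
       (\<lambda>x. \<nu> x * \<phi> x) summable_on (N \<inter> I) \<and>
       \<bar>(\<Sum>\<^sub>\<infinity>x\<in>N \<inter> I. \<nu> x * \<phi> x) - (\<Sum>\<^sub>\<infinity>x\<in>P \<inter> I. \<phi> x)\<bar> \<le> K * B"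
    show "\<exists>K. interlace_const K" unfolding interlace_const_def
      by (rule exI[of _ K], rule conjI[OF K(1)], intro allI impI, rule K(2); blast)
  qed (assumption)+
qed

text \<open>Zeros in the window \<open>W\<close> are kept exactly. On either side of it the kernel
  is monotone and at most \<open>1 / (R^2 + y^2)\<close>, so exchanging \<open>P\<close> for
  \<open>N\<close> costs \<open>K\<close> times that bound twice. For \<open>R = 0\<close> the
  window is empty and the two full sums are compared.\<close>

lemma zsum_deriv:
  fixes t y R K :: real
  assumes K: "interlace_const K" and y: "y > 0" and R: "R \<ge> 0"
  defines "\<phi> \<equiv> \<lambda>x. 1 / ((t - x)\<^sup>2 + y\<^sup>2)" and "W \<equiv> {t - R<..<t + R}"
  shows "(\<lambda>x. real (m' x) / ((t - x)\<^sup>2 + y\<^sup>2)) summable_on UNIV"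
    "\<bar>zsum (deriv f) t y - (zsum f t y + (\<Sum>x\<in>N \<inter> W. \<nu> x * \<phi> x) - (\<Sum>x\<in>P \<inter> W. \<phi> x))\<bar> \<le> 2 * K / (R\<^sup>2 + y\<^sup>2)"
proof -
  define J1 where "J1 = {..t - R}"
  \<comment> \<open>The condition \<open>t - R < x\<close> matters for \<open>R = 0\<close>: the
    point \<open>t\<close> would otherwise lie in both tails.\<close>
  define J2 where "J2 = {x. t - R < x \<and> t + R \<le> x}"
  define B where "B = 1 / (R\<^sup>2 + y\<^sup>2)"
  have B: "B \<ge> 0" by (simp add: B_def)
  have den: "(t - x)\<^sup>2 + y\<^sup>2 > 0" for x using y by (intro add_nonneg_pos) auto
  have \<phi>0: "\<phi> x \<ge> 0" for x using den[of x] by (simp add: \<phi>_def)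
  have sm: "(\<lambda>x. real (m x) * \<phi> x) summable_on UNIV"
    using sm_kernel[of y t] y by (simp add: \<phi>_def)
  have smP: "\<phi> summable_on P"
  proof (rule summable_on_comparison_test)
    show "(\<lambda>x. real (m x) * \<phi> x) summable_on P" by (rule summable_on_subset_banach[OF sm]) auto
    fix x assume "x \<in> P"
    hence "m x \<ge> 1" using m_pos[of x] by (auto simp: P_def)
    thus "\<phi> x \<le> real (m x) * \<phi> x" using \<phi>0[of x] by (intro mult_le_cancel_right1[THEN iffD2]) auto
  qed (use \<phi>0 in auto)
  have part: "(\<lambda>x. \<nu> x * \<phi> x) summable_on (N \<inter> J) \<and> \<bar>(\<Sum>\<^sub>\<infinity>x\<in>N \<inter> J. \<nu> x * \<phi> x) - (\<Sum>\<^sub>\<infinity>x\<in>P \<inter> J. \<phi> x)\<bar> \<le> K * B"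
    if "is_interval J" "antimono_on J \<phi> \<or> mono_on J \<phi>" "\<forall>x\<in>J. \<phi> x \<le> B" for J
    using K that \<phi>0 B summable_on_subset_banach[OF smP, of "P \<inter> J"] unfolding interlace_const_def by auto
  have le: "\<phi> x \<le> B" if "R \<le> \<bar>t - x\<bar>" for x
  proof -
    have "R\<^sup>2 \<le> (t - x)\<^sup>2" using that R by (metis abs_le_square_iff abs_of_nonneg)
    thus ?thesis unfolding \<phi>_def B_def using y den by (intro divide_left_mono add_right_mono mult_pos_pos add_nonneg_pos) auto
  qed
  have p1: "(\<lambda>x. \<nu> x * \<phi> x) summable_on (N \<inter> J1) \<and> \<bar>(\<Sum>\<^sub>\<infinity>x\<in>N \<inter> J1. \<nu> x * \<phi> x) - (\<Sum>\<^sub>\<infinity>x\<in>P \<inter> J1. \<phi> x)\<bar> \<le> K * B"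
  proof (rule part)
    show "antimono_on J1 \<phi> \<or> mono_on J1 \<phi>"
    proof (rule disjI2, rule mono_onI)
      fix a b assume "a \<in> J1" "b \<in> J1" "a \<le> b"
      hence "(t - b)\<^sup>2 \<le> (t - a)\<^sup>2" using R by (intro power_mono) (auto simp: J1_def)
      thus "\<phi> a \<le> \<phi> b" unfolding \<phi>_def using den by (intro divide_left_mono mult_pos_pos) auto
    qed
    show "\<forall>x\<in>J1. \<phi> x \<le> B" using le by (auto simp: J1_def)
  qed (auto simp: J1_def is_interval_1)
  have p2: "(\<lambda>x. \<nu> x * \<phi> x) summable_on (N \<inter> J2) \<and> \<bar>(\<Sum>\<^sub>\<infinity>x\<in>N \<inter> J2. \<nu> x * \<phi> x) - (\<Sum>\<^sub>\<infinity>x\<in>P \<inter> J2. \<phi> x)\<bar> \<le> K * B"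
  proof (rule part)
    show "antimono_on J2 \<phi> \<or> mono_on J2 \<phi>"
    proof (rule disjI1, rule monotone_onI)
      fix a b assume "a \<in> J2" "b \<in> J2" "a \<le> b"
      hence "(a - t)\<^sup>2 \<le> (b - t)\<^sup>2" using R by (intro power_mono) (auto simp: J2_def)
      hence "(t - a)\<^sup>2 \<le> (t - b)\<^sup>2" by (simp add: power2_commute)
      thus "\<phi> b \<le> \<phi> a" unfolding \<phi>_def using den by (intro divide_left_mono mult_pos_pos) auto
    qed
    show "\<forall>x\<in>J2. \<phi> x \<le> B" using le by (auto simp: J2_def)
  qed (auto simp: J2_def is_interval_1)
  have un: "X = (X \<inter> J1 \<union> X \<inter> J2) \<union> X \<inter> W" for X
    by (auto simp: J1_def J2_def W_def)
  have dis: "(X \<inter> J1) \<inter> (X \<inter> J2) = {}" "(X \<inter> J1 \<union> X \<inter> J2) \<inter> (X \<inter> W) = {}" for X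
    by (auto simp: J1_def J2_def W_def)
  have finW: "finite (N \<inter> W)" "finite (P \<inter> W)"
    by (rule finite_subset[OF _ finite_PN(2)[of "t - R" "t + R"]] finite_subset[OF _ finite_PN(1)[of "t - R" "t + R"]], auto simp: W_def)+
  have hs: "(g has_sum (infsum g (X \<inter> J1) + infsum g (X \<inter> J2) + sum g (X \<inter> W))) X"
    if "g summable_on (X \<inter> J1)" "g summable_on (X \<inter> J2)" "finite (X \<inter> W)" for g :: "real \<Rightarrow> real" and X
    using has_sum_Un_disjoint[OF has_sum_Un_disjoint[OF has_sum_infsum[OF that(1)] has_sum_infsum[OF that(2)] dis(1)] has_sum_finite[OF that(3), of g] dis(2)]
    by (simp flip: un)
  define a where "a = infsum \<phi> (P \<inter> J1) + infsum \<phi> (P \<inter> J2) + sum \<phi> (P \<inter> W)"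
  define b where "b = (\<Sum>\<^sub>\<infinity>x\<in>N \<inter> J1. \<nu> x * \<phi> x) + (\<Sum>\<^sub>\<infinity>x\<in>N \<inter> J2. \<nu> x * \<phi> x) + (\<Sum>x\<in>N \<inter> W. \<nu> x * \<phi> x)"
  have a: "(\<phi> has_sum a) P" unfolding a_def
    by (rule hs) (use summable_on_subset_banach[OF smP] finW in auto)
  have b: "((\<lambda>x. \<nu> x * \<phi> x) has_sum b) N" unfolding b_def
    by (rule hs) (use p1 p2 finW in auto)
  have a': "((\<lambda>x. indicator P x * \<phi> x) has_sum a) UNIV"
    by (rule iffD1[OF has_sum_cong_neutral a]) auto
  have b': "((\<lambda>x. \<nu> x * \<phi> x) has_sum b) UNIV"
    by (rule iffD1[OF has_sum_cong_neutral b]) (auto simp: \<nu>_def)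
  have c': "((\<lambda>x. real (m x) * \<phi> x) has_sum zsum f t y) UNIV"
    using has_sum_infsum[OF sm] by (simp add: zsum_def \<phi>_def)
  have "((\<lambda>x. real (m x) * \<phi> x + - (indicator P x * \<phi> x) + \<nu> x * \<phi> x) has_sum (zsum f t y + - a + b)) UNIV"
    by (intro has_sum_add a' b' c' has_sum_uminus[THEN iffD2]) (use a' in simp)
  moreover have "real (m x) * \<phi> x + - (indicator P x * \<phi> x) + \<nu> x * \<phi> x = real (m' x) / ((t - x)\<^sup>2 + y\<^sup>2)" for x
    by (simp add: m'_eq \<phi>_def algebra_simps add_divide_distrib diff_divide_distrib)
  ultimately have tot: "((\<lambda>x. real (m' x) / ((t - x)\<^sup>2 + y\<^sup>2)) has_sum (zsum f t y - a + b)) UNIV" by simp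
  show "(\<lambda>x. real (m' x) / ((t - x)\<^sup>2 + y\<^sup>2)) summable_on UNIV" using tot by (auto simp: summable_on_def)
  have "zsum (deriv f) t y = zsum f t y - a + b" unfolding zsum_def[of "deriv f"] using tot by (rule infsumI)
  moreover have "2 * K / (R\<^sup>2 + y\<^sup>2) = 2 * (K * B)" by (simp add: B_def)
  ultimately show "\<bar>zsum (deriv f) t y - (zsum f t y + (\<Sum>x\<in>N \<inter> W. \<nu> x * \<phi> x) - (\<Sum>x\<in>P \<inter> W. \<phi> x))\<bar> \<le> 2 * K / (R\<^sup>2 + y\<^sup>2)"
    using p1 p2 unfolding a_def b_def by linarith
qed


text \<open>Interlacing bounds the alternating sum of arguments by \<open>K * pi\<close> and
  \<open>Ln (- q)\<close> adds \<open>pi\<close>; the outer factor 2 accounts for the difference of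
  two values.\<close>

definition osc :: "real \<Rightarrow> real" where "osc K = 2 * ((K + 1) * pi)"

text \<open>The radius \<open>c * |t| / 2\<close> with \<open>c \<le> 1\<close> keeps
  \<open>|Re w| > |t| / 2\<close>, so the disc stays beyond \<open>T1\<close>, and
  \<open>|Im w| < c * |t| / 2\<close> keeps it within the cone.\<close>

lemma in_ball:
  assumes t: "\<bar>t\<bar> \<ge> 2 * T1" and R: "R = c * \<bar>t\<bar> / 2" and w: "w \<in> ball (of_real t) R"
  shows "\<bar>Re w\<bar> > T1" "\<bar>Im w\<bar> \<le> c * \<bar>Re w\<bar>" "w \<in> bowtie d" "\<bar>Re w - t\<bar> < R" "cnj w \<in> ball (of_real t) R"
proof -
  have n: "norm (w - of_real t) < R" using w by (simp add: dist_norm norm_minus_commute)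
  have re: "\<bar>Re w - t\<bar> < R" using n abs_Re_le_cmod[of "w - of_real t"] by simp
  have im: "\<bar>Im w\<bar> < R" using n abs_Im_le_cmod[of "w - of_real t"] by simp
  have R2: "R \<le> \<bar>t\<bar> / 2" using R c mult_right_mono[of c 1 "\<bar>t\<bar>"] by simp
  have r: "\<bar>Re w\<bar> > \<bar>t\<bar> / 2" using re R2 by linarith
  thus r1: "\<bar>Re w\<bar> > T1" using t by linarith
  have "c * (\<bar>t\<bar> / 2) \<le> c * \<bar>Re w\<bar>" using r c by (intro mult_left_mono) auto
  thus i1: "\<bar>Im w\<bar> \<le> c * \<bar>Re w\<bar>" using im R by simp
  have "Complex (Re w) \<bar>Im w\<bar> \<in> bowtie d" using in_bowtie[OF _ i1] by simp
  thus "w \<in> bowtie d" by (simp add: bowtie_def)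
  show "\<bar>Re w - t\<bar> < R" by fact
  have "norm (cnj w - of_real t) = norm (w - of_real t)"
    by (metis complex_cnj_complex_of_real complex_cnj_diff complex_mod_cnj)
  thus "cnj w \<in> ball (of_real t) R" using n by (simp add: dist_norm norm_minus_commute)
qed

lemma in_ball_nz:
  assumes t: "\<bar>t\<bar> \<ge> 2 * T1" and R: "R = c * \<bar>t\<bar> / 2" and w: "w \<in> ball (of_real t) R" "Im w \<noteq> 0"
  shows "f w \<noteq> 0" "deriv f w \<noteq> 0" "Im w > 0 \<Longrightarrow> Im (q w) < 0"
proof -
  have *: "f w \<noteq> 0 \<and> deriv f w \<noteq> 0 \<and> Im (q w) < 0" if w: "w \<in> ball (of_real t) R" "Im w > 0" for w
    using Im_q_neg'[of "Re w" "Im w"] in_ball[OF t R w(1)] w(2) by simp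
  show "Im w > 0 \<Longrightarrow> Im (q w) < 0" using * w by blast
  have "f w \<noteq> 0 \<and> deriv f w \<noteq> 0"
  proof (cases "Im w > 0")
    case False
    hence "f (cnj w) \<noteq> 0" "deriv f (cnj w) \<noteq> 0" using *[OF in_ball(5)[OF t R w(1)]] w(2) by auto
    thus ?thesis using sym sym' in_ball(3)[OF t R w(1)] by auto
  qed (use * w in blast)
  thus "f w \<noteq> 0" "deriv f w \<noteq> 0" by auto
qed

text \<open>\<open>f'' / f' - q\<close> is the logarithmic derivative of \<open>q\<close>, with
  residue 1 at new zeros and -1 at every zero of \<open>f\<close>, whatever its multiplicity. Off
  the axis neither \<open>f\<close> nor \<open>deriv f\<close> vanishes in the disc, so subtracting
  these principal parts leaves a holomorphic function: the difference of the logarithmic derivatives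
  of two zero-free cofactors.\<close>

lemma disc_log:
  assumes K: "interlace_const K" and t: "\<bar>t\<bar> \<ge> 2 * T1" and R: "R = c * \<bar>t\<bar> / 2"
  defines "W \<equiv> {t - R<..<t + R}" and "U \<equiv> ball (complex_of_real t) R"
  obtains L where "L holomorphic_on U"
    "\<And>w. w \<in> U \<Longrightarrow> Im w \<noteq> 0 \<Longrightarrow> L w = deriv (deriv f) w / deriv f w - q w
        - (\<Sum>n\<in>N \<inter> W. 1 / (w - of_real n)) + (\<Sum>p\<in>P \<inter> W. 1 / (w - of_real p))"
proof -
  have "\<bar>t\<bar> > 0" using t T1 by linarith
  hence "c * \<bar>t\<bar> > 0" using c by (intro mult_pos_pos) auto
  hence R0: "R > 0" using R by linarith
  define w1 where "w1 = Complex t (R / 2)"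
  have w1: "w1 \<in> U" using R0 by (simp add: w1_def U_def dist_norm cmod_def)
  have w1nz: "f w1 \<noteq> 0" "deriv f w1 \<noteq> 0"
    using in_ball_nz[OF t R, of w1] w1 R0 by (auto simp: U_def w1_def)
  have UO: "U \<subseteq> bowtie d" using in_ball(3)[OF t R] by (auto simp: U_def)
  have hU: "f holomorphic_on U" "deriv f holomorphic_on U" using holo holo' UO holomorphic_on_subset by blast+
  have finW: "finite (P \<inter> W)" "finite (N \<inter> W)"
    by (rule finite_subset[OF _ finite_PN(1)[of "t - R" "t + R"]] finite_subset[OF _ finite_PN(2)[of "t - R" "t + R"]], auto simp: W_def)+
  have fin: "finite ((P \<union> N) \<inter> W)" using finW by (simp add: Int_Un_distrib2)
  have WU: "of_real ` W \<subseteq> U" by (auto simp: W_def U_def dist_of_real dist_real_def)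
  have open_U: "open U" "connected U" by (auto simp: U_def)
  obtain h0 where h0: "h0 holomorphic_on U" "\<And>x. x \<in> P \<inter> W \<Longrightarrow> h0 (of_real x) \<noteq> 0"
    "\<And>w. w \<in> U \<Longrightarrow> f w = (\<Prod>x\<in>P \<inter> W. (w - of_real x) ^ m x) * h0 w"
    using zmult_factor_real[OF hU(1) open_U w1 w1nz(1) finW(1)] WU by blast
  obtain h1 where h1: "h1 holomorphic_on U" "\<And>x. x \<in> (P \<union> N) \<inter> W \<Longrightarrow> h1 (of_real x) \<noteq> 0"
    "\<And>w. w \<in> U \<Longrightarrow> deriv f w = (\<Prod>x\<in>(P \<union> N) \<inter> W. (w - of_real x) ^ m' x) * h1 w"
    using zmult_factor_real[OF hU(2) open_U w1 w1nz(2) fin] WU by blast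
  have real_pt: "w = of_real (Re w) \<and> Re w \<in> W" if "w \<in> U" "Im w = 0" for w
    using in_ball(4)[OF t R, of w] that by (auto simp: U_def W_def complex_eq_iff)
  have h0nz: "h0 w \<noteq> 0" if w: "w \<in> U" for w
  proof
    assume z: "h0 w = 0"
    hence fw: "f w = 0" using h0(3)[OF w] by simp
    hence "Im w = 0" using in_ball_nz(1)[OF t R, of w] w by (auto simp: U_def)
    hence "w = of_real (Re w)" "Re w \<in> P \<inter> W" using real_pt[OF w] fw by (auto simp: P_def)
    thus False using h0(2) z by metis
  qed
  have h1nz: "h1 w \<noteq> 0" if w: "w \<in> U" for w
  proof
    assume z: "h1 w = 0"
    hence fw: "deriv f w = 0" using h1(3)[OF w] by simp
    hence "Im w = 0" using in_ball_nz(2)[OF t R, of w] w by (auto simp: U_def)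
    hence "w = of_real (Re w)" "Re w \<in> (P \<union> N) \<inter> W" using real_pt[OF w] fw by (auto simp: P_def N_def)
    thus False using h1(2) z by metis
  qed
  define L where "L = (\<lambda>w. deriv h1 w / h1 w - deriv h0 w / h0 w)"
  have L: "L holomorphic_on U" unfolding L_def
    by (intro holomorphic_intros holomorphic_deriv h0(1) h1(1) open_U) (use h0nz h1nz in auto)
  have "L w = deriv (deriv f) w / deriv f w - q w
        - (\<Sum>n\<in>N \<inter> W. 1 / (w - of_real n)) + (\<Sum>p\<in>P \<inter> W. 1 / (w - of_real p))"
    if w: "w \<in> U" "Im w \<noteq> 0" for w
  proof -
    have nz: "f w \<noteq> 0" "deriv f w \<noteq> 0" using in_ball_nz[OF t R, of w] w by (auto simp: U_def)
    have nr: "w \<noteq> of_real x" for x using w by auto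
    have e0: "q w = (\<Sum>x\<in>P \<inter> W. of_nat (m x) / (w - of_real x)) + deriv h0 w / h0 w"
      unfolding q_def by (rule logderiv_prod_power[OF finW(1) open_U(1) w(1) h0(1) nz(1) h0(3) nr])
    have e1: "deriv (deriv f) w / deriv f w = (\<Sum>x\<in>(P \<union> N) \<inter> W. of_nat (m' x) / (w - of_real x)) + deriv h1 w / h1 w"
      by (rule logderiv_prod_power[OF fin open_U(1) w(1) h1(1) nz(2) h1(3) nr])
    have "(\<Sum>x\<in>(P \<union> N) \<inter> W. of_nat (m' x) / (w - of_real x)) =
       (\<Sum>x\<in>P \<inter> W. of_nat (m' x) / (w - of_real x)) + (\<Sum>x\<in>N \<inter> W. of_nat (m' x) / (w - of_real x))"
      unfolding Int_Un_distrib2 by (rule sum.union_disjoint) (use finW in \<open>auto simp: P_def N_def\<close>)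
    also have "(\<Sum>x\<in>N \<inter> W. of_nat (m' x) / (w - of_real x)) = (\<Sum>x\<in>N \<inter> W. 1 / (w - of_real x))"
    proof (intro sum.cong refl)
      fix x assume x: "x \<in> N \<inter> W"
      hence "of_real x \<in> U" using WU by auto
      hence "\<bar>x\<bar> > T1" using in_ball(1)[OF t R, of "of_real x"] by (simp add: U_def)
      thus "of_nat (m' x) / (w - of_real x) = 1 / (w - of_real x)" using m'_N[of x] x by simp
    qed
    also have "(\<Sum>x\<in>P \<inter> W. of_nat (m' x) / (w - of_real x)) = (\<Sum>x\<in>P \<inter> W. of_nat (m x) / (w - of_real x) - 1 / (w - of_real x))"
    proof (intro sum.cong refl)
      fix x assume x: "x \<in> P \<inter> W"
      hence "m x > 0" "m' x = m x - 1" using m_pos[of x] m'_P[of x] by (auto simp: P_def)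
      thus "of_nat (m' x) / (w - of_real x) = of_nat (m x) / (w - of_real x) - 1 / (w - of_real x)"
        by (simp add: of_nat_diff diff_divide_distrib)
    qed
    finally show ?thesis unfolding L_def e0 e1 by (simp add: sum_subtractf)
  qed
  thus ?thesis using that L by blast
qed


text \<open>
  On the upper half-disc \<open>g\<close> differs by a constant from \<open>Ln (- q)\<close> plus an alternating sum of
  \<open>Ln (w - x)\<close> over the poles and zeros \<open>x\<close> of \<open>q\<close>. As \<open>Im (Ln (w - x))\<close> is monotone in \<open>x\<close> with values in
  \<open>[0, pi]\<close>, interlacing bounds this sum independently of the number of its terms.
\<close>

lemma disc_osc:
  assumes K: "interlace_const K" and t: "\<bar>t\<bar> \<ge> 2 * T1" and R: "R = c * \<bar>t\<bar> / 2"
  defines "W \<equiv> {t - R<..<t + R}" and "U \<equiv> ball (complex_of_real t) R"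
  assumes L: "\<And>w. w \<in> U \<Longrightarrow> Im w \<noteq> 0 \<Longrightarrow> L w = deriv (deriv f) w / deriv f w - q w
        - (\<Sum>n\<in>N \<inter> W. 1 / (w - of_real n)) + (\<Sum>p\<in>P \<inter> W. 1 / (w - of_real p))"
    and g: "\<And>w. w \<in> U \<Longrightarrow> (g has_field_derivative L w) (at w)"
    and w: "w \<in> U" "Im w \<ge> 0" "v \<in> U" "Im v > 0"
  shows "\<bar>Im (g w) - Im (g v)\<bar> \<le> osc K"
proof -
  define H where "H = U \<inter> {w. Im w > 0}"
  have H: "open H" "convex H"
    by (auto simp: H_def U_def intro!: open_Int convex_Int convex_halfspace_Im_gt open_halfspace_Im_gt)
  have finW: "finite (P \<inter> W)" "finite (N \<inter> W)"
    by (rule finite_subset[OF _ finite_PN(1)[of "t - R" "t + R"]] finite_subset[OF _ finite_PN(2)[of "t - R" "t + R"]], auto simp: W_def)+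
  define S where "S = (\<lambda>w. (\<Sum>p\<in>P \<inter> W. Ln (w - of_real p)) - (\<Sum>n\<in>N \<inter> W. Ln (w - of_real n)))"
  define \<Lambda> where "\<Lambda> = (\<lambda>w. Ln (- q w) + S w)"
  have Hnz: "f w \<noteq> 0" "deriv f w \<noteq> 0" "Im (q w) < 0" "w \<in> bowtie d" "w \<in> U" "Im w > 0" if "w \<in> H" for w
    using in_ball_nz[OF t R, of w] in_ball(3)[OF t R, of w] that by (auto simp: H_def U_def)
  have d\<Lambda>: "(\<Lambda> has_field_derivative L w) (at w)" if w: "w \<in> H" for w
  proof -
    note nz = Hnz[OF w]
    have np: "- q w \<notin> \<real>\<^sub>\<le>\<^sub>0" using nz(3) by (auto simp: complex_nonpos_Reals_iff)
    have np': "w - of_real x \<notin> \<real>\<^sub>\<le>\<^sub>0" for x using nz(6) by (auto simp: complex_nonpos_Reals_iff)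
    have dq: "(q has_field_derivative ((deriv (deriv f) w * f w - deriv f w * deriv f w) / (f w * f w))) (at w)"
      unfolding q_def by (rule DERIV_divide holomorphic_derivI[OF holo open_bowtie] holomorphic_derivI[OF holo' open_bowtie] nz)+
    have "((\<lambda>w. Ln (- q w)) has_field_derivative (1 / (- q w)) * (- ((deriv (deriv f) w * f w - deriv f w * deriv f w) / (f w * f w)))) (at w)"
      using DERIV_chain2[OF has_field_derivative_Ln[OF np] DERIV_minus[OF dq]] by (simp add: inverse_eq_divide)
    moreover have "(1 / (- q w)) * (- ((deriv (deriv f) w * f w - deriv f w * deriv f w) / (f w * f w))) = deriv (deriv f) w / deriv f w - q w"
      using nz(1,2) by (simp add: q_def field_simps)
    moreover have "((\<lambda>w. \<Sum>x\<in>X. Ln (w - of_real x)) has_field_derivative (\<Sum>x\<in>X. 1 / (w - of_real x))) (at w)" for X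
      by (intro DERIV_sum) (use np' in \<open>auto intro!: derivative_eq_intros simp: inverse_eq_divide\<close>)
    ultimately have "(\<Lambda> has_field_derivative (deriv (deriv f) w / deriv f w - q w + ((\<Sum>p\<in>P \<inter> W. 1 / (w - of_real p)) - (\<Sum>n\<in>N \<inter> W. 1 / (w - of_real n))))) (at w)"
      unfolding \<Lambda>_def S_def by (intro DERIV_add DERIV_diff) auto
    moreover have "L w = deriv (deriv f) w / deriv f w - q w + ((\<Sum>p\<in>P \<inter> W. 1 / (w - of_real p)) - (\<Sum>n\<in>N \<inter> W. 1 / (w - of_real n)))"
      using L[of w] nz by simp
    ultimately show ?thesis by simp
  qed
  have bd\<Lambda>: "\<bar>Im (\<Lambda> w)\<bar> \<le> (K + 1) * pi" if w: "w \<in> H" for w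
  proof -
    note nz = Hnz[OF w]
    define \<phi> where "\<phi> = (\<lambda>u::real. Im (Ln (w - of_real u)))"
    have \<phi>: "0 \<le> \<phi> u" "\<phi> u \<le> pi" for u
    proof -
      have "w - of_real u \<noteq> 0" using nz(6) by (auto simp: complex_eq_iff)
      thus "0 \<le> \<phi> u" "\<phi> u \<le> pi" unfolding \<phi>_def using Im_Ln_pos_lt[of "w - of_real u"] nz(6) by auto
    qed
    have "mono_on W \<phi>" unfolding \<phi>_def by (intro mono_onI Im_Ln_diff_mono nz)
    moreover have "\<phi> summable_on P \<inter> W" using finW by simp
    moreover have "is_interval W" unfolding W_def is_interval_1 by auto
    ultimately have "\<bar>(\<Sum>\<^sub>\<infinity>x\<in>N \<inter> W. \<nu> x * \<phi> x) - (\<Sum>\<^sub>\<infinity>x\<in>P \<inter> W. \<phi> x)\<bar> \<le> K * pi"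
      using K \<phi> pi_ge_zero unfolding interlace_const_def by blast
    moreover have "(\<Sum>\<^sub>\<infinity>x\<in>N \<inter> W. \<nu> x * \<phi> x) = (\<Sum>x\<in>N \<inter> W. \<phi> x)"
    proof -
      have "\<nu> x = 1" if x: "x \<in> N \<inter> W" for x
      proof -
        have "of_real x \<in> ball (complex_of_real t) R" using x by (auto simp: W_def dist_of_real dist_real_def)
        hence "\<bar>x\<bar> > T1" using in_ball(1)[OF t R, of "of_real x"] by simp
        thus ?thesis using m'_N[of x] x by (simp add: \<nu>_def)
      qed
      thus ?thesis using finW by simp
    qed
    moreover have "Im (S w) = (\<Sum>x\<in>P \<inter> W. \<phi> x) - (\<Sum>x\<in>N \<inter> W. \<phi> x)" by (simp add: S_def \<phi>_def)
    ultimately have S: "\<bar>Im (S w)\<bar> \<le> K * pi" using finW by (simp add: abs_minus_commute)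
    have "- q w \<noteq> 0" using nz(3) by auto
    hence "\<bar>Im (Ln (- q w))\<bar> \<le> pi" using Im_Ln_le_pi[of "- q w"] mpi_less_Im_Ln[of "- q w"] by (simp add: abs_le_iff)
    thus ?thesis using S by (simp add: \<Lambda>_def algebra_simps abs_le_iff)
  qed
  have HH: "\<bar>Im (g w) - Im (g v)\<bar> \<le> osc K" if wv: "w \<in> H" "v \<in> H" for w v
  proof -
    have "\<exists>k. \<forall>x\<in>H. g x - \<Lambda> x = k"
    proof (rule has_field_derivative_zero_constant[OF H(2)])
      fix x assume "x \<in> H"
      hence "((\<lambda>x. g x - \<Lambda> x) has_field_derivative L x - L x) (at x)"
        by (intro DERIV_diff g d\<Lambda>) (auto simp: H_def)
      thus "((\<lambda>x. g x - \<Lambda> x) has_field_derivative 0) (at x within H)" by (simp add: has_field_derivative_at_within)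
    qed
    then obtain k where k: "\<And>x. x \<in> H \<Longrightarrow> g x = \<Lambda> x + k" by (auto simp: diff_eq_eq add.commute)
    have "Im (g w) - Im (g v) = Im (\<Lambda> w) - Im (\<Lambda> v)" using k wv by simp
    thus ?thesis using bd\<Lambda>[OF wv(1)] bd\<Lambda>[OF wv(2)] unfolding osc_def by linarith
  qed
  have vH: "v \<in> H" using w by (simp add: H_def)
  have "isCont g w" using g[OF w(1)] DERIV_isCont by blast
  moreover have "((\<lambda>y. w + \<i> * of_real y) \<longlongrightarrow> w) (at_right 0)"
    by (rule tendsto_eq_intros refl | simp)+
  ultimately have lim: "((\<lambda>y. g (w + \<i> * of_real y)) \<longlongrightarrow> g w) (at_right 0)"
    by (rule isCont_tendsto_compose)
  have limI: "((\<lambda>y. \<bar>Im (g (w + \<i> * of_real y)) - Im (g v)\<bar>) \<longlongrightarrow> \<bar>Im (g w) - Im (g v)\<bar>) (at_right 0)"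
    by (intro tendsto_intros lim)
  define e where "e = R - dist (of_real t) w"
  have e: "e > 0" using w(1) by (simp add: U_def e_def)
  have "eventually (\<lambda>y. y \<in> {0<..<e}) (at_right 0)"
    by (rule eventually_at_rightI[of 0 e]) (use e in auto)
  hence "eventually (\<lambda>y. \<bar>Im (g (w + \<i> * of_real y)) - Im (g v)\<bar> \<le> osc K) (at_right 0)"
  proof eventually_elim
    case (elim y)
    have "dist (of_real t) (w + \<i> * of_real y) \<le> dist (of_real t) w + dist w (w + \<i> * of_real y)" by (rule dist_triangle)
    also have "dist w (w + \<i> * of_real y) = y" using elim by (simp add: dist_norm norm_mult)
    finally have "w + \<i> * of_real y \<in> H" using elim w(2) by (simp add: H_def U_def e_def)
    thus ?case using HH vH by blast
  qed
  thus ?thesis by (intro tendsto_upperbound[OF limI]) auto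
qed

text \<open>The derivative of \<open>L\<close> is the second derivative of a primitive
  \<open>G\<close>. The oscillation bound only covers the upper half-disc; the lower one follows
  from the reflected primitive, which has the same derivative because \<open>L\<close> is symmetric.
  Both bounds meet at the real centre \<open>t\<close>, whence \<open>2 * osc K\<close>.\<close>

lemma disc_deriv_bound:
  assumes K: "interlace_const K" and t: "\<bar>t\<bar> \<ge> 2 * T1" and R: "R = c * \<bar>t\<bar> / 2"
  defines "W \<equiv> {t - R<..<t + R}" and "U \<equiv> ball (complex_of_real t) R"
  assumes Lh: "L holomorphic_on U" and L: "\<And>w. w \<in> U \<Longrightarrow> Im w \<noteq> 0 \<Longrightarrow> L w = deriv (deriv f) w / deriv f w - q w
        - (\<Sum>n\<in>N \<inter> W. 1 / (w - of_real n)) + (\<Sum>p\<in>P \<inter> W. 1 / (w - of_real p))"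
    and w: "w \<in> ball (of_real t) (R / 2)" "Im w \<noteq> 0"
  shows "\<bar>Im (L w)\<bar> \<le> 64 * exp (2 * (2 * osc K)) / R\<^sup>2 * \<bar>Im w\<bar>"
proof -
  have "\<bar>t\<bar> > 0" using t T1 by linarith
  hence "c * \<bar>t\<bar> > 0" using c by (intro mult_pos_pos) auto
  hence R0: "R > 0" using R by linarith
  have cU: "cnj z \<in> U" if "z \<in> U" for z using in_ball(5)[OF t R, of z] that by (simp add: U_def)
  have symL: "L (cnj z) = cnj (L z)" if z: "z \<in> U" "Im z \<noteq> 0" for z
  proof -
    have zO: "z \<in> bowtie d" using in_ball(3)[OF t R, of z] z by (simp add: U_def)
    have "deriv (deriv f) (cnj z) = cnj (deriv (deriv f) z)"
      by (rule deriv_cnj[OF open_bowtie zO holo']) (auto simp: sym')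
    thus ?thesis using L[OF z] L[OF cU[OF z(1)]] z zO by (simp add: q_def sym sym')
  qed
  obtain G where G: "\<And>w. w \<in> U \<Longrightarrow> (G has_field_derivative L w) (at w)"
    using holomorphic_convex_primitive'[of U L] Lh by (auto simp: U_def at_within_open[of _ "ball (complex_of_real t) R"])
  define Gc where "Gc = cnj \<circ> G \<circ> cnj"
  have Gh: "G holomorphic_on U"
    unfolding holomorphic_on_def field_differentiable_def using G has_field_derivative_at_within by blast
  define v where "v = Complex t (R / 2)"
  have v: "v \<in> U" "Im v > 0" "of_real t \<in> U" using R0 by (simp_all add: v_def U_def dist_norm cmod_def)
  \<comment> \<open>The formula for \<open>L\<close> holds off the axis only; the identity theorem
    extends its symmetry to real points.\<close>
  have symL': "L (cnj z) = cnj (L z)" if z: "z \<in> U" for z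
  proof -
    have cU': "cnj ` U = U" using cU by (auto simp: image_iff) (metis complex_cnj_cnj)
    have Lc: "(cnj \<circ> L \<circ> cnj) holomorphic_on U"
      using Lh cU' by (subst holomorphic_on_compose_cnj_cnj) (auto simp: U_def)
    have "L z - (cnj \<circ> L \<circ> cnj) z = 0"
    proof (rule analytic_continuation[of "\<lambda>z. L z - (cnj \<circ> L \<circ> cnj) z" U "U \<inter> {z. Im z > 0}" v])
      show "(\<lambda>z. L z - (cnj \<circ> L \<circ> cnj) z) holomorphic_on U" using Lh Lc by (intro holomorphic_intros)
      show "v islimpt U \<inter> {z. 0 < Im z}"
        by (rule open_imp_islimpt) (use v in \<open>auto simp: U_def intro!: open_Int open_halfspace_Im_gt\<close>)
    qed (use symL v z in \<open>auto simp: U_def\<close>)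
    thus ?thesis by (simp add: o_def)
  qed
  have Gc: "(Gc has_field_derivative L z) (at z)" if z: "z \<in> U" for z
  proof -
    have "(Gc has_field_derivative cnj (L (cnj z))) (at z)"
      unfolding Gc_def using G[OF cU[OF z(1)]] has_field_derivative_cnj_cnj by blast
    thus ?thesis using symL'[OF z] by simp
  qed
  note D1 = disc_osc[OF K t R L[unfolded U_def W_def] G[unfolded U_def], folded U_def W_def]
  note D2 = disc_osc[OF K t R L[unfolded U_def W_def] Gc[unfolded U_def], folded U_def W_def]
  have osc: "\<bar>Im (G z) - Im (G (of_real t))\<bar> \<le> 2 * osc K" if z: "z \<in> U" for z
  proof (cases "Im z \<ge> 0")
    case True
    have "\<bar>Im (G z) - Im (G v)\<bar> \<le> osc K" by (rule D1) (use z v True in auto)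
    moreover have "\<bar>Im (G (of_real t)) - Im (G v)\<bar> \<le> osc K" by (rule D1) (use v in auto)
    ultimately show ?thesis by linarith
  next
    case False
    have "\<bar>Im (Gc (cnj z)) - Im (Gc v)\<bar> \<le> osc K" by (rule D2) (use z v False cU in auto)
    moreover have "\<bar>Im (Gc (of_real t)) - Im (Gc v)\<bar> \<le> osc K" by (rule D2) (use v in auto)
    moreover have "Im (Gc (cnj z)) = - Im (G z)" "Im (Gc (of_real t)) = - Im (G (of_real t))" by (auto simp: Gc_def)
    ultimately show ?thesis by linarith
  qed
  have dG: "deriv (deriv G) z = deriv L z" if "z \<in> U" for z
  proof (rule deriv_cong_ev[OF _ refl])
    show "eventually (\<lambda>z. deriv G z = L z) (nhds z)"
      using eventually_nhds_in_open[of U z] that G by (auto simp: U_def elim!: eventually_mono intro!: DERIV_imp_deriv)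
  qed
  show ?thesis
  proof (rule Im_le_deriv_bound[of "ball (of_real t) (R / 2)"])
    fix z assume z: "z \<in> ball (complex_of_real t) (R / 2)"
    hence zU: "z \<in> U" using R0 by (simp add: U_def)
    show "(L has_field_derivative deriv L z) (at z)" by (rule holomorphic_derivI[OF Lh _ zU]) (simp add: U_def)
    show "norm (deriv L z) \<le> 64 * exp (2 * (2 * osc K)) / R\<^sup>2"
      using norm_deriv2_le_of_Im_bounded[OF Gh[unfolded U_def] R0 osc[unfolded U_def] z] dG[OF zU] by simp
  next
    have wU: "w \<in> U" using w R0 by (simp add: U_def)
    show "L (cnj w) = cnj (L w)" by (rule symL[OF wU w(2)])
    have "norm (cnj w - of_real t) = norm (w - of_real t)"
      by (metis complex_cnj_complex_of_real complex_cnj_diff complex_mod_cnj)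
    thus "cnj w \<in> ball (of_real t) (R / 2)" using w by (simp add: dist_norm norm_minus_commute)
  qed (use w in auto)
qed

text \<open>The induction over the order of the derivative rests on this: the class is closed under
  \<open>deriv\<close>, with worse constants but with errors of the same order in
  \<open>t\<close>.\<close>

theorem near_real_rooted_deriv: "\<exists>c' T' A' C'. near_real_rooted d (deriv f) c' T' A' C'"
proof -
  obtain K where K: "interlace_const K" using interlace_const_ex by blast
  have K0: "K > 0" using K by (simp add: interlace_const_def)
  define K2 where "K2 = 64 * exp (2 * (2 * osc K))"
  \<comment> \<open>The factor \<open>4 / c^2\<close> is \<open>t^2 / R^2\<close> for
    \<open>R = c * |t| / 2\<close>.\<close>
  define C' where "C' = C + 4 * (K2 + 2 * K) / c\<^sup>2"
  \<comment> \<open>Beyond \<open>4 * K / (c^2 * A)\<close> the exchange of zeros at height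
    \<open>c * |t|\<close>, which costs \<open>2 * K / (c * t)^2\<close>, takes away at most half of
    \<open>A / |t|\<close>.\<close>
  define T' where "T' = 2 * T1 + 4 * K / (c\<^sup>2 * A)"
  have T': "T' \<ge> 2 * T1" "T' \<ge> 4 * K / (c\<^sup>2 * A)" "T' \<ge> 1"
    using K0 A c T1 by (auto simp: T'_def add_increasing2)
  \<comment> \<open>With \<open>y \<le> c * |t| / 8 = R / 4\<close> the point stays in the
    concentric disc of radius \<open>R / 2\<close>, where \<open>L\<close> is controlled.\<close>
  have "near_real_rooted d (deriv f) (c / 8) T' (A / 2) C'"
  proof
    show "d > 0" "0 < c / 8" "c / 8 \<le> d" "c / 8 \<le> 1" "T' \<ge> 1" "A / 2 > 0" using d c A T' by auto
    show "C' \<ge> 0" using C K0 c by (auto simp: C'_def K2_def)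
    show "deriv f holomorphic_on bowtie d" by (rule holo')
    show "\<And>w. w \<in> bowtie d \<Longrightarrow> deriv f (cnj w) = cnj (deriv f w)" by (rule sym')
    show "(\<lambda>x. real (m' x) / (1 + x\<^sup>2)) summable_on UNIV"
      using zsum_deriv(1)[OF K, of 1 0 0] by (simp add: add.commute)
    show "A / 2 / \<bar>t\<bar> \<le> zsum (deriv f) t (c / 8 * \<bar>t\<bar>)" if t: "\<bar>t\<bar> \<ge> T'" for t
    proof -
      have t0: "\<bar>t\<bar> > 0" "\<bar>t\<bar> \<ge> T" "4 * K / (c\<^sup>2 * A) \<le> \<bar>t\<bar>" using t T' T1 by linarith+
      have y: "c * \<bar>t\<bar> > 0" "c / 8 * \<bar>t\<bar> > 0" using c t0 by auto
      \<comment> \<open>The comparison is made at the edge of the old cone, with an empty window,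
        and then carried down to the edge of the new one by monotonicity in
        \<open>y\<close>.\<close>
      have "\<bar>zsum (deriv f) t (c * \<bar>t\<bar>) - zsum f t (c * \<bar>t\<bar>)\<bar> \<le> 2 * K / (c * \<bar>t\<bar>)\<^sup>2"
        using zsum_deriv(2)[OF K y(1), of 0 t] by simp
      moreover have "2 * K / (c * \<bar>t\<bar>)\<^sup>2 \<le> A / (2 * \<bar>t\<bar>)"
      proof -
        have "4 * K \<le> \<bar>t\<bar> * (c\<^sup>2 * A)" using t0(3) c A by (simp add: pos_divide_le_eq)
        hence "2 * K \<le> \<bar>t\<bar> * (c\<^sup>2 * A) / 2" by simp
        hence "2 * K / (c * \<bar>t\<bar>)\<^sup>2 \<le> (\<bar>t\<bar> * (c\<^sup>2 * A) / 2) / (c * \<bar>t\<bar>)\<^sup>2" by (rule divide_right_mono) simp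
        also have "\<dots> = A / (2 * \<bar>t\<bar>)" using t0 c by (simp add: power2_eq_square field_simps)
        finally show ?thesis .
      qed
      ultimately have "A / \<bar>t\<bar> - A / (2 * \<bar>t\<bar>) \<le> zsum (deriv f) t (c * \<bar>t\<bar>)" using zsum_ge[OF t0(2)] by linarith
      also have "\<dots> \<le> zsum (deriv f) t (c / 8 * \<bar>t\<bar>)"
        unfolding zsum_def
      proof (intro infsum_mono zsum_deriv(1)[OF K y(1), of 0 t] zsum_deriv(1)[OF K y(2), of 0 t])
        fix x
        show "real (m' x) / ((t - x)\<^sup>2 + (c * \<bar>t\<bar>)\<^sup>2) \<le> real (m' x) / ((t - x)\<^sup>2 + (c / 8 * \<bar>t\<bar>)\<^sup>2)"
          using y by (intro divide_left_mono add_left_mono power_mono mult_pos_pos add_nonneg_pos) auto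
      qed auto
      finally show ?thesis by (simp add: field_simps)
    qed
    show "\<bar>Im (deriv (deriv f) (Complex t y) / deriv f (Complex t y)) + y * zsum (deriv f) t y\<bar> \<le> C' * y / t\<^sup>2"
      if t: "\<bar>t\<bar> \<ge> T'" and y: "0 < y" "y \<le> c / 8 * \<bar>t\<bar>" for t y
    proof -
      have t0: "\<bar>t\<bar> > 0" "\<bar>t\<bar> \<ge> T" "\<bar>t\<bar> \<ge> 2 * T1" using t T' T1 by linarith+
      define R where "R = c * \<bar>t\<bar> / 2"
      define W where "W = {t - R<..<t + R}"
      have ct: "c * \<bar>t\<bar> > 0" using c t0 by simp
      have R0: "R > 0" using ct by (simp add: R_def)
      have y': "y \<le> c * \<bar>t\<bar>" "y < R / 2" using y ct unfolding R_def by linarith+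
      define w where "w = Complex t y"
      define \<phi> where "\<phi> = (\<lambda>x. 1 / ((t - x)\<^sup>2 + y\<^sup>2))"
      obtain L where L: "L holomorphic_on ball (complex_of_real t) R"
        "\<And>w. w \<in> ball (complex_of_real t) R \<Longrightarrow> Im w \<noteq> 0 \<Longrightarrow> L w = deriv (deriv f) w / deriv f w - q w
        - (\<Sum>n\<in>N \<inter> W. 1 / (w - of_real n)) + (\<Sum>p\<in>P \<inter> W. 1 / (w - of_real p))"
        using disc_log[OF K t0(3) R_def] unfolding W_def by blast
      have wb: "w \<in> ball (complex_of_real t) (R / 2)" "w \<in> ball (complex_of_real t) R" "Im w \<noteq> 0"
        using y y' by (auto simp: w_def dist_norm cmod_def)
      have 1: "\<bar>Im (L w)\<bar> \<le> K2 / R\<^sup>2 * y"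
        using disc_deriv_bound[OF K t0(3) R_def L(1) L(2)[unfolded W_def] wb(1,3)] y unfolding K2_def by (simp add: w_def)
      have Im1: "Im (1 / (w - of_real x)) = - (y * \<phi> x)" for x
        by (simp add: Im_divide w_def \<phi>_def)
      have "Im (L w) = Im (deriv (deriv f) w / deriv f w) - Im (q w) + y * (\<Sum>x\<in>N \<inter> W. \<phi> x) - y * (\<Sum>x\<in>P \<inter> W. \<phi> x)"
        unfolding L(2)[OF wb(2,3)] by (simp add: Im1 sum_negf sum_distrib_left del: Im_divide)
      hence e1: "Im (deriv (deriv f) w / deriv f w) = Im (L w) + Im (q w) - y * (\<Sum>x\<in>N \<inter> W. \<phi> x) + y * (\<Sum>x\<in>P \<inter> W. \<phi> x)"
        by simp
      have \<nu>: "(\<Sum>x\<in>N \<inter> W. \<nu> x * \<phi> x) = (\<Sum>x\<in>N \<inter> W. \<phi> x)"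
      proof (intro sum.cong refl)
        fix x assume x: "x \<in> N \<inter> W"
        have "of_real x \<in> ball (complex_of_real t) R" using x by (auto simp: W_def dist_of_real dist_real_def)
        hence "\<bar>x\<bar> > T1" using in_ball(1)[OF t0(3) R_def, of "of_real x"] by simp
        thus "\<nu> x * \<phi> x = \<phi> x" using m'_N[of x] x by (simp add: \<nu>_def)
      qed
      define z where "z = zsum (deriv f) t y - (zsum f t y + (\<Sum>x\<in>N \<inter> W. \<phi> x) - (\<Sum>x\<in>P \<inter> W. \<phi> x))"
      have "\<bar>z\<bar> \<le> 2 * K / (R\<^sup>2 + y\<^sup>2)"
        using zsum_deriv(2)[OF K y(1) less_imp_le[OF R0], of t] \<nu> unfolding z_def W_def \<phi>_def by simp
      also have "\<dots> \<le> 2 * K / R\<^sup>2" using R0 K0 by (intro divide_left_mono mult_pos_pos add_pos_nonneg) auto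
      finally have "y * \<bar>z\<bar> \<le> y * (2 * K / R\<^sup>2)" using y by (intro mult_left_mono) auto
      hence 2: "\<bar>y * z\<bar> \<le> 2 * K / R\<^sup>2 * y" using y by (simp add: abs_mult mult.commute)
      have e2: "y * zsum (deriv f) t y = y * z + y * zsum f t y + y * (\<Sum>x\<in>N \<inter> W. \<phi> x) - y * (\<Sum>x\<in>P \<inter> W. \<phi> x)"
        unfolding z_def by (simp add: algebra_simps)
      have 3: "\<bar>Im (q w) + y * zsum f t y\<bar> \<le> C * y / t\<^sup>2"
        unfolding w_def q_def by (rule Im_q[OF t0(2) y(1) y'(1)])
      \<comment> \<open>The sums over the zeros in the disc cancel between \<open>e1\<close> and
        \<open>e2\<close>, leaving \<open>L\<close>, the error of \<open>f\<close> and the tail of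
        the exchange.\<close>
      have "\<bar>Im (deriv (deriv f) w / deriv f w) + y * zsum (deriv f) t y\<bar> \<le> K2 / R\<^sup>2 * y + 2 * K / R\<^sup>2 * y + C * y / t\<^sup>2"
        unfolding e1 e2 using 1 2 3 by linarith
      also have "\<dots> = C' * y / t\<^sup>2"
      proof -
        have Rsq: "R\<^sup>2 = c\<^sup>2 * t\<^sup>2 / 4" by (simp add: R_def power_mult_distrib power_divide)
        show ?thesis unfolding Rsq C'_def using c t0 by (simp add: field_simps)
      qed
      finally show ?thesis by (simp add: w_def)
    qed
  qed
  thus ?thesis by blast
qed


section \<open>Return to the real axis\<close>

lemma zero_gap:
  assumes "f (of_real t) \<noteq> 0"
  obtains \<delta> where "\<delta> > 0" "\<And>x. m x \<noteq> 0 \<Longrightarrow> \<bar>t - x\<bar> \<ge> \<delta>"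
proof -
  have "isCont f (of_real t)"
    using holomorphic_on_imp_analytic_at[OF holo open_bowtie] d by (intro analytic_at_imp_isCont) auto
  then obtain \<delta> where \<delta>: "\<delta> > 0" "\<And>z. dist z (of_real t) < \<delta> \<Longrightarrow> f z \<noteq> 0"
    using continuous_at_avoid[of "complex_of_real t" f 0] assms by (auto simp: dist_commute)
  have "\<bar>t - x\<bar> \<ge> \<delta>" if "m x \<noteq> 0" for x
  proof (rule ccontr)
    assume "\<not> \<bar>t - x\<bar> \<ge> \<delta>"
    hence "dist (complex_of_real x) (of_real t) < \<delta>" by (simp add: dist_of_real dist_real_def abs_minus_commute)
    thus False using \<delta>(2) m_pos[of x] that by auto
  qed
  thus ?thesis using that \<delta>(1) by blast
qed

lemma summable_zsum_0:
  assumes "f (of_real t) \<noteq> 0"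
  shows "(\<lambda>x. real (m x) / (t - x)\<^sup>2) summable_on UNIV"
proof -
  obtain \<delta> where \<delta>: "\<delta> > 0" "\<And>x. m x \<noteq> 0 \<Longrightarrow> \<bar>t - x\<bar> \<ge> \<delta>" using zero_gap[OF assms] by blast
  show ?thesis
  proof (rule summable_on_comparison_test)
    show "(\<lambda>x. (1 + 1 / \<delta>\<^sup>2) * (real (m x) / ((t - x)\<^sup>2 + 1\<^sup>2))) summable_on UNIV"
      by (intro summable_on_cmult_right sm_kernel) auto
    fix x
    show "real (m x) / (t - x)\<^sup>2 \<le> (1 + 1 / \<delta>\<^sup>2) * (real (m x) / ((t - x)\<^sup>2 + 1\<^sup>2))"
    proof (cases "m x = 0")
      case False
      define a where "a = (t - x)\<^sup>2"
      have "\<delta>\<^sup>2 \<le> a" unfolding a_def using \<delta>(2)[OF False] \<delta>(1) by (metis abs_le_square_iff abs_of_pos)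
      hence a: "a > 0" "1 \<le> a / \<delta>\<^sup>2" using \<delta>(1) by (auto intro: less_le_trans[of 0 "\<delta>\<^sup>2"])
      have "a + 1 \<le> (1 + 1 / \<delta>\<^sup>2) * a" using a by (simp add: algebra_simps)
      hence "1 / a \<le> (1 + 1 / \<delta>\<^sup>2) / (a + 1)" using a by (simp add: divide_simps)
      hence "real (m x) * (1 / a) \<le> real (m x) * ((1 + 1 / \<delta>\<^sup>2) / (a + 1))" by (intro mult_left_mono) auto
      thus ?thesis by (simp add: a_def mult_ac)
    qed simp
  qed auto
qed

text \<open>Every zero is at distance at least \<open>\<delta>\<close> from \<open>t\<close>, so
  each term keeps at least the fraction \<open>1 - y^2 / \<delta>^2\<close>, the same for all zeros;
  the limit follows by squeezing.\<close>

lemma zsum_tendsto: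
  assumes "f (of_real t) \<noteq> 0"
  shows "(zsum f t \<longlongrightarrow> zsum f t 0) (at_right 0)"
proof -
  obtain \<delta> where \<delta>: "\<delta> > 0" "\<And>x. m x \<noteq> 0 \<Longrightarrow> \<bar>t - x\<bar> \<ge> \<delta>" using zero_gap[OF assms] by blast
  note sm0 = summable_zsum_0[OF assms]
  have up: "zsum f t y \<le> zsum f t 0" and lo: "zsum f t 0 * (1 - y\<^sup>2 / \<delta>\<^sup>2) \<le> zsum f t y" if y: "y > 0" for y
  proof -
    have sy: "(\<lambda>x. real (m x) / ((t - x)\<^sup>2 + y\<^sup>2)) summable_on UNIV" using sm_kernel[of y t] y by simp
    have "(\<Sum>\<^sub>\<infinity>x. real (m x) / ((t - x)\<^sup>2 + y\<^sup>2)) \<le> (\<Sum>\<^sub>\<infinity>x. real (m x) / (t - x)\<^sup>2)"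
    proof (rule infsum_mono[OF sy sm0])
      fix x
      show "real (m x) / ((t - x)\<^sup>2 + y\<^sup>2) \<le> real (m x) / (t - x)\<^sup>2"
      proof (cases "m x = 0")
        case False
        hence "(t - x)\<^sup>2 > 0" using \<delta>(2)[OF False] \<delta>(1) by auto
        thus ?thesis by (intro divide_left_mono mult_pos_pos add_pos_nonneg) auto
      qed simp
    qed
    thus "zsum f t y \<le> zsum f t 0" by (simp add: zsum_def)
    have "(\<Sum>\<^sub>\<infinity>x. real (m x) / (t - x)\<^sup>2 * (1 - y\<^sup>2 / \<delta>\<^sup>2)) \<le> (\<Sum>\<^sub>\<infinity>x. real (m x) / ((t - x)\<^sup>2 + y\<^sup>2))"
    proof (rule infsum_mono[OF summable_on_cmult_left[OF sm0] sy])
      fix x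
      show "real (m x) / (t - x)\<^sup>2 * (1 - y\<^sup>2 / \<delta>\<^sup>2) \<le> real (m x) / ((t - x)\<^sup>2 + y\<^sup>2)"
      proof (cases "m x = 0")
        case False
        define a where "a = (t - x)\<^sup>2"
        have "\<delta>\<^sup>2 \<le> a" unfolding a_def using \<delta>(2)[OF False] \<delta>(1) by (metis abs_le_square_iff abs_of_pos)
        hence a: "a > 0" "1 \<le> a / \<delta>\<^sup>2" using \<delta>(1) by (auto intro: less_le_trans[of 0 "\<delta>\<^sup>2"])
        have y2: "y\<^sup>2 > 0" using y by simp
        have "y\<^sup>2 * 1 \<le> y\<^sup>2 * (a / \<delta>\<^sup>2)" by (rule mult_left_mono) (use a in auto)
        moreover have "0 \<le> y\<^sup>2 * (y\<^sup>2 / \<delta>\<^sup>2)" by simp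
        moreover have "(1 - y\<^sup>2 / \<delta>\<^sup>2) * (a + y\<^sup>2) = a + y\<^sup>2 - y\<^sup>2 * (a / \<delta>\<^sup>2) - y\<^sup>2 * (y\<^sup>2 / \<delta>\<^sup>2)" by (simp add: algebra_simps add_divide_distrib)
        ultimately have "(1 - y\<^sup>2 / \<delta>\<^sup>2) * (a + y\<^sup>2) \<le> a" by linarith
        hence "(1 - y\<^sup>2 / \<delta>\<^sup>2) \<le> a / (a + y\<^sup>2)"
          by (subst pos_le_divide_eq) (use a(1) y2 in linarith)+
        hence "real (m x) / a * (1 - y\<^sup>2 / \<delta>\<^sup>2) \<le> real (m x) / a * (a / (a + y\<^sup>2))" using a by (intro mult_left_mono) auto
        thus ?thesis using a by (simp add: a_def)
      qed simp
    qed
    moreover have "(\<Sum>\<^sub>\<infinity>x. real (m x) / (t - x)\<^sup>2 * (1 - y\<^sup>2 / \<delta>\<^sup>2)) = (\<Sum>\<^sub>\<infinity>x. real (m x) / (t - x)\<^sup>2) * (1 - y\<^sup>2 / \<delta>\<^sup>2)"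
      by (rule infsum_cmult_left')
    moreover have "zsum f t y = (\<Sum>\<^sub>\<infinity>x. real (m x) / ((t - x)\<^sup>2 + y\<^sup>2))" by (rule zsum_def)
    moreover have "zsum f t 0 = (\<Sum>\<^sub>\<infinity>x. real (m x) / (t - x)\<^sup>2)" by (simp add: zsum_def)
    ultimately show "zsum f t 0 * (1 - y\<^sup>2 / \<delta>\<^sup>2) \<le> zsum f t y" by (simp only:)
  qed
  have pos: "eventually (\<lambda>y::real. y > 0) (at_right 0)" by (rule eventually_at_right_less)
  have "((\<lambda>y. zsum f t 0 * (1 - y\<^sup>2 / \<delta>\<^sup>2)) \<longlongrightarrow> zsum f t 0 * (1 - 0\<^sup>2 / \<delta>\<^sup>2)) (at_right 0)"
    by (intro tendsto_intros) (use \<delta> in auto)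
  thus ?thesis
    using tendsto_sandwich[OF eventually_mono[OF pos lo] eventually_mono[OF pos up] _ tendsto_const] by simp
qed

text \<open>The error in \<open>Im_q\<close> is proportional to \<open>y\<close>, so it survives
  division by \<open>y\<close> and the passage to \<open>y = 0\<close>.\<close>

lemma deriv_q_real:
  assumes t: "\<bar>t\<bar> \<ge> T" and f: "f (of_real t) \<noteq> 0"
  shows "\<bar>Re (deriv q (of_real t)) + zsum f t 0\<bar> \<le> C / t\<^sup>2"
proof -
  have t0: "\<bar>t\<bar> > 0" using t T by linarith
  have lim: "((\<lambda>y. \<bar>Im (q (Complex t y)) / y + zsum f t y\<bar>) \<longlongrightarrow> \<bar>Re (deriv q (of_real t)) + zsum f t 0\<bar>) (at_right 0)"
    by (intro tendsto_intros Im_q_tendsto zsum_tendsto f)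
  have "eventually (\<lambda>y. y \<in> {0<..<c * \<bar>t\<bar>}) (at_right 0)"
    by (rule eventually_at_rightI[of 0 "c * \<bar>t\<bar>"]) (use c t0 in auto)
  hence "eventually (\<lambda>y. \<bar>Im (q (Complex t y)) / y + zsum f t y\<bar> \<le> C / t\<^sup>2) (at_right 0)"
  proof eventually_elim
    case (elim y)
    hence y: "0 < y" "y \<le> c * \<bar>t\<bar>" by auto
    have "\<bar>Im (q (Complex t y)) + y * zsum f t y\<bar> / y \<le> C * y / t\<^sup>2 / y"
      unfolding q_def by (rule divide_right_mono[OF Im_q[OF t y]]) (use y in auto)
    moreover have "\<bar>Im (q (Complex t y)) + y * zsum f t y\<bar> / y = \<bar>(Im (q (Complex t y)) + y * zsum f t y) / y\<bar>"
      using y by simp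
    moreover have "(Im (q (Complex t y)) + y * zsum f t y) / y = Im (q (Complex t y)) / y + zsum f t y"
      using y by (simp add: field_simps)
    ultimately show ?case using y by simp
  qed
  thus ?thesis by (intro tendsto_upperbound[OF lim]) auto
qed

end

section \<open>Iterated derivatives and their restriction to the real line\<close>

lemma near_real_rooted_higher_deriv:
  assumes "near_real_rooted d f c T A C"
  shows "\<exists>c T A C. near_real_rooted d ((deriv ^^ k) f) c T A C"
proof (induction k)
  case (Suc k)
  then obtain c T A C where "near_real_rooted d ((deriv ^^ k) f) c T A C" by blast
  from near_real_rooted.near_real_rooted_deriv[OF this] show ?case by simp
qed (use assms in auto)

text \<open>The holomorphic extension makes every real iterate differentiable, so that the iterated
  \<open>deriv\<close> has its intended meaning.\<close>

lemma higher_deriv_of_real: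
  fixes h :: "real \<Rightarrow> real"
  assumes g: "g holomorphic_on U" "open U" "\<And>t. of_real t \<in> U"
    and gh: "\<And>t. g (of_real t) = of_real (h t)"
  shows "(deriv ^^ n) g (of_real t) = of_real ((deriv ^^ n) h t)"
    and "((deriv ^^ n) h has_real_derivative (deriv ^^ Suc n) h t) (at t)"
proof -
  have step: "(h has_real_derivative deriv h t) (at t) \<and> deriv g (of_real t) = of_real (deriv h t)"
    if g: "g holomorphic_on U" and gh: "\<And>t. g (of_real t) = of_real (h t)" for g and h :: "real \<Rightarrow> real" and t
  proof -
    have "(g has_field_derivative deriv g (of_real t)) (at (of_real t))"
      using holomorphic_derivI[OF g assms(2,3)] .
    hence v: "((\<lambda>x. complex_of_real (h x)) has_vector_derivative deriv g (of_real t)) (at t)"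
      using has_vector_derivative_real_field gh by fastforce
    have re: "(h has_real_derivative Re (deriv g (of_real t))) (at t)"
      using bounded_linear.has_vector_derivative[OF bounded_linear_Re v]
      by (simp add: has_real_derivative_iff_has_vector_derivative)
    have "((\<lambda>x. 0) has_real_derivative Im (deriv g (of_real t))) (at t)"
      using bounded_linear.has_vector_derivative[OF bounded_linear_Im v]
      by (simp add: has_real_derivative_iff_has_vector_derivative)
    hence "Im (deriv g (of_real t)) = 0" by (rule DERIV_unique) simp
    thus ?thesis using re by (simp add: DERIV_imp_deriv complex_eq_iff)
  qed
  have ho: "(deriv ^^ n) g holomorphic_on U" for n using g by (intro holomorphic_higher_deriv)
  have *: "\<forall>t. (deriv ^^ n) g (of_real t) = of_real ((deriv ^^ n) h t)" for n
  proof (induction n)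
    case (Suc n)
    thus ?case using step[OF ho[of n], of "(deriv ^^ n) h"] by simp
  qed (use gh in auto)
  show "(deriv ^^ n) g (of_real t) = of_real ((deriv ^^ n) h t)" using * by blast
  show "((deriv ^^ n) h has_real_derivative (deriv ^^ Suc n) h t) (at t)"
    using step[OF ho[of n], of "(deriv ^^ n) h" t] * by simp
qed

lemma zero_mult_eq_zmult:
  fixes h :: "real \<Rightarrow> real"
  assumes g: "g holomorphic_on U" "open U" "connected U" "\<And>t. of_real t \<in> U" "w \<in> U" "g w \<noteq> 0"
    and gh: "\<And>t. g (of_real t) = of_real (h t)"
  shows "zero_mult h x = zmult g (of_real x)"
proof -
  have eq: "(deriv ^^ n) g (of_real x) = of_real ((deriv ^^ n) h x)" for n
    by (rule higher_deriv_of_real(1)[OF g(1,2,4) gh])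
  \<comment> \<open>Some derivative is non-zero by the identity theorem, so the \<open>LEAST\<close>
    in \<open>zero_mult\<close> is genuine.\<close>
  have "\<exists>n. (deriv ^^ n) h x \<noteq> 0"
  proof (rule ccontr)
    assume *: "\<nexists>n. (deriv ^^ n) h x \<noteq> 0"
    have "g w = 0"
      by (rule holomorphic_fun_eq_0_on_connected[OF g(1,2,3) _ g(4) g(5), of x]) (use * eq in auto)
    thus False using g by simp
  qed
  hence 1: "(deriv ^^ zero_mult h x) h x \<noteq> 0" unfolding zero_mult_def by (rule LeastI_ex)
  have 2: "(deriv ^^ i) h x = 0" if "i < zero_mult h x" for i
    using not_less_Least[of i "\<lambda>n. (deriv ^^ n) h x \<noteq> 0"] that unfolding zero_mult_def by blast
  have "zorder g (of_real x) = int (zero_mult h x)"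
    by (rule zorder_zero_eqI[OF g(1,2,4)]) (use 1 2 eq in auto)
  thus ?thesis by (simp add: zmult_def)
qed

theorem near_real_rooted_logderiv_asymptotics:
  fixes h :: "real \<Rightarrow> real" and k :: nat
  assumes "near_real_rooted d g c T A C" and gh: "\<And>t. g (of_real t) = of_real (h t)"
  defines "Z \<equiv> \<lambda>n. (deriv ^^ n) h"
  shows "\<exists>R :: real \<Rightarrow> real. R \<in> O[at_top](\<lambda>t. 1 / t) \<and>
    (\<forall>t. Z k t \<noteq> 0 \<longrightarrow>
      (\<lambda>x. real (zero_mult (Z k) x) / (t - x)\<^sup>2) summable_on {x. Z k x = 0} \<and>
      ((\<lambda>u. Z (k + 1) u / Z k u) has_real_derivative
         (- (\<Sum>\<^sub>\<infinity>x\<in>{x. Z k x = 0}. real (zero_mult (Z k) x) / (t - x)\<^sup>2) + R t)) (at t))"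
proof -
  interpret g0: near_real_rooted d g c T A C by fact
  define f where "f = (deriv ^^ k) g"
  obtain c T A C where "near_real_rooted d f c T A C"
    using near_real_rooted_higher_deriv[OF assms(1)] unfolding f_def by blast
  then interpret near_real_rooted d f c T A C .
  have inU: "of_real t \<in> bowtie d" for t using d by simp
  have fZ: "f (of_real t) = of_real (Z k t)" for t
    unfolding f_def Z_def by (rule higher_deriv_of_real(1)[OF g0.holo open_bowtie inU gh])
  have dfZ: "deriv f (of_real t) = of_real (Z (k + 1) t)" for t
    using higher_deriv_of_real(1)[OF g0.holo open_bowtie inU gh, of "Suc k" t] by (simp add: f_def Z_def)
  have mult: "zero_mult (Z k) x = m x" for x
    by (rule zero_mult_eq_zmult[OF holo open_bowtie connected_bowtie inU w0(1,2) fZ])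
  have sum_eq: "(\<Sum>\<^sub>\<infinity>x\<in>{x. Z k x = 0}. real (zero_mult (Z k) x) / (t - x)\<^sup>2) = zsum f t 0" for t
    unfolding zsum_def mult by (rule infsum_cong_neutral) (use m_pos fZ in auto)
  \<comment> \<open>At zeros of \<open>Z k\<close> nothing is claimed about the derivative, but the
    growth of \<open>R\<close> concerns all large \<open>t\<close>; the value 0 satisfies
    it.\<close>
  define R where "R = (\<lambda>t. if Z k t = 0 then 0 else Re (deriv q (of_real t)) + zsum f t 0)"
  have "R \<in> O[at_top](\<lambda>t. 1 / t)"
  proof (rule bigoI[of _ C])
    show "eventually (\<lambda>t. norm (R t) \<le> C * norm (1 / t)) at_top"
      using eventually_ge_at_top[of T]
    proof eventually_elim
      case (elim t)
      have t1: "t \<ge> 1" using elim T by simp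
      have "norm (R t) \<le> C / t\<^sup>2" using deriv_q_real[of t] elim T C fZ[of t] by (auto simp: R_def)
      also have "\<dots> \<le> C / t" using C t1 by (intro divide_left_mono) (auto simp: power2_eq_square)
      finally show ?case using t1 by simp
    qed
  qed
  moreover have "(\<lambda>x. real (zero_mult (Z k) x) / (t - x)\<^sup>2) summable_on {x. Z k x = 0} \<and>
      ((\<lambda>u. Z (k + 1) u / Z k u) has_real_derivative
         (- (\<Sum>\<^sub>\<infinity>x\<in>{x. Z k x = 0}. real (zero_mult (Z k) x) / (t - x)\<^sup>2) + R t)) (at t)" if t: "Z k t \<noteq> 0" for t
  proof
    have ft: "f (of_real t) \<noteq> 0" using fZ[of t] t by simp
    show "(\<lambda>x. real (zero_mult (Z k) x) / (t - x)\<^sup>2) summable_on {x. Z k x = 0}"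
      unfolding mult by (rule summable_on_subset_banach[OF summable_zsum_0[OF ft]]) auto
    have "Re (q (of_real u)) = Z (k + 1) u / Z k u" for u
      by (simp add: q_def fZ dfZ flip: of_real_divide)
    hence "((\<lambda>u. Z (k + 1) u / Z k u) has_real_derivative Re (deriv q (of_real t))) (at t)"
      using q_real_deriv[OF ft] by simp
    moreover have "Re (deriv q (of_real t)) = - zsum f t 0 + R t" using t by (simp add: R_def)
    ultimately show "((\<lambda>u. Z (k + 1) u / Z k u) has_real_derivative
         (- (\<Sum>\<^sub>\<infinity>x\<in>{x. Z k x = 0}. real (zero_mult (Z k) x) / (t - x)\<^sup>2) + R t)) (at t)"
      by (simp add: sum_eq)
  qed
  ultimately show ?thesis by blast
qed

section \<open>Growth of the completed function\<close>

text \<open>In Euler's limit formula the numerators for \<open>z\<close> and \<open>Re z\<close>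
  have equal modulus, and \<open>|z + k| \<ge> Re z + k\<close> in every factor of the
  denominator.\<close>

lemma norm_Gamma_le:
  assumes "Re z > 0"
  shows "norm (Gamma z) \<le> Gamma (Re z)"
proof (rule tendsto_le)
  have np: "z \<notin> \<int>\<^sub>\<le>\<^sub>0" using assms by (auto elim!: nonpos_Ints_cases)
  show "(\<lambda>n. norm (Gamma_series z n)) \<longlonglongrightarrow> norm (Gamma z)"
    by (intro tendsto_norm Gamma_series_LIMSEQ)
  show "Gamma_series (Re z) \<longlonglongrightarrow> Gamma (Re z)" by (rule Gamma_series_LIMSEQ)
  show "eventually (\<lambda>n. norm (Gamma_series z n) \<le> Gamma_series (Re z) n) sequentially"
    using eventually_gt_at_top[of 0]
  proof eventually_elim
    case (elim n)
    have "norm (pochhammer z (n + 1)) = (\<Prod>k<n + 1. norm (z + of_nat k))"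
      by (simp add: pochhammer_prod prod_norm atLeast0LessThan)
    also have "\<dots> \<ge> (\<Prod>k<n + 1. Re z + of_nat k)"
    proof (intro prod_mono conjI)
      fix k
      show "0 \<le> Re z + of_nat k" using assms by simp
      show "Re z + of_nat k \<le> norm (z + of_nat k)" using complex_Re_le_cmod[of "z + of_nat k"] by simp
    qed
    finally have le: "pochhammer (Re z) (n + 1) \<le> norm (pochhammer z (n + 1))"
      by (simp add: pochhammer_prod atLeast0LessThan)
    have pos: "pochhammer (Re z) (n + 1) > 0" using assms by (rule pochhammer_pos)
    have "norm (Gamma_series z n) = fact n * exp (Re z * ln (real n)) / norm (pochhammer z (n + 1))"
      using elim by (simp add: Gamma_series_def norm_divide norm_mult Ln_of_nat)
    also have "\<dots> \<le> fact n * exp (Re z * ln (real n)) / pochhammer (Re z) (n + 1)"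
      by (rule divide_left_mono[OF le]) (use pos le in \<open>auto intro!: mult_pos_pos\<close>)
    finally show ?case by (simp add: Gamma_series_def)
  qed
qed auto

lemma Gamma_real_growth:
  fixes x0 e :: real
  assumes "x0 > 0" "e > 0"
  shows "\<exists>C>0. \<forall>x\<ge>x0. Gamma x \<le> C * exp (e * x\<^sup>2)"
proof -
  have "eventually (\<lambda>x::real. (x + 2) * ln (x + 2) \<le> e * x\<^sup>2) at_top"
    using assms(2) by real_asymp
  then obtain x1 where x1: "\<And>x. x \<ge> x1 \<Longrightarrow> (x + 2) * ln (x + 2) \<le> e * x\<^sup>2"
    by (auto simp: eventually_at_top_linorder)
  define x2 where "x2 = max (max x1 2) x0"
  have big: "Gamma x \<le> exp (e * x\<^sup>2)" if x: "x \<ge> x2" for x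
  proof -
    define n where "n = nat \<lceil>x\<rceil>"
    have n: "real n \<ge> x" "real n < x + 1" using x by (auto simp: n_def x2_def) linarith+
    have xx: "x \<ge> 2" using x by (auto simp: x2_def)
    have "Gamma x < Gamma (1 + real n)" using n xx by (intro Gamma_real_strict_mono) auto
    also have "\<dots> = fact n" by (rule Gamma_fact)
    also have "\<dots> \<le> real n ^ n" using fact_le_power[of n, where 'a = real] by simp
    also have "\<dots> = exp (real n * ln (real n))" using n xx by (simp add: exp_of_nat_mult)
    also have "\<dots> \<le> exp ((x + 2) * ln (x + 2))"
      using n xx by (intro exp_le_cancel_iff[THEN iffD2] mult_mono) auto
    also have "\<dots> \<le> exp (e * x\<^sup>2)" using x1[of x] x by (simp add: x2_def)
    finally show ?thesis by simp
  qed
  have "compact (Gamma ` {x0..x2})"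
    by (intro compact_continuous_image continuous_intros) (use assms in \<open>auto elim!: nonpos_Ints_cases\<close>)
  then obtain M where M: "\<And>x. x \<in> {x0..x2} \<Longrightarrow> Gamma x \<le> M" 
    by (meson bounded_imp_bdd_above compact_imp_bounded bdd_above.E imageI)
  define C where "C = max 1 M"
  have "Gamma x \<le> C * exp (e * x\<^sup>2)" if x: "x \<ge> x0" for x
  proof (cases "x \<ge> x2")
    case True
    show ?thesis by (rule order_trans[OF big[OF True]]) (simp add: C_def)
  next
    case False
    hence "Gamma x \<le> C * 1" using M[of x] x by (auto simp: C_def)
    also have "\<dots> \<le> C * exp (e * x\<^sup>2)" using assms by (intro mult_left_mono) (auto simp: C_def)
    finally show ?thesis .
  qed
  thus ?thesis by (intro exI[of _ C]) (auto simp: C_def)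
qed

text \<open>Order at most two with minimal type. Quantifying over all \<open>e\<close> makes the
  notion stable under products and affine changes of variable, as \<open>e\<close> may be split or
  rescaled.\<close>

definition subgaussian_on :: "complex set \<Rightarrow> (complex \<Rightarrow> complex) \<Rightarrow> bool" where
  "subgaussian_on S g \<longleftrightarrow> (\<forall>e>0. \<exists>C>0. \<forall>s\<in>S. norm (g s) \<le> C * exp (e * (norm s)\<^sup>2))"

lemma subgaussian_onD:
  assumes "subgaussian_on S g" "e > 0"
  obtains C where "C > 0" "\<And>s. s \<in> S \<Longrightarrow> norm (g s) \<le> C * exp (e * (norm s)\<^sup>2)"
  using assms unfolding subgaussian_on_def by blast

lemma subgaussian_on_mult:
  assumes "subgaussian_on S g" "subgaussian_on S h"
  shows "subgaussian_on S (\<lambda>s. g s * h s)"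
  unfolding subgaussian_on_def
proof (intro allI impI)
  fix e :: real assume "e > 0"
  hence e2: "e / 2 > 0" by simp
  obtain C where C: "C > 0" "\<And>s. s \<in> S \<Longrightarrow> norm (g s) \<le> C * exp (e / 2 * (norm s)\<^sup>2)"
    using subgaussian_onD[OF assms(1) e2] by blast
  obtain D where D: "D > 0" "\<And>s. s \<in> S \<Longrightarrow> norm (h s) \<le> D * exp (e / 2 * (norm s)\<^sup>2)"
    using subgaussian_onD[OF assms(2) e2] by blast
  have "norm (g s * h s) \<le> C * D * exp (e * (norm s)\<^sup>2)" if s: "s \<in> S" for s
  proof -
    have "norm (g s * h s) \<le> (C * exp (e / 2 * (norm s)\<^sup>2)) * (D * exp (e / 2 * (norm s)\<^sup>2))"
      unfolding norm_mult using C D s by (intro mult_mono) auto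
    also have "\<dots> = C * D * (exp (e / 2 * (norm s)\<^sup>2) * exp (e / 2 * (norm s)\<^sup>2))" by (simp only: mult_ac)
    also have "exp (e / 2 * (norm s)\<^sup>2) * exp (e / 2 * (norm s)\<^sup>2) = exp (e * (norm s)\<^sup>2)" by (simp flip: exp_add)
    finally show ?thesis .
  qed
  thus "\<exists>C>0. \<forall>s\<in>S. norm (g s * h s) \<le> C * exp (e * (norm s)\<^sup>2)"
    using C D by (intro exI[of _ "C * D"]) auto
qed

lemma subgaussian_on_const: "subgaussian_on S (\<lambda>_. a)"
  unfolding subgaussian_on_def
proof (intro allI impI exI conjI ballI)
  fix e :: real and s :: complex assume "e > 0"
  have "(norm a + 1) * 1 \<le> (norm a + 1) * exp (e * (norm s)\<^sup>2)" using \<open>e > 0\<close> by (intro mult_left_mono) auto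
  thus "norm a \<le> (norm a + 1) * exp (e * (norm s)\<^sup>2)" by simp
qed (auto intro: add_nonneg_pos)

lemma subgaussian_on_prod:
  assumes "\<And>i. i \<in> I \<Longrightarrow> subgaussian_on S (g i)"
  shows "subgaussian_on S (\<lambda>s. \<Prod>i\<in>I. g i s)"
  using assms by (induction I rule: infinite_finite_induct) (auto intro: subgaussian_on_const subgaussian_on_mult)

text \<open>Completing the square gives \<open>a * norm s \<le> e * (norm s)^2 + a^2 / e\<close>, so
  exponential growth of any rate is absorbed.\<close>

lemma subgaussian_on_exp_bound:
  assumes "\<And>s. s \<in> S \<Longrightarrow> norm (g s) \<le> exp (a * norm s + b)"
  shows "subgaussian_on S g"
  unfolding subgaussian_on_def
proof (intro allI impI exI conjI ballI)
  fix e :: real and s assume e: "e > 0" and s: "s \<in> S"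
  have "a * norm s \<le> e * (norm s)\<^sup>2 + a\<^sup>2 / e"
  proof -
    define u where "u = a\<^sup>2 / e"
    have u: "u \<ge> 0" using e by (simp add: u_def)
    have "0 \<le> e * (norm s - a / (2 * e))\<^sup>2" using e by simp
    also have "\<dots> = e * (norm s)\<^sup>2 - a * norm s + u / 4" using e by (simp add: u_def power2_eq_square field_simps)
    finally show ?thesis using u unfolding u_def[symmetric] by linarith
  qed
  hence "exp (a * norm s + b) \<le> exp ((a\<^sup>2 / e + b) + e * (norm s)\<^sup>2)" by simp
  also have "\<dots> = exp (a\<^sup>2 / e + b) * exp (e * (norm s)\<^sup>2)" by (rule exp_add)
  finally show "norm (g s) \<le> exp (a\<^sup>2 / e + b) * exp (e * (norm s)\<^sup>2)" using assms[OF s] by simp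
qed auto

lemma subgaussian_on_power: "subgaussian_on S g \<Longrightarrow> subgaussian_on S (\<lambda>s. g s ^ n)"
  by (induction n) (auto intro: subgaussian_on_const subgaussian_on_mult)

lemma subgaussian_on_shift: "subgaussian_on S (\<lambda>s. s + a)"
proof (rule subgaussian_on_exp_bound)
  fix s :: complex
  have "norm (s + a) \<le> norm s + norm a" by (rule norm_triangle_ineq)
  also have "\<dots> \<le> exp (norm s + norm a)" using exp_ge_add_one_self[of "norm s + norm a"] by linarith
  finally show "norm (s + a) \<le> exp (1 * norm s + norm a)" by simp
qed

lemma subgaussian_on_Gamma:
  assumes "a > 0" "Re b \<ge> 0"
  shows "subgaussian_on {s. Re s \<ge> 2} (\<lambda>s. Gamma (of_real a * s + b))"
  unfolding subgaussian_on_def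
proof (intro allI impI)
  fix e :: real assume e: "e > 0"
  \<comment> \<open>\<open>x \<le> (a + Re b) * norm s\<close> for \<open>norm s \<ge> 1\<close>, so
    this rescaling turns \<open>e' * x^2\<close> into at most \<open>e * (norm s)^2\<close>.\<close>
  define e' where "e' = e / (a + Re b)\<^sup>2"
  have ab: "a + Re b > 0" using assms by simp
  hence e': "e' > 0" using e by (simp add: e'_def)
  obtain C where C: "C > 0" "\<And>x. x \<ge> 2 * a \<Longrightarrow> Gamma x \<le> C * exp (e' * x\<^sup>2)"
    using Gamma_real_growth[of "2 * a" e'] assms e' by auto
  have "norm (Gamma (of_real a * s + b)) \<le> C * exp (e * (norm s)\<^sup>2)" if s: "Re s \<ge> 2" for s
  proof -
    define x where "x = a * Re s + Re b"
    have "a * 2 \<le> a * Re s" using s assms by (intro mult_left_mono) auto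
    hence x2: "x \<ge> 2 * a" using assms unfolding x_def by linarith
    have rs: "Re s \<le> norm s" "1 \<le> norm s" using s complex_Re_le_cmod[of s] by linarith+
    have "a * Re s \<le> a * norm s" "Re b * 1 \<le> Re b * norm s" using rs assms by (intro mult_left_mono; simp)+
    hence "x \<le> (a + Re b) * norm s" by (simp add: x_def algebra_simps)
    hence "x\<^sup>2 \<le> ((a + Re b) * norm s)\<^sup>2" using x2 assms by (intro power_mono) auto
    hence "e' * x\<^sup>2 \<le> e' * ((a + Re b) * norm s)\<^sup>2" using e' by (intro mult_left_mono) auto
    also have "\<dots> = e * (norm s)\<^sup>2" using ab by (simp add: e'_def power_mult_distrib)
    finally have ex: "exp (e' * x\<^sup>2) \<le> exp (e * (norm s)\<^sup>2)" by simp
    have "Re (of_real a * s + b) > 0" using x2 assms by (simp add: x_def)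
    hence "norm (Gamma (of_real a * s + b)) \<le> Gamma (Re (of_real a * s + b))" by (rule norm_Gamma_le)
    also have "\<dots> = Gamma x" by (simp add: x_def)
    also have "\<dots> \<le> C * exp (e' * x\<^sup>2)" by (rule C(2)[OF x2])
    also have "\<dots> \<le> C * exp (e * (norm s)\<^sup>2)" using ex C(1) by (intro mult_left_mono) auto
    finally show ?thesis .
  qed
  thus "\<exists>C>0. \<forall>s\<in>{s. Re s \<ge> 2}. norm (Gamma (of_real a * s + b)) \<le> C * exp (e * (norm s)\<^sup>2)"
    using C(1) by auto
qed

text \<open>The comparison function \<open>exp (- e * cos (s / 2))\<close> decays doubly exponentially along the strip.\<close>

lemma Phragmen_Lindelof_strip:
  fixes Y :: "complex \<Rightarrow> complex"
  assumes holo: "Y holomorphic_on U" "open U" "{s. a \<le> Re s \<and> Re s \<le> b} \<subseteq> U"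
    and ab: "- 2 \<le> a" "a < b" "b \<le> 2"
    and bd: "\<And>s. Re s = a \<or> Re s = b \<Longrightarrow> norm (Y s) \<le> A"
    and growth: "\<And>s. a \<le> Re s \<Longrightarrow> Re s \<le> b \<Longrightarrow> norm (Y s) \<le> C * exp ((\<bar>Im s\<bar> + 3) powr \<rho>)"
    and s: "a \<le> Re s" "Re s \<le> b" and A: "A > 0"
  shows "norm (Y s) \<le> A"
proof -
  have "C \<ge> 0" using growth[of "of_real a"] ab norm_ge_zero[of "Y (of_real a)"] by (smt (verit) Re_complex_of_real exp_gt_zero zero_le_mult_iff)
  have Re_cos: "Re (cos (z / 2)) = cos (Re z / 2) * cosh (Im z / 2)" for z
    by (simp add: Re_cos cosh_def)
  \<comment> \<open>This is why the strip lies within \<open>|Re z| \<le> 2\<close>: then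
    \<open>|Re z / 2| \<le> 1 < pi / 3\<close>.\<close>
  have cos_ge: "cos (Re z / 2) \<ge> 1 / 2" if "a \<le> Re z" "Re z \<le> b" for z
  proof -
    have "\<bar>Re z / 2\<bar> \<le> pi / 3" using that ab pi_gt3 by auto
    hence "cos (pi / 3) \<le> cos \<bar>Re z / 2\<bar>" using pi_gt3 by (intro cos_monotone_0_pi_le) auto
    moreover have "cos \<bar>Re z / 2\<bar> = cos (Re z / 2)" by (rule cos_abs_real)
    ultimately show ?thesis by (simp add: cos_60)
  qed
  have key: "norm (Y s) * exp (- e * Re (cos (s / 2))) \<le> A" if e: "e > 0" for e
  proof -
    define V where "V = (\<lambda>z. Y z * exp (- of_real e * cos (z / 2)))"
    \<comment> \<open>For fixed \<open>e\<close> the doubly exponential decay beats the assumed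
      growth \<open>exp ((T + 3) powr \<rho>)\<close>, so the bound \<open>A\<close> also holds on
      the horizontal sides of a tall rectangle; \<open>e\<close> tends to 0 at the end.\<close>
    have "eventually (\<lambda>T::real. C * exp ((T + 3) powr \<rho>) * exp (- e * (1 / 2 * cosh (T / 2))) \<le> A) at_top"
    proof -
      have "((\<lambda>T::real. exp ((T + 3) powr \<rho> - e * (1 / 2 * ((exp (T / 2) + exp (- (T / 2))) / 2)))) \<longlongrightarrow> 0) at_top"
        using e by real_asymp
      hence "((\<lambda>T::real. C * exp ((T + 3) powr \<rho> - e * (1 / 2 * ((exp (T / 2) + exp (- (T / 2))) / 2)))) \<longlongrightarrow> C * 0) at_top"
        by (intro tendsto_mult tendsto_const)
      hence "eventually (\<lambda>T. C * exp ((T + 3) powr \<rho> - e * (1 / 2 * ((exp (T / 2) + exp (- (T / 2))) / 2))) < A) at_top"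
        using A by (intro order_tendstoD) auto
      thus ?thesis
      proof eventually_elim
        case (elim T)
        have "exp ((T + 3) powr \<rho>) * exp (- e * (1 / 2 * cosh (T / 2))) =
            exp ((T + 3) powr \<rho> - e * (1 / 2 * ((exp (T / 2) + exp (- (T / 2))) / 2)))"
          by (simp add: cosh_def flip: exp_add)
        thus ?case using elim by (simp only: mult.assoc)
      qed
    qed
    then obtain T where T: "T \<ge> \<bar>Im s\<bar> + 1" "C * exp ((T + 3) powr \<rho>) * exp (- e * (1 / 2 * cosh (T / 2))) \<le> A"
      using eventually_conj[OF _ eventually_ge_at_top[of "\<bar>Im s\<bar> + 1"]] by (metis (mono_tags, lifting) eventually_at_top_linorder order_refl eventually_conj)
    define K where "K = cbox (Complex a (- T)) (Complex b T)"
    have Kin: "z \<in> K \<longleftrightarrow> a \<le> Re z \<and> Re z \<le> b \<and> - T \<le> Im z \<and> Im z \<le> T" for z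
      by (simp add: K_def in_cbox_complex_iff)
    have KU: "K \<subseteq> U"
      by (rule subset_trans[OF _ holo(3)]) (use ab in \<open>auto simp: Kin\<close>)
    have Vh: "V holomorphic_on K" unfolding V_def
      by (intro holomorphic_intros holomorphic_on_subset[OF holo(1) KU]) auto
    have nV: "norm (V z) = norm (Y z) * exp (- e * (cos (Re z / 2) * cosh (Im z / 2)))" for z
      by (simp add: V_def norm_mult Re_cos)
    have "norm (V s) \<le> A"
    proof (rule maximum_modulus_frontier[of V K])
      show "V holomorphic_on interior K" by (rule holomorphic_on_subset[OF Vh interior_subset])
      show "continuous_on (closure K) V" using holomorphic_on_imp_continuous_on[OF Vh] by (simp add: K_def)
      show "bounded K" by (simp add: K_def)
      show "s \<in> K" using s T by (auto simp: Kin)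
      fix z assume "z \<in> frontier K"
      hence zK: "z \<in> K" and nz: "z \<notin> box (Complex a (- T)) (Complex b T)" by (auto simp: frontier_cbox K_def)
      have z: "a \<le> Re z" "Re z \<le> b" using zK by (auto simp: Kin)
      have c0: "cos (Re z / 2) * cosh (Im z / 2) \<ge> 1 / 2 * cosh (Im z / 2)"
        using cos_ge[OF z] by (intro mult_right_mono) auto
      show "norm (V z) \<le> A"
      proof (cases "Re z = a \<or> Re z = b")
        case True
        have "- e * (cos (Re z / 2) * cosh (Im z / 2)) \<le> 0" using c0 e cosh_real_pos[of "Im z / 2"]
          by (smt (verit) mult_nonneg_nonneg mult_minus_left divide_pos_pos)
        hence "norm (V z) \<le> norm (Y z) * 1" unfolding nV by (intro mult_left_mono) auto
        thus ?thesis using bd[OF True] by simp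
      next
        case False
        hence Im: "\<bar>Im z\<bar> = T" using zK nz by (auto simp: Kin in_box_complex_iff)
        have ch: "cosh (Im z / 2) = cosh (T / 2)" using Im by (auto simp: abs_if split: if_splits)
        have "norm (V z) \<le> (C * exp ((T + 3) powr \<rho>)) * exp (- e * (1 / 2 * cosh (T / 2)))"
          unfolding nV using growth[OF z] c0 e Im \<open>C \<ge> 0\<close> unfolding ch by (intro mult_mono) auto
        thus ?thesis using T by simp
      qed
    qed
    thus ?thesis by (simp add: V_def norm_mult)
  qed
  have lim: "((\<lambda>e. norm (Y s) * exp (- e * Re (cos (s / 2)))) \<longlongrightarrow> norm (Y s) * exp (- 0 * Re (cos (s / 2)))) (at_right 0)"
    by (intro tendsto_intros)
  have "norm (Y s) * exp (- 0 * Re (cos (s / 2))) \<le> A"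
    by (rule tendsto_upperbound[OF lim]) (use key in \<open>auto intro: eventually_mono[OF eventually_at_right_less]\<close>)
  thus ?thesis by simp
qed

section \<open>The completed function is entire, symmetric and of slow growth\<close>

locale selberg_data =
  fixes F :: "complex \<Rightarrow> complex" and r :: nat and Q :: real and lam :: "nat \<Rightarrow> real"
    and mu :: "nat \<Rightarrow> complex" and \<omega> :: complex
  assumes F: "F \<in> extended_Selberg_class" and fe: "functional_equation r Q lam mu \<omega> F"
begin

definition pm :: nat where "pm = polar_order F"

text \<open>The entire continuation of \<open>(s - 1) ^ pm * F s\<close>. If \<open>F\<close> has a
  pole at 1, the product itself has the wrong value there, since then
  \<open>F 1 = 0\<close>.\<close>

definition G :: "complex \<Rightarrow> complex" where
  "G = (SOME G. entire_of_finite_order G \<and> (\<forall>s. s \<noteq> 1 \<longrightarrow> G s = (s - 1) ^ pm * F s))"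

abbreviation gm :: "complex \<Rightarrow> complex" where "gm \<equiv> gamma_factor r Q lam mu"
abbreviation X :: "complex \<Rightarrow> complex" where "X \<equiv> completed r Q lam mu F"

lemma G: "entire_of_finite_order G" "\<And>s. s \<noteq> 1 \<Longrightarrow> G s = (s - 1) ^ pm * F s"
proof -
  have "\<exists>m. polar_bound F m" using F by (auto simp: extended_Selberg_class_def)
  hence "polar_bound F pm" unfolding pm_def polar_order_def by (rule LeastI_ex)
  hence "\<exists>G. entire_of_finite_order G \<and> (\<forall>s. s \<noteq> 1 \<longrightarrow> G s = (s - 1) ^ pm * F s)" by (simp add: polar_bound_def)
  from someI_ex[OF this] show "entire_of_finite_order G" "\<And>s. s \<noteq> 1 \<Longrightarrow> G s = (s - 1) ^ pm * F s"
    unfolding G_def by auto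
qed

lemma G_holo: "G holomorphic_on A"
  using G(1) by (auto simp: entire_of_finite_order_def intro: holomorphic_on_subset)

lemma params: "Q > 0" "\<And>j. j \<in> {1..r} \<Longrightarrow> lam j > 0" "\<And>j. j \<in> {1..r} \<Longrightarrow> Re (mu j) \<ge> 0" "norm \<omega> = 1"
  and X_fe: "X s = \<omega> * cnj (X (1 - cnj s))"
  using fe unfolding functional_equation_def by blast+

lemma norm_X_reflect: "norm (X s) = norm (X (1 - cnj s))"
  by (subst X_fe) (simp add: norm_mult params)

lemma gm_analytic: "Re s > 0 \<Longrightarrow> gm analytic_on {s}" and gm_nz: "Re s > 0 \<Longrightarrow> gm s \<noteq> 0"
  using gamma_factor_analytic[of Q r lam mu s] params by auto

lemma gm_holo: "gm holomorphic_on {s. Re s > 0}"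
  using gm_analytic analytic_on_analytic_at analytic_imp_holomorphic by blast

lemma X_eq: assumes "Re s > 0" shows "X s = s ^ pm * G s * gm s"
  unfolding completed_def
proof (rule remove_sings_eqI)
  have "(\<lambda>s. s ^ pm * G s * gm s) analytic_on {s}"
    using gm_analytic[OF assms] holomorphic_on_imp_analytic_at[OF G_holo open_UNIV, of s]
    by (intro analytic_intros) auto
  hence "(\<lambda>s. s ^ pm * G s * gm s) \<midarrow>s\<rightarrow> s ^ pm * G s * gm s"
    using analytic_at_imp_isCont isCont_def by blast
  moreover have "eventually (\<lambda>z. s \<noteq> s \<or> z \<noteq> 1) (at s)" by (simp add: eventually_neq_at_within)
  hence "eventually (\<lambda>z. z ^ pm * G z * gm z = z ^ polar_order F * (z - 1) ^ polar_order F * gm z * F z) (at s)"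
    by eventually_elim (auto simp: G(2) pm_def)
  ultimately show "(\<lambda>s. s ^ polar_order F * (s - 1) ^ polar_order F * gm s * F s) \<midarrow>s\<rightarrow> s ^ pm * G s * gm s"
    by (rule Lim_transform_eventually)
qed

text \<open>The explicit formula covers \<open>Re s > 0\<close>, where the gamma factor is analytic;
  the functional equation reflects this to \<open>Re s < 1\<close>, and the two half-planes cover
  the plane.\<close>

lemma X_holo: "X holomorphic_on A"
proof -
  have 1: "X holomorphic_on {s. Re s > 0}"
    by (rule holomorphic_transform[of "\<lambda>s. s ^ pm * G s * gm s"])
       (use X_eq in \<open>auto intro!: holomorphic_intros G_holo gm_holo\<close>)
  have 2: "X holomorphic_on {s. Re s < 1}"
  proof (rule holomorphic_transform[of "\<lambda>s. \<omega> * (cnj \<circ> (\<lambda>z. X (1 - z)) \<circ> cnj) s"])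
    have "(\<lambda>z. X (1 - z)) holomorphic_on (cnj ` {s. Re s < 1})"
      by (rule holomorphic_on_compose_gen[of "\<lambda>z. 1 - z" _ X "{s. Re s > 0}", unfolded o_def])
         (use 1 in \<open>auto intro!: holomorphic_intros\<close>)
    hence "(cnj \<circ> (\<lambda>z. X (1 - z)) \<circ> cnj) holomorphic_on {s. Re s < 1}"
      by (rule holomorphic_on_compose_cnj_cnj) (rule open_halfspace_Re_lt)
    thus "(\<lambda>s. \<omega> * (cnj \<circ> (\<lambda>z. X (1 - z)) \<circ> cnj) s) holomorphic_on {s. Re s < 1}"
      by (intro holomorphic_intros)
    show "\<omega> * (cnj \<circ> (\<lambda>z. X (1 - z)) \<circ> cnj) s = X s" for s using X_fe[of s] by simp
  qed
  have "X holomorphic_on ({s. Re s > 0} \<union> {s. Re s < 1})"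
    by (rule holomorphic_on_Un[OF 1 2]) (auto intro: open_halfspace_Re_lt open_halfspace_Re_gt)
  moreover have "{s. Re s > 0} \<union> {s. Re s < 1} = (UNIV :: complex set)" by auto
  ultimately show ?thesis using holomorphic_on_subset by auto
qed

lemma F_near_1:
  obtains C where "C \<ge> 0" "\<And>s. Re s \<ge> 2 \<Longrightarrow> norm (F s - 1) \<le> C * 2 powr (- Re s)"
proof -
  obtain a :: "nat \<Rightarrow> complex" where a1: "a 1 = 1" and
    a: "\<And>s. Re s > 1 \<Longrightarrow> (\<lambda>n. norm (a n * of_nat n powr (- s))) summable_on {1..}"
       "\<And>s. Re s > 1 \<Longrightarrow> F s = (\<Sum>\<^sub>\<infinity>n\<in>{1..}. a n * of_nat n powr (- s))"
    using F by (auto simp: extended_Selberg_class_def normalised_Dirichlet_series_def)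
  define A where "A = (\<Sum>\<^sub>\<infinity>n\<in>{2..}. norm (a n * of_nat n powr (- 2)))"
  have sub: "{2..} \<subseteq> {1::nat..}" by auto
  have A2: "(\<lambda>n. norm (a n * of_nat n powr (- 2))) summable_on {2..}"
    by (rule summable_on_subset_banach[OF a(1)[of 2] sub]) simp
  have A: "A \<ge> 0" unfolding A_def by (intro infsum_nonneg) auto
  have "norm (F s - 1) \<le> (4 * A) * 2 powr (- Re s)" if s: "Re s \<ge> 2" for s
  proof -
    have s1: "Re s > 1" using s by simp
    have sm: "(\<lambda>n. norm (a n * of_nat n powr (- s))) summable_on {2..}"
      by (rule summable_on_subset_banach[OF a(1)[OF s1] sub])
    have sm': "(\<lambda>n. a n * of_nat n powr (- s)) summable_on {2..}"
      using sm by (rule abs_summable_summable)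
    have "{1..} = {1::nat} \<union> {2..}" by auto
    hence "F s = (\<Sum>\<^sub>\<infinity>n\<in>{1} \<union> {2..}. a n * of_nat n powr (- s))" using a(2)[OF s1] by simp
    also have "\<dots> = 1 + (\<Sum>\<^sub>\<infinity>n\<in>{2..}. a n * of_nat n powr (- s))"
      by (subst infsum_Un_disjoint) (use sm' a1 in auto)
    finally have "norm (F s - 1) = norm (\<Sum>\<^sub>\<infinity>n\<in>{2..}. a n * of_nat n powr (- s))" by simp
    also have "\<dots> \<le> (\<Sum>\<^sub>\<infinity>n\<in>{2..}. norm (a n * of_nat n powr (- s)))" by (rule norm_infsum_bound[OF sm])
    also have "\<dots> \<le> (\<Sum>\<^sub>\<infinity>n\<in>{2..}. norm (a n * of_nat n powr (- 2)) * (4 * 2 powr (- Re s)))"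
    proof (rule infsum_mono[OF sm summable_on_cmult_left[OF A2]])
      fix n :: nat assume n: "n \<in> {2..}"
      have p: "norm (complex_of_nat n powr z) = real n powr Re z" for z
        using n by (simp add: norm_powr_real_powr)
      \<comment> \<open>The factor \<open>n powr (- 2)\<close> is kept for convergence; the
        remaining power is largest at \<open>n = 2\<close>, which gives
        \<open>4 * 2 powr (- Re s)\<close>.\<close>
      have "real n powr (- Re s) = real n powr (- 2) * real n powr (2 - Re s)" by (simp flip: powr_add)
      also have "\<dots> \<le> real n powr (- 2) * 2 powr (2 - Re s)"
        using n s by (intro mult_left_mono powr_mono2') auto
      also have "\<dots> = real n powr (- 2) * (4 * 2 powr (- Re s))" by (simp add: powr_diff powr_minus field_simps)
      finally have "real n powr (- Re s) \<le> real n powr (- 2) * (4 * 2 powr (- Re s))" .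
      hence "norm (a n) * real n powr (- Re s) \<le> norm (a n) * (real n powr (- 2) * (4 * 2 powr (- Re s)))"
        by (rule mult_left_mono) auto
      thus "norm (a n * of_nat n powr (- s)) \<le> norm (a n * of_nat n powr (- 2)) * (4 * 2 powr (- Re s))"
        using p[of "- s"] p[of "- 2"] by (simp add: norm_mult mult_ac)
    qed
    also have "\<dots> = A * (4 * 2 powr (- Re s))" unfolding A_def by (rule infsum_cmult_left')
    finally show ?thesis by (simp add: mult_ac)
  qed
  thus ?thesis using that[of "4 * A"] A by simp
qed

lemma F_bounded:
  obtains C where "C > 0" "\<And>s. Re s \<ge> 2 \<Longrightarrow> norm (F s) \<le> C"
proof -
  obtain C where C: "C \<ge> 0" "\<And>s. Re s \<ge> 2 \<Longrightarrow> norm (F s - 1) \<le> C * 2 powr (- Re s)" using F_near_1 by blast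
  have "norm (F s) \<le> 1 + C" if s: "Re s \<ge> 2" for s
  proof -
    have "2 powr (- Re s) \<le> 2 powr (0::real)" using s by (intro powr_mono) auto
    hence "C * 2 powr (- Re s) \<le> C * 1" using C by (intro mult_left_mono) auto
    moreover have "norm (F s) \<le> norm (F s - 1) + norm (1 :: complex)" using norm_triangle_ineq[of "F s - 1" 1] by simp
    ultimately show ?thesis using C(2)[OF s] by simp
  qed
  thus ?thesis using that[of "1 + C"] C by simp
qed

lemma norm_gm_le:
  assumes "Re s > 0"
  shows "norm (gm s) \<le> Q powr Re s * (\<Prod>j=1..r. Gamma (lam j * Re s + Re (mu j)))"
proof -
  have "norm (of_real Q powr s) = Q powr Re s" using params(1) by (simp add: norm_powr_real_powr)
  moreover have "norm (\<Prod>j=1..r. Gamma (of_real (lam j) * s + mu j)) \<le> (\<Prod>j=1..r. Gamma (lam j * Re s + Re (mu j)))"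
    unfolding prod_norm[symmetric]
  proof (intro prod_mono conjI)
    fix j assume j: "j \<in> {1..r}"
    have "lam j * Re s > 0" using params(2)[OF j] assms by simp
    hence "Re (of_real (lam j) * s + mu j) > 0" using params(3)[OF j] by simp
    from norm_Gamma_le[OF this] show "norm (Gamma (of_real (lam j) * s + mu j)) \<le> Gamma (lam j * Re s + Re (mu j))" by simp
  qed auto
  ultimately show ?thesis unfolding gamma_factor_def norm_mult by (intro mult_mono) auto
qed

lemma gm_bounded_strip:
  obtains B where "B > 0" "\<And>s. 1 / 2 \<le> Re s \<Longrightarrow> Re s \<le> 2 \<Longrightarrow> norm (gm s) \<le> B"
proof -
  define b where "b = (\<lambda>x. Q powr x * (\<Prod>j=1..r. Gamma (lam j * x + Re (mu j))))"
  have np: "lam j * x + Re (mu j) \<notin> \<int>\<^sub>\<le>\<^sub>0" if "j \<in> {1..r}" "x \<in> {1/2..2}" for j x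
  proof -
    have "lam j * x > 0" "Re (mu j) \<ge> 0" using params that by auto
    thus ?thesis by (auto elim!: nonpos_Ints_cases)
  qed
  have cont: "continuous_on {1/2..2} (\<lambda>x. Gamma (lam j * x + Re (mu j)))" if "j \<in> {1..r}" for j
    by (rule continuous_on_compose2[OF continuous_on_Gamma[of "- \<int>\<^sub>\<le>\<^sub>0"]])
       (use np[OF that] in \<open>auto intro!: continuous_intros\<close>)
  have "continuous_on {1/2..2} b" unfolding b_def
    by (intro continuous_on_mult continuous_on_prod cont) (use params(1) in \<open>auto intro!: continuous_intros\<close>)
  hence "compact (b ` {1/2..2})"
    by (intro compact_continuous_image compact_Icc)
  then obtain M where M: "\<And>x. x \<in> {1/2..2} \<Longrightarrow> b x \<le> M"
    by (meson bounded_imp_bdd_above compact_imp_bounded bdd_above.E imageI)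
  have "norm (gm s) \<le> max 1 M" if s: "1 / 2 \<le> Re s" "Re s \<le> 2" for s
    using norm_gm_le[of s] M[of "Re s"] s by (simp add: b_def)
  thus ?thesis using that[of "max 1 M"] by simp
qed

lemma G_growth:
  obtains C \<rho> where "C > 0" "\<rho> \<ge> 1" "\<And>s. norm (G s) \<le> C * exp (norm s powr \<rho>)"
proof -
  obtain \<rho>0 where "(\<lambda>z. norm (G z)) \<in> O[at_infinity](\<lambda>z. exp (norm z powr \<rho>0))"
    using G(1) by (auto simp: entire_of_finite_order_def)
  then obtain c where c: "c > 0" "eventually (\<lambda>z. norm (norm (G z)) \<le> c * norm (exp (norm z powr \<rho>0))) at_infinity"
    by (elim landau_o.bigE)
  then obtain M where M: "\<And>z. norm z \<ge> M \<Longrightarrow> norm (G z) \<le> c * exp (norm z powr \<rho>0)"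
    by (auto simp: eventually_at_infinity)
  define \<rho> where "\<rho> = max \<rho>0 1"
  define M' where "M' = max M 1"
  have "compact (G ` cball 0 M')"
    by (intro compact_continuous_image holomorphic_on_imp_continuous_on G_holo) auto
  then obtain B where B: "\<And>z. z \<in> cball 0 M' \<Longrightarrow> norm (G z) \<le> B"
    by (meson bounded_iff compact_imp_bounded imageI)
  define C where "C = max c B"
  have "norm (G s) \<le> C * exp (norm s powr \<rho>)" for s
  proof (cases "norm s \<le> M'")
    case True
    hence "norm (G s) \<le> C * 1" using B[of s] by (simp add: C_def)
    also have "\<dots> \<le> C * exp (norm s powr \<rho>)" using c by (intro mult_left_mono) (auto simp: C_def)
    finally show ?thesis .
  next
    case False
    hence "norm s powr \<rho>0 \<le> norm s powr \<rho>" by (intro powr_mono) (auto simp: \<rho>_def M'_def)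
    hence "c * exp (norm s powr \<rho>0) \<le> C * exp (norm s powr \<rho>)" using c by (intro mult_mono) (auto simp: C_def)
    moreover have "M \<le> norm s" using False by (simp add: M'_def)
    ultimately show ?thesis using M[of s] by linarith
  qed
  moreover have "C > 0" using c by (simp add: C_def)
  ultimately show ?thesis using that[of C \<rho>] by (simp add: \<rho>_def)
qed

lemma norm_le_shift:
  assumes "- 1 \<le> Re s"
  shows "norm s \<le> norm (s + 3)" "norm (s - 1) \<le> norm (s + 3)" "1 \<le> norm (s + 3)"
proof -
  have "(Re s)\<^sup>2 \<le> (Re s + 3)\<^sup>2" using assms by (simp add: abs_le_square_iff[symmetric])
  thus "norm s \<le> norm (s + 3)" unfolding cmod_def by simp
  have "(Re s - 1)\<^sup>2 \<le> (Re s + 3)\<^sup>2" using assms by (simp add: abs_le_square_iff[symmetric])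
  thus "norm (s - 1) \<le> norm (s + 3)" unfolding cmod_def by simp
  show "1 \<le> norm (s + 3)" using abs_Re_le_cmod[of "s + 3"] assms by simp
qed

text \<open>\<open>F\<close> and the gamma factor are bounded on \<open>Re s = 2\<close>, the
  functional equation handles \<open>Re s = - 1\<close>, and in between the finite order of
  \<open>G\<close> is the a priori growth that Phragmen-Lindeloef requires.\<close>

lemma X_strip_bound:
  obtains A where "A > 0" "\<And>s. - 1 \<le> Re s \<Longrightarrow> Re s \<le> 2 \<Longrightarrow> norm (X s) \<le> A * norm (s + 3) ^ (2 * pm)"
proof -
  obtain CF where CF: "CF > 0" "\<And>s. Re s \<ge> 2 \<Longrightarrow> norm (F s) \<le> CF" using F_bounded by blast
  obtain B where B: "B > 0" "\<And>s. 1 / 2 \<le> Re s \<Longrightarrow> Re s \<le> 2 \<Longrightarrow> norm (gm s) \<le> B" using gm_bounded_strip by blast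
  obtain C \<rho> where C: "C > 0" "\<rho> \<ge> 1" "\<And>s. norm (G s) \<le> C * exp (norm s powr \<rho>)" using G_growth by blast
  \<comment> \<open>Division by \<open>(s + 3) ^ (2 * pm)\<close> absorbs the powers of
    \<open>s\<close> and \<open>s - 1\<close>, both dominated by \<open>s + 3\<close> according to
    \<open>norm_le_shift\<close>; the zero at -3 lies outside the strip.\<close>
  define Y where "Y = (\<lambda>s. X s / (s + 3) ^ (2 * pm))"
  define A where "A = CF * B"
  have A: "A > 0" using CF B by (simp add: A_def)
  have nY: "norm (Y s) = norm (X s) / norm (s + 3) ^ (2 * pm)" for s by (simp add: Y_def norm_divide norm_power)
  have pos: "norm (s + 3) ^ (2 * pm) > 0" if "- 1 \<le> Re s" for s
    using norm_le_shift(3)[OF that] by (intro zero_less_power) linarith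
  have X2: "norm (X s) \<le> norm s ^ pm * norm (s - 1) ^ pm * A" if s: "Re s = 2" for s
  proof -
    have "s \<noteq> 1" using s by auto
    hence "norm (X s) = norm s ^ pm * norm (s - 1) ^ pm * (norm (F s) * norm (gm s))"
      using X_eq[of s] s G(2)[of s] by (simp add: norm_mult norm_power)
    also have "\<dots> \<le> norm s ^ pm * norm (s - 1) ^ pm * A"
      unfolding A_def using CF(2)[of s] B(2)[of s] s CF(1) by (intro mult_left_mono mult_mono) auto
    finally show ?thesis .
  qed
  have pw: "u ^ pm * v ^ pm * A \<le> A * w ^ (2 * pm)" if "0 \<le> u" "u \<le> w" "0 \<le> v" "v \<le> w" for u v w :: real
  proof -
    have "u ^ pm * v ^ pm \<le> w ^ pm * w ^ pm" using that by (intro mult_mono power_mono) auto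
    hence "A * (u ^ pm * v ^ pm) \<le> A * (w ^ pm * w ^ pm)" using A by (intro mult_left_mono) auto
    moreover have "w ^ pm * w ^ pm = w ^ (2 * pm)" by (simp add: mult_2 power_add)
    ultimately show ?thesis by (simp add: mult_ac)
  qed
  have bd: "norm (Y s) \<le> A" if s: "Re s = - 1 \<or> Re s = 2" for s
  proof -
    have s1: "- 1 \<le> Re s" using s by auto
    have "norm (X s) \<le> A * norm (s + 3) ^ (2 * pm)"
    proof (cases "Re s = 2")
      case True
      thus ?thesis using X2[OF True] pw[of "norm s" "norm (s + 3)" "norm (s - 1)"] norm_le_shift[OF s1] by simp
    next
      case False
      hence R: "Re (1 - cnj s) = 2" using s by auto
      have n1: "norm (1 - cnj s) = norm (s - 1)"
        by (metis complex_cnj_diff complex_cnj_one complex_mod_cnj norm_minus_commute)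
      have n2: "norm (1 - cnj s - 1) = norm s" by simp
      show ?thesis using norm_X_reflect[of s] X2[OF R] pw[of "norm (s - 1)" "norm (s + 3)" "norm s"] norm_le_shift[OF s1]
        unfolding n1 n2 by simp
    qed
    thus ?thesis using pos[OF s1] by (simp add: nY divide_simps)
  qed
  have gr0: "norm (X s) \<le> norm s ^ pm * (C * B * exp ((\<bar>Im s\<bar> + 3) powr \<rho>))" if s: "1 / 2 \<le> Re s" "Re s \<le> 2" for s
  proof -
    have "norm s \<le> \<bar>Im s\<bar> + 3" using cmod_le[of s] s by auto
    hence "norm s powr \<rho> \<le> (\<bar>Im s\<bar> + 3) powr \<rho>" using C by (intro powr_mono2) auto
    hence "C * exp (norm s powr \<rho>) \<le> C * exp ((\<bar>Im s\<bar> + 3) powr \<rho>)" using C by (intro mult_left_mono) auto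
    hence "norm (G s) \<le> C * exp ((\<bar>Im s\<bar> + 3) powr \<rho>)" using C(3)[of s] by linarith
    hence "norm (G s) * norm (gm s) \<le> (C * exp ((\<bar>Im s\<bar> + 3) powr \<rho>)) * B"
      using B(2)[OF s] C by (intro mult_mono) auto
    hence "norm s ^ pm * (norm (G s) * norm (gm s)) \<le> norm s ^ pm * ((C * exp ((\<bar>Im s\<bar> + 3) powr \<rho>)) * B)"
      by (intro mult_left_mono) auto
    thus ?thesis using X_eq[of s] s by (simp add: norm_mult norm_power mult_ac)
  qed
  have gr: "norm (Y s) \<le> C * B * exp ((\<bar>Im s\<bar> + 3) powr \<rho>)" if s: "- 1 \<le> Re s" "Re s \<le> 2" for s
  proof -
    \<comment> \<open>In the left part of the strip the gamma factor may have poles, so the estimate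
      is made at the reflected point.\<close>
    define s' where "s' = (if Re s \<ge> 1 / 2 then s else 1 - cnj s)"
    have s': "1 / 2 \<le> Re s'" "Re s' \<le> 2" "norm (X s) = norm (X s')" "\<bar>Im s'\<bar> = \<bar>Im s\<bar>"
      using s norm_X_reflect[of s] by (auto simp: s'_def)
    have n1: "norm (1 - cnj s) = norm (s - 1)"
      by (metis complex_cnj_diff complex_cnj_one complex_mod_cnj norm_minus_commute)
    have "norm s' \<le> norm (s + 3)" using norm_le_shift[OF s(1)] n1 by (simp add: s'_def)
    hence "norm s' ^ pm \<le> norm (s + 3) ^ pm" by (intro power_mono) auto
    also have "\<dots> \<le> norm (s + 3) ^ (2 * pm)" using norm_le_shift(3)[OF s(1)] by (intro power_increasing) auto
    finally have "norm s' ^ pm \<le> norm (s + 3) ^ (2 * pm)" .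
    hence "norm s' ^ pm * (C * B * exp ((\<bar>Im s'\<bar> + 3) powr \<rho>)) \<le> norm (s + 3) ^ (2 * pm) * (C * B * exp ((\<bar>Im s'\<bar> + 3) powr \<rho>))"
      using C B by (intro mult_right_mono) auto
    hence "norm (X s) \<le> norm (s + 3) ^ (2 * pm) * (C * B * exp ((\<bar>Im s\<bar> + 3) powr \<rho>))"
      using gr0[OF s'(1,2)] s'(3,4) by simp
    thus ?thesis using pos[OF s(1)] by (simp add: nY pos_divide_le_eq mult.commute)
  qed
  have "norm (X s) \<le> A * norm (s + 3) ^ (2 * pm)" if s: "- 1 \<le> Re s" "Re s \<le> 2" for s
  proof -
    have "norm (Y s) \<le> A"
    proof (rule Phragmen_Lindelof_strip[of Y "{s. Re s > - 3}" "-1" 2 A "C * B" \<rho>])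
      show "Y holomorphic_on {s. Re s > - 3}" unfolding Y_def
        by (intro holomorphic_intros X_holo) (auto simp: add_eq_0_iff2)
      show "open {s. Re s > - 3}" by (rule open_halfspace_Re_gt)
    qed (use bd gr s A in auto)
    thus ?thesis using pos[OF s(1)] by (simp add: nY pos_divide_le_eq)
  qed
  thus ?thesis using that A by blast
qed

lemma X_subgaussian: "subgaussian_on UNIV X"
proof -
  have gm: "subgaussian_on {s. Re s \<ge> 2} gm"
    unfolding gamma_factor_def [abs_def]
  proof (intro subgaussian_on_mult subgaussian_on_prod subgaussian_on_Gamma)
    show "subgaussian_on {s. Re s \<ge> 2} (\<lambda>s. of_real Q powr s)"
    proof (rule subgaussian_on_exp_bound)
      fix s :: complex
      have "norm (of_real Q powr s) = exp (Re s * ln Q)" using params(1) by (simp add: norm_powr_real_powr powr_def)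
      also have "\<dots> \<le> exp (\<bar>ln Q\<bar> * norm s + 0)"
      proof -
        have "Re s * ln Q \<le> \<bar>Re s * ln Q\<bar>" by (rule abs_ge_self)
        also have "\<dots> \<le> \<bar>ln Q\<bar> * norm s" 
          unfolding abs_mult using mult_right_mono[OF abs_Re_le_cmod[of s], of "\<bar>ln Q\<bar>"] by (simp add: mult.commute)
        finally show ?thesis by simp
      qed
      finally show "norm (of_real Q powr s) \<le> exp (\<bar>ln Q\<bar> * norm s + 0)" .
    qed
  qed (use params in auto)
  obtain CF where CF: "CF > 0" "\<And>s. Re s \<ge> 2 \<Longrightarrow> norm (F s) \<le> CF" using F_bounded by blast
  have Fs: "subgaussian_on {s. Re s \<ge> 2} F"
    by (rule subgaussian_on_exp_bound[of _ _ 0 "ln CF"]) (use CF in auto)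
  have 1: "subgaussian_on {s. Re s \<ge> 2} (\<lambda>s. (s + 0) ^ pm * ((s + (- 1)) ^ pm * F s) * gm s)"
    by (intro subgaussian_on_mult subgaussian_on_power subgaussian_on_shift gm Fs)
  have eq: "(s + 0) ^ pm * ((s + (- 1)) ^ pm * F s) * gm s = X s" if "Re s \<ge> 2" for s
  proof -
    have "s \<noteq> 1" using that by auto
    thus ?thesis using X_eq[of s] G(2)[of s] that by simp
  qed
  obtain A where A: "A > 0" "\<And>s. - 1 \<le> Re s \<Longrightarrow> Re s \<le> 2 \<Longrightarrow> norm (X s) \<le> A * norm (s + 3) ^ (2 * pm)"
    using X_strip_bound by blast
  have 2: "subgaussian_on UNIV (\<lambda>s. of_real A * (s + 3) ^ (2 * pm))"
    by (intro subgaussian_on_mult subgaussian_on_power subgaussian_on_shift subgaussian_on_const)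
  show ?thesis unfolding subgaussian_on_def
  proof (intro allI impI)
    fix e :: real assume e: "e > 0"
    hence e2: "e / 2 > 0" by simp
    obtain C1 where C1': "C1 > 0" "\<And>s. s \<in> {s. Re s \<ge> 2} \<Longrightarrow>
        norm ((s + 0) ^ pm * ((s + (- 1)) ^ pm * F s) * gm s) \<le> C1 * exp (e / 2 * (norm s)\<^sup>2)"
      using subgaussian_onD[OF 1 e2] by blast
    have C1: "C1 > 0" "norm (X s) \<le> C1 * exp (e / 2 * (norm s)\<^sup>2)" if "Re s \<ge> 2" for s
      using C1'(1) C1'(2)[of s] that unfolding eq[OF that] by simp_all
    obtain C2 where C2': "C2 > 0" "\<And>s::complex. s \<in> UNIV \<Longrightarrow> norm (of_real A * (s + 3) ^ (2 * pm)) \<le> C2 * exp (e / 2 * (norm s)\<^sup>2)"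
      using subgaussian_onD[OF 2 e2] by blast
    note C2 = C2'(1) C2'(2)[OF UNIV_I]
    define C where "C = max C1 C2"
    have C: "C > 0" "C \<ge> C1" "C \<ge> C2" using C1'(1) by (auto simp: C_def)
    have 3: "norm (X s) \<le> C * exp (e / 2 * (norm s)\<^sup>2)" if s: "Re s \<ge> - 1" for s
    proof (cases "Re s \<ge> 2")
      case True
      have "C1 * exp (e / 2 * (norm s)\<^sup>2) \<le> C * exp (e / 2 * (norm s)\<^sup>2)" using C by (intro mult_right_mono) auto
      thus ?thesis using C1(2)[OF True] by linarith
    next
      case False
      have "C2 * exp (e / 2 * (norm s)\<^sup>2) \<le> C * exp (e / 2 * (norm s)\<^sup>2)" using C by (intro mult_right_mono) auto
      moreover have "norm (X s) \<le> norm (of_real A * (s + 3) ^ (2 * pm))"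
        using A(2)[of s] A(1) s False by (simp add: norm_mult norm_power)
      ultimately show ?thesis using C2(2)[of s] by linarith
    qed
    have "norm (X s) \<le> C * exp e * exp (e * (norm s)\<^sup>2)" for s
    proof (cases "Re s \<ge> - 1")
      case True
      have "e / 2 * (norm s)\<^sup>2 \<le> e + e * (norm s)\<^sup>2" using e by (simp add: algebra_simps add_nonneg_nonneg)
      hence "exp (e / 2 * (norm s)\<^sup>2) \<le> exp e * exp (e * (norm s)\<^sup>2)" by (simp flip: exp_add)
      hence "C * exp (e / 2 * (norm s)\<^sup>2) \<le> C * (exp e * exp (e * (norm s)\<^sup>2))" using C by (intro mult_left_mono) auto
      thus ?thesis using 3[OF True] by (simp add: mult_ac)
    next
      case False
      \<comment> \<open>Reflection can enlarge the modulus by 1; starting with \<open>e / 2\<close>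
        leaves room for this, at the price of the factor \<open>exp e\<close>.\<close>
      define s' where "s' = 1 - cnj s"
      have "norm s' \<le> 1 + norm s" unfolding s'_def using norm_triangle_ineq4[of 1 "cnj s"] by simp
      hence "(norm s')\<^sup>2 \<le> (1 + norm s)\<^sup>2" by (intro power_mono) auto
      also have "\<dots> \<le> 2 + 2 * (norm s)\<^sup>2" using sum_squares_bound[of 1 "norm s"] by (simp add: power2_sum)
      finally have "e / 2 * (norm s')\<^sup>2 \<le> e / 2 * (2 + 2 * (norm s)\<^sup>2)" using e by (intro mult_left_mono) auto
      also have "\<dots> = e + e * (norm s)\<^sup>2" by (simp add: algebra_simps)
      finally have "exp (e / 2 * (norm s')\<^sup>2) \<le> exp e * exp (e * (norm s)\<^sup>2)" by (simp flip: exp_add)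
      hence "C * exp (e / 2 * (norm s')\<^sup>2) \<le> C * (exp e * exp (e * (norm s)\<^sup>2))" using C by (intro mult_left_mono) auto
      moreover have "norm (X s) \<le> C * exp (e / 2 * (norm s')\<^sup>2)"
        using 3[of s'] norm_X_reflect[of s] False by (simp add: s'_def)
      ultimately show ?thesis by (simp add: mult_ac)
    qed
    thus "\<exists>C>0. \<forall>s\<in>UNIV. norm (X s) \<le> C * exp (e * (norm s)\<^sup>2)"
      using C by (intro exI[of _ "C * exp e"]) auto
  qed
qed

end

section \<open>Real parts of Digamma and size of the trigamma function\<close>

lemma Re_Digamma_ge:
  assumes "Re z > 0"
  shows "Digamma (Re z) \<le> Re (Digamma z)"
proof (rule tendsto_le)
  have z: "z \<noteq> 0" "Re z \<noteq> 0" using assms by auto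
  show "(\<lambda>m. Re (of_real (ln (real m)) - (\<Sum>n<m. inverse (z + of_nat n)))) \<longlonglongrightarrow> Re (Digamma z)"
    by (intro tendsto_Re Digamma_LIMSEQ z)
  show "(\<lambda>m. of_real (ln (real m)) - (\<Sum>n<m. inverse (Re z + of_nat n))) \<longlonglongrightarrow> Digamma (Re z)"
    by (rule Digamma_LIMSEQ[OF z(2)])
  have "Re (inverse (z + of_nat n)) \<le> inverse (Re z + of_nat n)" for n
  proof -
    define x where "x = Re z + real n"
    have x: "x > 0" using assms by (simp add: x_def)
    have "Re (inverse (z + of_nat n)) = x / (x\<^sup>2 + (Im z)\<^sup>2)" by (simp add: x_def)
    also have "\<dots> \<le> x / x\<^sup>2" using x by (intro divide_left_mono mult_pos_pos add_pos_nonneg) auto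
    also have "\<dots> = inverse x" using x by (simp add: power2_eq_square field_simps)
    finally show ?thesis by (simp add: x_def)
  qed
  hence "(\<Sum>n<m. Re (inverse (z + of_nat n))) \<le> (\<Sum>n<m. inverse (Re z + of_nat n))" for m
    by (intro sum_mono)
  thus "eventually (\<lambda>m. of_real (ln (real m)) - (\<Sum>n<m. inverse (Re z + of_nat n)) \<le>
      Re (of_real (ln (real m)) - (\<Sum>n<m. inverse (z + of_nat n)))) sequentially"
    by (intro always_eventually) simp
qed auto

lemma Digamma_real_unbounded: "\<exists>x0>0. \<forall>x\<ge>x0. B \<le> Digamma (x :: real)"
proof -
  have "eventually (\<lambda>n. B + euler_mascheroni \<le> harm n) sequentially"
    using harm_at_top by (simp add: filterlim_at_top)
  then obtain n where n: "B + euler_mascheroni \<le> (harm n :: real)" by (auto simp: eventually_sequentially)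
  have "B \<le> Digamma x" if "x \<ge> real (Suc n)" for x
  proof -
    have "B \<le> Digamma (real (Suc n))" unfolding Digamma_of_nat using n by linarith
    also have "\<dots> \<le> Digamma x" by (rule Digamma_real_mono) (use that in auto)
    finally show ?thesis .
  qed
  thus ?thesis by (intro exI[of _ "real (Suc n)"]) auto
qed

text \<open>\<open>1 / z\<close> is the telescoping sum of
  \<open>1 / (z + n) - 1 / (z + n + 1)\<close>, so the difference is the sum of
  \<open>1 / ((z + n)^2 * (z + n + 1))\<close>. The lower bound on \<open>norm (z + n)\<close> grows
  with both \<open>u\<close> and \<open>n\<close>, which makes this of size
  \<open>1 / u^2\<close>.\<close>

lemma trigamma_approx:
  fixes z :: complex
  assumes u: "u \<ge> 2" and z: "\<And>n. (u + real n) / 2 \<le> norm (z + of_nat n)"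
  shows "norm (Polygamma 1 z - 1 / z) \<le> 8 / u\<^sup>2"
proof -
  define a where "a = (\<lambda>n. inverse ((z + of_nat n) ^ 2) - (inverse (z + of_nat n) - inverse (z + of_nat (Suc n))))"
  \<comment> \<open>A telescoping majorant:
    \<open>g n - g (Suc n) = 2 / ((v - 1) * v * (v + 1))\<close> with
    \<open>v = u + n\<close>.\<close>
  define g where "g = (\<lambda>n. 1 / ((u + real n - 1) * (u + real n)))"
  have z0: "z + of_nat n \<noteq> 0" for n
  proof -
    have "(u + real n) / 2 > 0" using u by simp
    thus ?thesis using z[of n] by force
  qed
  have zz: "z \<noteq> 0" using z0[of 0] by simp
  have "(\<lambda>n. inverse (z + of_nat n) - inverse (z + of_nat (Suc n))) sums (inverse (z + of_nat 0) - 0)"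
    by (intro telescope_sums' filterlim_compose[OF tendsto_inverse_0]
              tendsto_add_filterlim_at_infinity[OF tendsto_const] tendsto_of_nat)
  moreover have "(\<lambda>n. inverse ((z + of_nat n) ^ 2)) sums Polygamma 1 z"
    using summable_sums[OF Polygamma_converges'[OF zz, of 2]] by (simp add: Polygamma_def numeral_2_eq_2)
  ultimately have a: "a sums (Polygamma 1 z - 1 / z)"
    unfolding a_def using sums_diff by (fastforce simp: inverse_eq_divide)
  have gl: "g \<longlonglongrightarrow> 0" unfolding g_def by real_asymp
  have "(\<lambda>n. g n - g (Suc n)) sums (g 0 - 0)" by (rule telescope_sums'[OF gl])
  hence sg: "(\<lambda>n. 4 * (g n - g (Suc n))) sums (4 * g 0)" using sums_mult[of _ _ 4] by fastforce
  have "norm (a n) \<le> 4 * (g n - g (Suc n))" for n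
  proof -
    define v where "v = u + real n"
    have v: "v \<ge> 2" using u by (simp add: v_def)
    have n1: "v / 2 \<le> norm (z + of_nat n)" "v / 2 \<le> norm (z + of_nat (Suc n))"
      using z[of n] z[of "Suc n"] by (simp_all add: v_def)
    have id: "inverse (x ^ 2) - (inverse x - inverse (x + 1)) = inverse (x ^ 2 * (x + 1))"
      if "x \<noteq> 0" "x + 1 \<noteq> 0" for x :: complex
    proof -
      define u v where "u = inverse x" and "v = inverse (x + 1)"
      have "x * u = 1" "(x + 1) * v = 1" using that by (auto simp: u_def v_def)
      hence "u ^ 2 - (u - v) = u ^ 2 * v" by algebra
      thus ?thesis by (simp add: u_def v_def power_inverse)
    qed
    have "a n = inverse ((z + of_nat n) ^ 2 * (z + of_nat (Suc n)))"
      using id[of "z + of_nat n"] z0[of n] z0[of "Suc n"] unfolding a_def by (simp add: add_ac)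
    hence "norm (a n) = 1 / ((norm (z + of_nat n))\<^sup>2 * norm (z + of_nat (Suc n)))"
      by (simp add: norm_inverse norm_mult norm_power norm_divide inverse_eq_divide)
    also have "\<dots> \<le> 1 / ((v / 2)\<^sup>2 * (v / 2))"
      using n1 v by (intro divide_left_mono mult_mono power_mono mult_pos_pos) (auto intro: less_le_trans[of 0 "v / 2"])
    also have "\<dots> = 8 / v ^ 3" by (simp add: power2_eq_square power3_eq_cube)
    also have "\<dots> \<le> 8 / ((v - 1) * v * (v + 1))"
    proof (rule divide_left_mono)
      show "(v - 1) * v * (v + 1) \<le> v ^ 3" using v by (simp add: power3_eq_cube algebra_simps)
    qed (use v in auto)
    also have "\<dots> = 4 * (1 / ((v - 1) * v) - 1 / (v * (v + 1)))"
    proof -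
      define a b c where "a = 1 / (v - 1)" and "b = 1 / v" and "c = 1 / (v + 1)"
      have "(v - 1) * a = 1" "v * b = 1" "(v + 1) * c = 1" using v by (auto simp: a_def b_def c_def)
      hence "8 * (a * b * c) = 4 * (a * b - b * c)" by algebra
      thus ?thesis by (simp add: a_def b_def c_def)
    qed
    also have "\<dots> = 4 * (g n - g (Suc n))" by (simp add: g_def v_def add_ac)
    finally show ?thesis .
  qed
  hence "norm (suminf a) \<le> (\<Sum>n. 4 * (g n - g (Suc n)))" using sums_summable[OF sg] by (intro norm_suminf_le)
  also have "\<dots> = 4 * g 0" using sg by (simp add: sums_iff)
  also have "\<dots> \<le> 8 / u\<^sup>2"
  proof -
    have "2 * u \<le> u * u" using u by (intro mult_right_mono) auto
    hence "u\<^sup>2 / 2 \<le> (u - 1) * u" by (simp add: power2_eq_square algebra_simps)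
    hence "4 / ((u - 1) * u) \<le> 4 / (u\<^sup>2 / 2)" using u by (intro divide_left_mono mult_pos_pos) auto
    thus ?thesis by (simp add: g_def)
  qed
  finally show ?thesis using a by (simp add: sums_iff)
qed

section \<open>The degenerate case: no Gamma factor and \<open>Q \<le> 1\<close>\<close>

lemma power_exp_tendsto_0:
  assumes "b > (0::real)"
  shows "((\<lambda>x. x ^ k * exp (- b * x)) \<longlongrightarrow> 0) at_top"
proof -
  have "filterlim (\<lambda>x. b * x) at_top at_top"
    using assms by (intro filterlim_tendsto_pos_mult_at_top[OF tendsto_const] filterlim_ident) auto
  from filterlim_compose[OF tendsto_power_div_exp_0[of k] this]
  have "((\<lambda>x. (1 / b ^ k) * ((b * x) ^ k / exp (b * x))) \<longlongrightarrow> (1 / b ^ k) * 0) at_top"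
    by (intro tendsto_mult tendsto_const)
  moreover have "(1 / b ^ k) * ((b * x) ^ k / exp (b * x)) = x ^ k * exp (- b * x)" for x
    using assms by (simp add: power_mult_distrib exp_minus field_simps)
  ultimately show ?thesis by simp
qed

text \<open>Polynomial growth makes \<open>D\<close> a polynomial. A non-constant one has modulus at
  least 1 far out, against the limit along the positive axis, and a constant equals that
  limit.\<close>

lemma polyfun_tendsto_0:
  fixes D :: "complex \<Rightarrow> complex"
  assumes D: "D holomorphic_on UNIV" "\<And>z. norm z \<ge> 1 \<Longrightarrow> norm (D z) \<le> B * norm z ^ n"
    and lim: "((\<lambda>x. D (of_real x)) \<longlongrightarrow> 0) at_top"
  shows "D z = 0"
proof -
  define c where "c = (\<lambda>k. (deriv ^^ k) D 0 / fact k)"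
  have eq: "D z = (\<Sum>k\<le>n. c k * z ^ k)" for z
    unfolding c_def by (rule Liouville_polynomial[OF D(1), of 1 B n]) (use D in auto)
  have c0: "c k = 0" if "k \<noteq> 0" "k \<le> n" for k
  proof (rule ccontr)
    assume ck: "c k \<noteq> 0"
    have "eventually (\<lambda>z. 1 \<le> norm (\<Sum>i\<le>n. c i * z ^ i)) at_infinity"
      using polyfun_extremal[where c = c and n = n and B = 1] ck that by auto
    then obtain b where b: "\<And>z. norm z \<ge> b \<Longrightarrow> 1 \<le> norm (D z)" by (auto simp: eventually_at_infinity eq)
    have "eventually (\<lambda>x. norm (D (of_real x)) < 1) at_top" using tendstoD[OF lim, of 1] by simp
    hence "eventually (\<lambda>x::real. False) at_top"
      using eventually_ge_at_top[of "max b 0"]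
    proof eventually_elim
      case (elim x)
      thus ?case using b[of "of_real x"] by simp
    qed
    thus False by simp
  qed
  have "D z = c 0" for z
  proof -
    have "(\<Sum>k\<le>n. c k * z ^ k) = (\<Sum>k\<in>{0}. c k * z ^ k)" by (rule sum.mono_neutral_right) (use c0 in auto)
    thus ?thesis using eq[of z] by simp
  qed
  moreover have "c 0 = 0" using lim calculation by (simp add: tendsto_const_iff)
  ultimately show ?thesis by simp
qed

context selberg_data
begin

text \<open>For \<open>Q \<le> 1\<close> the gamma factor \<open>Q powr s\<close> is bounded to the
  right, so \<open>X\<close> grows polynomially there and, by the functional equation, everywhere.
  For \<open>Q = 1\<close> this polynomial agrees with \<open>s ^ pm * (s - 1) ^ pm\<close> up to
  terms tending to 0 along the positive axis, so both are equal and \<open>F = 1\<close>. For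
  \<open>Q < 1\<close> the comparison would give \<open>X = 0\<close>, against \<open>F\<close>
  tending to 1.\<close>

lemma F_eq_1_of_trivial_gamma_factor:
  assumes "r = 0" "Q \<le> 1"
  shows "Q = 1 \<and> (\<forall>s. Re s > 0 \<longrightarrow> s \<noteq> 1 \<longrightarrow> F s = 1)"
proof -
  obtain CF where CF: "CF > 0" "\<And>s. Re s \<ge> 2 \<Longrightarrow> norm (F s) \<le> CF" using F_bounded by blast
  obtain C1 where C1: "C1 \<ge> 0" "\<And>s. Re s \<ge> 2 \<Longrightarrow> norm (F s - 1) \<le> C1 * 2 powr (- Re s)" using F_near_1 by blast
  obtain A where A: "A > 0" "\<And>s. - 1 \<le> Re s \<Longrightarrow> Re s \<le> 2 \<Longrightarrow> norm (X s) \<le> A * norm (s + 3) ^ (2 * pm)"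
    using X_strip_bound by blast
  have gm: "gm s = of_real Q powr s" for s by (simp add: gamma_factor_def assms)
  have ngm: "norm (gm s) = Q powr Re s" for s using params(1) by (simp add: gm norm_powr_real_powr)
  have Xr: "X s = s ^ pm * (s - 1) ^ pm * gm s * F s" if "Re s > 0" "s \<noteq> 1" for s
    using X_eq[OF that(1)] G(2)[OF that(2)] by simp
  define B where "B = max A CF"
  have B: "B > 0" "A \<le> B" "CF \<le> B" using A by (auto simp: B_def)
  have right: "norm (X s) \<le> B * norm (s + 3) ^ (2 * pm)" if s: "Re s \<ge> - 1" for s
  proof (cases "Re s \<le> 2")
    case True
    have "A * norm (s + 3) ^ (2 * pm) \<le> B * norm (s + 3) ^ (2 * pm)" using B by (intro mult_right_mono) auto
    thus ?thesis using A(2)[OF s True] by linarith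
  next
    case False
    have "Q powr Re s \<le> 1 powr Re s" using False params assms by (intro powr_mono2) auto
    hence q: "norm (gm s) \<le> 1" by (simp add: ngm)
    have "s \<noteq> 1" using False by auto
    hence "norm (X s) = norm s ^ pm * norm (s - 1) ^ pm * (norm (gm s) * norm (F s))"
      using Xr[of s] False by (simp add: norm_mult norm_power)
    also have "\<dots> \<le> norm (s + 3) ^ pm * norm (s + 3) ^ pm * (1 * CF)"
      using norm_le_shift[OF s] q CF(2)[of s] False by (intro mult_mono power_mono) auto
    also have "\<dots> = CF * norm (s + 3) ^ (2 * pm)" by (simp add: mult_2 power_add)
    also have "\<dots> \<le> B * norm (s + 3) ^ (2 * pm)" using B by (intro mult_right_mono) auto
    finally show ?thesis .
  qed
  have all: "norm (X s) \<le> B * (5 * norm s) ^ (2 * pm)" if s: "norm s \<ge> 1" for s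
  proof -
    define s' where "s' = (if Re s \<ge> - 1 then s else 1 - cnj s)"
    have s': "Re s' \<ge> - 1" "norm (X s) = norm (X s')" using norm_X_reflect[of s] by (auto simp: s'_def)
    have "norm (1 - cnj s) \<le> 1 + norm s" using norm_triangle_ineq4[of 1 "cnj s"] by simp
    hence "norm s' \<le> 2 * norm s" using s by (auto simp: s'_def)
    hence "norm (s' + 3) \<le> 5 * norm s" using s norm_triangle_ineq[of s' 3] by simp
    hence "norm (s' + 3) ^ (2 * pm) \<le> (5 * norm s) ^ (2 * pm)" by (intro power_mono) auto
    hence "B * norm (s' + 3) ^ (2 * pm) \<le> B * (5 * norm s) ^ (2 * pm)" using B by (intro mult_left_mono) auto
    thus ?thesis using right[OF s'(1)] s'(2) by linarith
  qed
  \<comment> \<open>The limit of \<open>Q powr x\<close> for large real \<open>x\<close>, chosen so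
    that \<open>D\<close> tends to 0 along the positive axis.\<close>
  define e :: complex where "e = (if Q = 1 then 1 else 0)"
  define D where "D = (\<lambda>s. X s - e * (s ^ pm * (s - 1) ^ pm))"
  have D0: "D s = 0" for s
  proof (rule polyfun_tendsto_0[of D "B * 5 ^ (2 * pm) + 2 ^ pm" "2 * pm"])
    show "D holomorphic_on UNIV" unfolding D_def by (intro holomorphic_intros X_holo)
    show "norm (D z) \<le> (B * 5 ^ (2 * pm) + 2 ^ pm) * norm z ^ (2 * pm)" if z: "norm z \<ge> 1" for z
    proof -
      have "norm (z - 1) \<le> 2 * norm z" using z norm_triangle_ineq4[of z 1] by simp
      hence "norm z ^ pm * norm (z - 1) ^ pm \<le> norm z ^ pm * (2 * norm z) ^ pm" by (intro mult_left_mono power_mono) auto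
      also have "\<dots> = 2 ^ pm * (norm z ^ pm * norm z ^ pm)" by (simp add: power_mult_distrib)
      also have "norm z ^ pm * norm z ^ pm = norm z ^ (2 * pm)" by (simp add: mult_2 power_add)
      finally have "norm (e * (z ^ pm * (z - 1) ^ pm)) \<le> 2 ^ pm * norm z ^ (2 * pm)" by (simp add: e_def norm_mult norm_power)
      moreover have "norm (X z) \<le> B * 5 ^ (2 * pm) * norm z ^ (2 * pm)" using all[OF z] by (simp add: power_mult_distrib)
      moreover have "norm (D z) \<le> norm (X z) + norm (e * (z ^ pm * (z - 1) ^ pm))" unfolding D_def by (rule norm_triangle_ineq4)
      ultimately show ?thesis by (simp add: distrib_right)
    qed
    show "((\<lambda>x. D (of_real x)) \<longlongrightarrow> 0) at_top"
    proof (cases "Q = 1")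
      case True
      have "((\<lambda>x::real. C1 * (x ^ (pm + pm) * exp (- ln 2 * x))) \<longlongrightarrow> C1 * 0) at_top"
        by (intro tendsto_mult tendsto_const power_exp_tendsto_0) simp
      hence lim: "((\<lambda>x::real. C1 * (x ^ pm * x ^ pm * 2 powr (- x))) \<longlongrightarrow> C1 * 0) at_top"
        by (simp add: power_add powr_def mult_ac)
      have "eventually (\<lambda>x. norm (D (of_real x)) \<le> C1 * (x ^ pm * x ^ pm * 2 powr (- x))) at_top"
        using eventually_ge_at_top[of 2]
      proof eventually_elim
        case (elim x)
        have "x \<noteq> 1" using elim by simp
        hence x1: "complex_of_real x \<noteq> 1" by simp
        have "complex_of_real x - 1 = of_real (x - 1)" by simp
        hence n1: "norm (complex_of_real x - 1) = x - 1" using elim by (simp only: norm_of_real)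
        have "D (of_real x) = of_real x ^ pm * (of_real x - 1) ^ pm * (F (of_real x) - 1)"
          using Xr[of "of_real x"] x1 elim True gm[unfolded True] by (simp add: D_def e_def algebra_simps)
        hence "norm (D (of_real x)) = x ^ pm * (x - 1) ^ pm * norm (F (of_real x) - 1)"
          using elim by (simp add: norm_mult norm_power n1)
        also have "\<dots> \<le> x ^ pm * x ^ pm * (C1 * 2 powr (- x))"
          using C1(2)[of "of_real x"] elim by (intro mult_mono power_mono) auto
        finally show ?case by (simp add: mult_ac)
      qed
      thus ?thesis by (rule Lim_null_comparison) (use lim in simp)
    next
      case False
      hence Q1: "0 < Q" "Q < 1" using params assms by auto
      define b where "b = - ln Q"
      have b: "b > 0" using Q1 by (simp add: b_def)
      have "((\<lambda>x::real. CF * (x ^ (pm + pm) * exp (- b * x))) \<longlongrightarrow> CF * 0) at_top"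
        by (intro tendsto_mult tendsto_const power_exp_tendsto_0 b)
      hence lim: "((\<lambda>x::real. CF * (x ^ pm * x ^ pm * exp (- b * x))) \<longlongrightarrow> CF * 0) at_top"
        by (simp add: power_add mult_ac)
      have "eventually (\<lambda>x. norm (D (of_real x)) \<le> CF * (x ^ pm * x ^ pm * exp (- b * x))) at_top"
        using eventually_ge_at_top[of 2]
      proof eventually_elim
        case (elim x)
        have "x \<noteq> 1" using elim by simp
        hence x1: "complex_of_real x \<noteq> 1" by simp
        have "complex_of_real x - 1 = of_real (x - 1)" by simp
        hence n1: "norm (complex_of_real x - 1) = x - 1" using elim by (simp only: norm_of_real)
        have "norm (D (of_real x)) = x ^ pm * (x - 1) ^ pm * (exp (- b * x) * norm (F (of_real x)))"
          using Xr[of "of_real x"] x1 elim False ngm[of "of_real x"] Q1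
          by (simp add: D_def e_def norm_mult norm_power powr_def b_def n1)
        also have "\<dots> \<le> x ^ pm * x ^ pm * (exp (- b * x) * CF)"
          using CF(2)[of "of_real x"] elim by (intro mult_mono power_mono) auto
        finally show ?case by (simp add: mult_ac)
      qed
      thus ?thesis by (rule Lim_null_comparison) (use lim in simp)
    qed
  qed
  have "Q = 1"
  proof (rule ccontr)
    assume "Q \<noteq> 1"
    hence X0: "X s = 0" for s using D0[of s] by (simp add: D_def e_def)
    have "((\<lambda>x::real. C1 * 2 powr (- x)) \<longlongrightarrow> C1 * 0) at_top"
      by (intro tendsto_mult tendsto_const) real_asymp
    hence "eventually (\<lambda>x::real. C1 * 2 powr (- x) < 1) at_top" using order_tendstoD(2)[of _ "C1 * 0" _ 1] by simp
    then obtain x0 where x0: "\<And>x. x \<ge> x0 \<Longrightarrow> C1 * 2 powr (- x) < 1" by (auto simp: eventually_at_top_linorder)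
    define x where "x = max x0 2"
    have x: "x \<ge> 2" "C1 * 2 powr (- x) < 1" using x0[of x] by (auto simp: x_def)
    have "x \<noteq> 1" using x by simp
    hence "complex_of_real x \<noteq> 1" by simp
    hence "F (of_real x) = 0" using Xr[of "of_real x"] X0 x gm_nz[of "of_real x"] by auto
    thus False using C1(2)[of "of_real x"] x by simp
  qed
  moreover have "F s = 1" if "Re s > 0" "s \<noteq> 1" "Q = 1" for s
    using D0[of s] Xr[OF that(1,2)] that gm[unfolded that(3)] by (auto simp: D_def e_def)
  ultimately show ?thesis by blast
qed

end

section \<open>The completed function on the critical line\<close>

lemma real_on_reals_imp_sym:
  assumes g: "g holomorphic_on bowtie d" "d > 0" and re: "\<And>t. Im (g (of_real t)) = 0" and w: "w \<in> bowtie d"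
  shows "g (cnj w) = cnj (g w)"
proof -
  have img: "cnj ` bowtie d = bowtie d" by (auto simp: image_iff intro!: bexI[of _ "cnj _"])
  have h: "(cnj \<circ> g \<circ> cnj) holomorphic_on bowtie d"
    by (rule holomorphic_on_compose_cnj_cnj) (use g img open_bowtie in auto)
  have "g z - (cnj \<circ> g \<circ> cnj) z = 0" if z: "z \<in> bowtie d" for z
  proof (rule analytic_continuation[of "\<lambda>z. g z - (cnj \<circ> g \<circ> cnj) z" "bowtie d" "range of_real" 0])
    show "(\<lambda>z. g z - (cnj \<circ> g \<circ> cnj) z) holomorphic_on bowtie d" by (intro holomorphic_intros g h)
    show "0 islimpt range complex_of_real" by (rule zero_islimpt_reals)
    show "0 \<in> bowtie d" using of_real_in_bowtie[OF g(2), of 0] by simp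
    show "g z - (cnj \<circ> g \<circ> cnj) z = 0" if "z \<in> range complex_of_real" for z
      using that re by (auto simp: complex_eq_iff)
  qed (use z g open_bowtie connected_bowtie in auto)
  from this[of "cnj w"] w show ?thesis by simp
qed

lemma has_field_derivative_prod_logderiv:
  fixes g :: "'a \<Rightarrow> complex \<Rightarrow> complex"
  assumes "finite S" "\<And>j. j \<in> S \<Longrightarrow> (g j has_field_derivative g j s * d j) (at s)"
  shows "((\<lambda>z. \<Prod>j\<in>S. g j z) has_field_derivative (\<Prod>j\<in>S. g j s) * (\<Sum>j\<in>S. d j)) (at s)"
  using assms
proof (induction S rule: finite_induct)
  case (insert a S)
  have "((\<lambda>z. g a z * (\<Prod>j\<in>S. g j z)) has_field_derivative
      g a s * d a * (\<Prod>j\<in>S. g j s) + (\<Prod>j\<in>S. g j s) * (\<Sum>j\<in>S. d j) * g a s) (at s)"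
    by (rule DERIV_mult) (use insert in auto)
  thus ?case using insert.hyps by (simp add: algebra_simps)
qed simp

context selberg_data
begin

section \<open>The logarithmic derivative of the completed function far to the right\<close>

lemma F_holo: "F holomorphic_on {s. Re s > 1}"
proof (rule holomorphic_transform[of "\<lambda>s. G s / (s - 1) ^ pm"])
  show "(\<lambda>s. G s / (s - 1) ^ pm) holomorphic_on {s. Re s > 1}"
    by (intro holomorphic_intros G_holo) auto
  fix s :: complex assume "s \<in> {s. Re s > 1}"
  hence "s \<noteq> 1" by auto
  thus "G s / (s - 1) ^ pm = F s" using G(2)[of s] by simp
qed

text \<open>\<open>F - 1\<close> is of size \<open>2 powr (- Re s)\<close>, and Cauchy's estimate on
  unit circles passes this on to the derivative.\<close>

lemma F_logderiv_small:
  assumes "e > 0"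
  shows "\<exists>x0\<ge>3. \<forall>s. Re s \<ge> x0 \<longrightarrow> F s \<noteq> 0 \<and> norm (deriv F s / F s) \<le> e"
proof -
  obtain C1 where C1: "C1 \<ge> 0" "\<And>s. Re s \<ge> 2 \<Longrightarrow> norm (F s - 1) \<le> C1 * 2 powr (- Re s)" using F_near_1 by blast
  have "((\<lambda>x::real. C1 * (x ^ 0 * exp (- ln 2 * x))) \<longlongrightarrow> C1 * 0) at_top"
    by (intro tendsto_mult tendsto_const power_exp_tendsto_0) simp
  hence lim: "((\<lambda>x::real. C1 * 2 powr (- x)) \<longlongrightarrow> 0) at_top" by (simp add: powr_def mult_ac)
  define e' where "e' = min (1 / 2) (e / 4)"
  have e': "e' > 0" "e' \<le> 1 / 2" "4 * e' \<le> e" using assms by (auto simp: e'_def)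
  obtain x0 where x0: "\<And>x. x \<ge> x0 \<Longrightarrow> C1 * 2 powr (- x) < e'"
    using order_tendstoD(2)[OF lim e'(1)] by (auto simp: eventually_at_top_linorder)
  have "F s \<noteq> 0 \<and> norm (deriv F s / F s) \<le> e" if s: "Re s \<ge> max 3 x0" for s
  proof -
    define c where "c = C1 * 2 powr (- Re s)"
    have c: "c < e'" "c \<ge> 0" using x0[of "Re s"] s C1 by (auto simp: c_def)
    have "norm (F s - 1) \<le> 1 / 2" using C1(2)[of s] s c e' unfolding c_def by simp
    moreover have "norm (1 :: complex) \<le> norm (F s) + norm (F s - 1)" using norm_triangle_ineq4[of "F s" "F s - 1"] by simp
    ultimately have F2: "norm (F s) \<ge> 1 / 2" by simp
    have sub: "cball s 1 \<subseteq> {s. Re s > 1}"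
    proof
      fix z assume "z \<in> cball s 1"
      hence "\<bar>Re (s - z)\<bar> \<le> 1" using abs_Re_le_cmod[of "s - z"] by (simp add: dist_norm)
      moreover have "Re s \<ge> 3" using s by simp
      ultimately show "z \<in> {s. Re s > 1}" by (simp add: abs_le_iff)
    qed
    have hF1: "(\<lambda>s. F s - 1) holomorphic_on cball s 1"
      by (intro holomorphic_intros holomorphic_on_subset[OF F_holo sub])
    have "norm ((deriv ^^ 1) (\<lambda>s. F s - 1) s) \<le> fact 1 * (2 * c) / 1 ^ 1"
    proof (rule Cauchy_inequality)
      show "(\<lambda>s. F s - 1) holomorphic_on ball s 1" using hF1 by (rule holomorphic_on_subset) auto
      show "continuous_on (cball s 1) (\<lambda>s. F s - 1)" using hF1 by (rule holomorphic_on_imp_continuous_on)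
      fix z assume z: "norm (s - z) = 1"
      have "\<bar>Re (s - z)\<bar> \<le> 1" using abs_Re_le_cmod[of "s - z"] z by simp
      hence rz: "Re z \<ge> Re s - 1" "Re z \<ge> 2" using s by auto
      have "2 powr (- Re z) \<le> 2 powr (1 + - Re s)" using rz by (intro powr_mono) auto
      also have "\<dots> = 2 * 2 powr (- Re s)" by (subst powr_add) simp
      finally have "C1 * 2 powr (- Re z) \<le> C1 * (2 * 2 powr (- Re s))" using C1 by (intro mult_left_mono) auto
      thus "norm (F z - 1) \<le> 2 * c" using C1(2)[OF rz(2)] by (simp add: c_def)
    qed auto
    moreover have "deriv (\<lambda>s. F s - 1) s = deriv F s"
      using holomorphic_on_imp_differentiable_at[OF F_holo open_halfspace_Re_gt, of s] s by (subst deriv_diff) auto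
    ultimately have dF: "norm (deriv F s) \<le> 2 * c" by simp
    have "norm (deriv F s / F s) \<le> (2 * c) / (1 / 2)"
      unfolding norm_divide using dF F2 c by (intro frac_le) auto
    also have "\<dots> \<le> e" using c e' by simp
    finally show ?thesis using F2 by auto
  qed
  thus ?thesis by (intro exI[of _ "max 3 x0"]) auto
qed

lemma gm_deriv:
  assumes "Re s > 0"
  shows "(gm has_field_derivative gm s * (of_real (ln Q) + (\<Sum>j=1..r. of_real (lam j) * Digamma (of_real (lam j) * s + mu j)))) (at s)"
proof -
  have np: "of_real (lam j) * s + mu j \<notin> \<int>\<^sub>\<le>\<^sub>0" if "j \<in> {1..r}" for j
  proof -
    have "lam j * Re s > 0" "Re (mu j) \<ge> 0" using assms params that by auto
    hence "Re (of_real (lam j) * s + mu j) > 0" by simp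
    moreover have "Re z \<le> 0" if "z \<in> \<int>\<^sub>\<le>\<^sub>0" for z :: complex using that by (auto elim!: nonpos_Ints_cases)
    ultimately show ?thesis using not_le by blast
  qed
  have 1: "((\<lambda>z. \<Prod>j=1..r. Gamma (of_real (lam j) * z + mu j)) has_field_derivative
     (\<Prod>j=1..r. Gamma (of_real (lam j) * s + mu j)) * (\<Sum>j=1..r. of_real (lam j) * Digamma (of_real (lam j) * s + mu j))) (at s)"
  proof (rule has_field_derivative_prod_logderiv)
    fix j assume j: "j \<in> {1..r}"
    show "((\<lambda>z. Gamma (of_real (lam j) * z + mu j)) has_field_derivative
        Gamma (of_real (lam j) * s + mu j) * (of_real (lam j) * Digamma (of_real (lam j) * s + mu j))) (at s)"
      using np[OF j] by (auto intro!: derivative_eq_intros)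
  qed auto
  have 2: "((\<lambda>z. of_real Q powr z) has_field_derivative of_real Q powr s * of_real (ln Q)) (at s)"
  proof -
    have "Ln (of_real Q) = of_real (ln Q)" using params(1) by (simp add: Ln_of_real)
    thus ?thesis using params(1) by (auto intro!: derivative_eq_intros)
  qed
  show ?thesis
    unfolding gamma_factor_def [abs_def]
    by (rule DERIV_cong[OF DERIV_mult[OF 2 1]]) (simp add: algebra_simps)
qed

lemma X_logderiv:
  assumes s: "Re s > 1" "F s \<noteq> 0"
  shows "deriv X s / X s = of_nat pm / s + of_nat pm / (s - 1) +
     (of_real (ln Q) + (\<Sum>j=1..r. of_real (lam j) * Digamma (of_real (lam j) * s + mu j))) + deriv F s / F s"
proof -
  have s0: "s \<noteq> 0" "s \<noteq> 1" "s - 1 \<noteq> 0" "Re s > 0" using s by auto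
  define D where "D = of_real (ln Q) + (\<Sum>j=1..r. of_real (lam j) * Digamma (of_real (lam j) * s + mu j))"
  define g where "g = (\<lambda>i::nat. if i = 0 then (\<lambda>z::complex. z ^ pm) else if i = 1 then (\<lambda>z. (z - 1) ^ pm) else if i = 2 then gm else F)"
  define d where "d = (\<lambda>i::nat. if i = 0 then of_nat pm / s else if i = 1 then of_nat pm / (s - 1) else if i = 2 then D else deriv F s / F s)"
  have pw: "((\<lambda>z. (z - a) ^ pm) has_field_derivative (s - a) ^ pm * (of_nat pm / (s - a))) (at s)" if "s \<noteq> a" for a
    using has_field_derivative_prod_power[of "{()}" s "\<lambda>_. a" "\<lambda>_. pm"] that by simp
  have "((\<lambda>z. \<Prod>i\<in>{0,1,2,3}. g i z) has_field_derivative (\<Prod>i\<in>{0,1,2,3}. g i s) * (\<Sum>i\<in>{0,1,2,3}. d i)) (at s)"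
  proof (rule has_field_derivative_prod_logderiv)
    fix j :: nat assume "j \<in> {0,1,2,3}"
    moreover have "(F has_field_derivative F s * (deriv F s / F s)) (at s)"
      using holomorphic_derivI[OF F_holo open_halfspace_Re_gt, of s] s by simp
    ultimately show "(g j has_field_derivative g j s * d j) (at s)"
      using pw[of 0] pw[of 1] s0 gm_deriv[OF s0(4)] by (auto simp: g_def d_def D_def)
  qed auto
  moreover have "((\<lambda>z. \<Prod>i\<in>{0,1,2,3}. g i z) has_field_derivative D') (at s) \<longleftrightarrow> (X has_field_derivative D') (at s)" for D'
  proof (rule DERIV_cong_ev[OF refl _ refl])
    have "eventually (\<lambda>z. z \<in> {z. Re z > 1}) (nhds s)" by (rule eventually_nhds_in_open) (use s open_halfspace_Re_gt in auto)
    thus "eventually (\<lambda>z. (\<Prod>i\<in>{0,1,2,3}. g i z) = X z) (nhds s)"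
    proof eventually_elim
      case (elim z)
      hence "z \<noteq> 1" by auto
      thus ?case using X_eq[of z] G(2)[of z] elim by (simp add: g_def mult_ac)
    qed
  qed
  ultimately have "deriv X s = (\<Prod>i\<in>{0,1,2,3}. g i s) * (\<Sum>i\<in>{0,1,2,3}. d i)" using DERIV_imp_deriv by blast
  moreover have "X s = (\<Prod>i\<in>{0,1,2,3}. g i s)" using X_eq[OF s0(4)] G(2)[OF s0(2)] by (simp add: g_def mult_ac)
  moreover have "X s \<noteq> 0" using X_eq[OF s0(4)] G(2)[OF s0(2)] s0 s gm_nz[OF s0(4)] by simp
  ultimately have "deriv X s / X s = (\<Sum>i\<in>{0,1,2,3}. d i)" by simp
  thus ?thesis by (simp add: d_def D_def add_ac)
qed

text \<open>Far to the right \<open>F' / F\<close> is small and the polar terms have nonnegative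
  real part, so the gamma factor decides: Digamma grows without bound when \<open>r \<ge> 1\<close>,
  and otherwise \<open>ln Q\<close> is positive. This is the origin of the constant \<open>A\<close>
  in \<open>near_real_rooted\<close>.\<close>

lemma Re_X_logderiv_ge:
  assumes "r \<ge> 1 \<or> Q > 1"
  obtains A x0 where "A > 0" "\<And>s. Re s \<ge> x0 \<Longrightarrow> A \<le> Re (deriv X s / X s)"
proof -
  define S where "S = (\<lambda>s. ln Q + (\<Sum>j=1..r. lam j * Re (Digamma (of_real (lam j) * s + mu j))))"
  have "\<exists>b>0. \<exists>x1>0. \<forall>s. Re s \<ge> x1 \<longrightarrow> b \<le> S s"
  proof (cases "r \<ge> 1")
    case False
    thus ?thesis using assms by (intro exI[of _ "ln Q"] exI[of _ 1] conjI) (auto simp: S_def)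
  next
    case True
    \<comment> \<open>Each Gamma factor is made to contribute at least \<open>B\<close>, so a single
      one outweighs a negative \<open>ln Q\<close> and leaves 1.\<close>
    define B where "B = \<bar>ln Q\<bar> + 1"
    have "\<exists>y>0. \<forall>x\<ge>y. B / lam j \<le> Digamma x" for j by (rule Digamma_real_unbounded)
    then obtain y where y: "\<And>j. y j > 0" "\<And>j x. x \<ge> y j \<Longrightarrow> B / lam j \<le> Digamma x" by metis
    define x1 where "x1 = 1 + (\<Sum>j=1..r. y j / lam j)"
    have x1: "x1 > 0" unfolding x1_def using y(1) params(2)
      by (intro add_pos_nonneg sum_nonneg) (auto intro: less_imp_le)
    have "1 \<le> S s" if s: "Re s \<ge> x1" for s
    proof -
      have "B \<le> lam j * Re (Digamma (of_real (lam j) * s + mu j))" if j: "j \<in> {1..r}" for j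
      proof -
        have l: "lam j > 0" "Re (mu j) \<ge> 0" using params j by auto
        have "y j / lam j \<le> (\<Sum>j=1..r. y j / lam j)"
          by (rule member_le_sum[OF j]) (use y(1) params(2) in \<open>auto intro: less_imp_le\<close>)
        hence "y j / lam j \<le> Re s" using s by (simp add: x1_def)
        hence "y j \<le> lam j * Re s" using l by (simp add: pos_divide_le_eq mult.commute)
        hence z: "y j \<le> Re (of_real (lam j) * s + mu j)" using l by simp
        hence "Re (of_real (lam j) * s + mu j) > 0" using y(1)[of j] by linarith
        from Re_Digamma_ge[OF this] have "B / lam j \<le> Re (Digamma (of_real (lam j) * s + mu j))"
          using y(2)[OF z] by linarith
        thus ?thesis using l by (simp add: pos_divide_le_eq mult.commute)
      qed
      hence "(\<Sum>j=1..r. B) \<le> (\<Sum>j=1..r. lam j * Re (Digamma (of_real (lam j) * s + mu j)))" by (intro sum_mono)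
      moreover have "B * 1 \<le> B * real r" using True by (intro mult_left_mono) (auto simp: B_def)
      ultimately show "1 \<le> S s" by (simp add: S_def B_def mult.commute abs_le_iff split: abs_split)
    qed
    thus ?thesis using x1 by (intro exI[of _ 1]) auto
  qed
  then obtain b x1 where b: "b > 0" "x1 > 0" "\<And>s. Re s \<ge> x1 \<Longrightarrow> b \<le> S s" by blast
  hence b2: "b / 2 > 0" by simp
  obtain x2 where x2: "x2 \<ge> 3" "\<And>s. Re s \<ge> x2 \<Longrightarrow> F s \<noteq> 0 \<and> norm (deriv F s / F s) \<le> b / 2"
    using F_logderiv_small[OF b2] by blast
  have "b / 2 \<le> Re (deriv X s / X s)" if s: "Re s \<ge> max x1 x2" for s
  proof -
    have s1: "Re s > 1" "F s \<noteq> 0" "Re s \<ge> x1" "Re s \<ge> x2" using s x2 by auto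
    have "- Re (deriv F s / F s) \<le> b / 2" using abs_Re_le_cmod[of "deriv F s / F s"] x2(2)[OF s1(4)] by linarith
    moreover have "Re (of_nat pm / s) \<ge> 0" "Re (of_nat pm / (s - 1)) \<ge> 0" using s1 by (auto simp: Re_divide)
    moreover have "Re (deriv X s / X s) = Re (of_nat pm / s) + Re (of_nat pm / (s - 1)) + S s + Re (deriv F s / F s)"
      unfolding X_logderiv[OF s1(1,2)] by (simp add: S_def)
    ultimately show ?thesis using b(3)[OF s1(3)] by linarith
  qed
  thus ?thesis using that b2 by blast
qed

end

section \<open>Rotation to the critical line\<close>

locale selberg_RH = selberg_data +
  fixes \<theta> :: "real \<Rightarrow> real"
  assumes RH: "Riemann_Hypothesis r Q lam mu F" and phase: "Hardy_phase r Q lam mu \<omega> \<theta>"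
begin

text \<open>The inverse of a square root of \<open>\<omega>\<close>, as
  \<open>norm \<omega> = 1\<close>. The other root would only change the sign of
  \<open>Xi\<close>.\<close>

definition \<kappa> :: complex where "\<kappa> = cnj (csqrt \<omega>)"

lemma \<kappa>: "\<kappa>\<^sup>2 * \<omega> = 1" "\<kappa> * \<omega> = cnj \<kappa>" "\<kappa> \<noteq> 0"
proof -
  have "norm (csqrt \<omega>) = 1" using params(4) by simp
  hence 1: "csqrt \<omega> * cnj (csqrt \<omega>) = 1" by (simp add: complex_norm_square[symmetric])
  have 2: "\<omega> = csqrt \<omega> * csqrt \<omega>" using power2_csqrt[of \<omega>] by (simp add: power2_eq_square)
  have 3: "\<kappa> * csqrt \<omega> = 1" using 1 by (simp add: \<kappa>_def mult.commute)
  have "\<kappa> * \<omega> = \<kappa> * (csqrt \<omega> * csqrt \<omega>)" by (rule arg_cong[OF 2])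
  also have "\<dots> = (\<kappa> * csqrt \<omega>) * csqrt \<omega>" by (simp only: mult.assoc)
  also have "\<dots> = cnj \<kappa>" unfolding 3 by (simp add: \<kappa>_def)
  finally show 4: "\<kappa> * \<omega> = cnj \<kappa>" .
  have "\<kappa>\<^sup>2 * \<omega> = \<kappa> * (\<kappa> * \<omega>)" by (simp add: power2_eq_square)
  also have "\<dots> = 1" unfolding 4 using 3 by (simp add: \<kappa>_def)
  finally show "\<kappa>\<^sup>2 * \<omega> = 1" .
  show "\<kappa> \<noteq> 0" using 3 by auto
qed

text \<open>The square root of the root number makes the completed function real on the critical line.\<close>

definition Xi :: "complex \<Rightarrow> complex" where "Xi = (\<lambda>w. \<kappa> * X (1 / 2 + \<i> * w))"

lemma Xi_deriv: "(Xi has_field_derivative \<kappa> * (deriv X (1 / 2 + \<i> * w) * \<i>)) (at w)"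
proof -
  have "(X has_field_derivative deriv X (1 / 2 + \<i> * w)) (at (1 / 2 + \<i> * w))"
    by (rule holomorphic_derivI[OF X_holo open_UNIV]) simp
  moreover have "((\<lambda>w. 1 / 2 + \<i> * w) has_field_derivative \<i>) (at w)" by (auto intro!: derivative_eq_intros)
  ultimately have "((\<lambda>w. X (1 / 2 + \<i> * w)) has_field_derivative deriv X (1 / 2 + \<i> * w) * \<i>) (at w)" by (rule DERIV_chain2)
  thus ?thesis unfolding Xi_def by (rule DERIV_cmult)
qed

lemma Xi_holo: "Xi holomorphic_on A"
  unfolding holomorphic_on_def field_differentiable_def using Xi_deriv has_field_derivative_at_within by blast

lemma Xi_cnj: "Xi (cnj w) = cnj (Xi w)"
proof -
  have e: "1 - cnj (1 / 2 + \<i> * cnj w) = 1 / 2 + \<i> * w" by (simp add: complex_eq_iff)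
  have "Xi (cnj w) = (\<kappa> * \<omega>) * cnj (X (1 / 2 + \<i> * w))"
    using X_fe[of "1 / 2 + \<i> * cnj w"] unfolding e by (simp add: Xi_def mult.assoc)
  thus ?thesis unfolding \<kappa>(2) by (simp add: Xi_def)
qed

lemma Xi_zeros: "Xi w = 0 \<Longrightarrow> Im w = 0"
proof -
  assume "Xi w = 0"
  hence "X (1 / 2 + \<i> * w) = 0" using \<kappa>(3) by (simp add: Xi_def)
  hence "Re (1 / 2 + \<i> * w) = 1 / 2" using RH by (auto simp: Riemann_Hypothesis_def)
  thus "Im w = 0" by simp
qed

lemma Xi_growth:
  assumes "e > 0"
  shows "\<exists>C. \<forall>z. norm (Xi z) \<le> C * exp (e * (norm z)\<^sup>2)"
proof -
  have e2: "e / 2 > 0" using assms by simp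
  obtain C where C': "C > 0" "\<And>s. s \<in> UNIV \<Longrightarrow> norm (X s) \<le> C * exp (e / 2 * (norm s)\<^sup>2)"
    by (rule subgaussian_onD[OF X_subgaussian e2]) blast
  have "norm (Xi z) \<le> (norm \<kappa> * C * exp e) * exp (e * (norm z)\<^sup>2)" for z
  proof -
    define s where "s = 1 / 2 + \<i> * z"
    have "norm s \<le> 1 + norm z" using norm_triangle_ineq[of "1 / 2" "\<i> * z"] by (simp add: s_def norm_mult)
    hence "(norm s)\<^sup>2 \<le> (1 + norm z)\<^sup>2" by (intro power_mono) auto
    also have "\<dots> \<le> 2 + 2 * (norm z)\<^sup>2" using sum_squares_bound[of 1 "norm z"] by (simp add: power2_sum)
    finally have "e / 2 * (norm s)\<^sup>2 \<le> e / 2 * (2 + 2 * (norm z)\<^sup>2)" using assms by (intro mult_left_mono) auto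
    also have "\<dots> = e + e * (norm z)\<^sup>2" by (simp add: algebra_simps)
    finally have "exp (e / 2 * (norm s)\<^sup>2) \<le> exp e * exp (e * (norm z)\<^sup>2)" by (simp flip: exp_add)
    hence "C * exp (e / 2 * (norm s)\<^sup>2) \<le> C * (exp e * exp (e * (norm z)\<^sup>2))" using C' by (intro mult_left_mono) auto
    hence "norm (X s) \<le> C * (exp e * exp (e * (norm z)\<^sup>2))" using C'(2)[of s, OF UNIV_I] by linarith
    hence "norm \<kappa> * norm (X s) \<le> norm \<kappa> * (C * (exp e * exp (e * (norm z)\<^sup>2)))" by (intro mult_left_mono) auto
    thus ?thesis by (simp add: Xi_def s_def norm_mult mult.assoc)
  qed
  thus ?thesis by blast
qed

lemma Xi_has_sum:
  assumes "y \<noteq> 0"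
  shows "((\<lambda>x. real (zmult Xi (of_real x)) / ((t - x)\<^sup>2 + y\<^sup>2)) has_sum
     (- Im (deriv Xi (Complex t y) / Xi (Complex t y)) / y)) UNIV"
  using real_rooted_Im_logderiv[OF Xi_holo Xi_cnj Xi_zeros Xi_growth, of "Complex t y"] assms by simp

lemma Xi_zsum: "y \<noteq> 0 \<Longrightarrow> zsum Xi t y = - Im (deriv Xi (Complex t y) / Xi (Complex t y)) / y"
  unfolding zsum_def by (rule infsumI[OF Xi_has_sum])

text \<open>The point \<open>w = t - \<i> * |t|\<close> corresponds to
  \<open>s = 1 / 2 + |t| + \<i> * t\<close>, far to the right, where
  \<open>Im (Xi' / Xi) = Re (X' / X)\<close> is at least \<open>A\<close>. Division by the height
  \<open>|t|\<close> gives the bound, since the kernel sum is even in \<open>y\<close>.\<close>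

lemma Xi_zsum_ge:
  assumes "r \<ge> 1 \<or> Q > 1"
  obtains A T where "A > 0" "T \<ge> 1" "\<And>t. \<bar>t\<bar> \<ge> T \<Longrightarrow> A / \<bar>t\<bar> \<le> zsum Xi t \<bar>t\<bar>"
proof -
  obtain A x0 where A: "A > 0" "\<And>s. Re s \<ge> x0 \<Longrightarrow> A \<le> Re (deriv X s / X s)" using Re_X_logderiv_ge[OF assms] by blast
  have "A / \<bar>t\<bar> \<le> zsum Xi t \<bar>t\<bar>" if t: "\<bar>t\<bar> \<ge> max 1 x0" for t
  proof -
    have t0: "\<bar>t\<bar> > 0" using t by linarith
    define w where "w = Complex t (- \<bar>t\<bar>)"
    define s where "s = 1 / 2 + \<i> * w"
    have "Re s \<ge> x0" using t by (simp add: s_def w_def)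
    hence 1: "A \<le> Re (deriv X s / X s)" by (rule A(2))
    have "deriv Xi w = \<kappa> * (deriv X s * \<i>)" unfolding s_def by (rule DERIV_imp_deriv[OF Xi_deriv])
    hence "deriv Xi w / Xi w = \<i> * (deriv X s / X s)" using \<kappa>(3) by (simp add: Xi_def s_def)
    hence "Im (deriv Xi w / Xi w) = Re (deriv X s / X s)" by (simp only: Im_i_times)
    moreover have "zsum Xi t (- \<bar>t\<bar>) = Im (deriv Xi w / Xi w) / \<bar>t\<bar>"
      unfolding w_def using Xi_zsum[of "- \<bar>t\<bar>" t] t0 by simp
    moreover have "zsum Xi t (- \<bar>t\<bar>) = zsum Xi t \<bar>t\<bar>" by (simp add: zsum_def)
    ultimately have "zsum Xi t \<bar>t\<bar> = Re (deriv X s / X s) / \<bar>t\<bar>" by simp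
    thus ?thesis using 1 t0 by (simp add: divide_right_mono)
  qed
  thus ?thesis using that[of A "max 1 x0"] A(1) by simp
qed

section \<open>A holomorphic amplitude in place of the gamma factor\<close>

definition M :: real where "M = (\<Sum>j=1..r. \<bar>Im (mu j)\<bar> / lam j)"
text \<open>Small enough for two purposes: the arguments \<open>a j w\<close> and
  \<open>b j w\<close> avoid the cut of \<open>ln_Gamma\<close> on \<open>bowtie \<delta>\<close>,
  and the zeros \<open>\<i> / 2\<close> and \<open>- \<i> / 2\<close> of \<open>1 / 4 + w^2\<close>
  lie outside it. The share \<open>4 * M\<close> pays for the imaginary parts of the
  \<open>mu j\<close>.\<close>

definition \<delta> :: real where "\<delta> = 1 / (8 + 4 * M)"
text \<open>Beyond \<open>T0\<close> the parameter \<open>u = lam j * |Re w| / 4\<close> of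
  \<open>trigamma_approx\<close> is at least 2, and \<open>|Im (mu j)|\<close> is at most half of
  \<open>lam j * |Re w|\<close>.\<close>

definition T0 :: real where "T0 = 1 + 2 * M + (\<Sum>j=1..r. 8 / lam j)"

lemma M: "M \<ge> 0" "\<And>j. j \<in> {1..r} \<Longrightarrow> \<bar>Im (mu j)\<bar> \<le> lam j * M"
proof -
  have l: "lam j > 0" if "j \<in> {1..r}" for j using params that by auto
  show "M \<ge> 0" unfolding M_def using l by (intro sum_nonneg divide_nonneg_nonneg) (auto intro: less_imp_le)
  fix j assume j: "j \<in> {1..r}"
  have "\<bar>Im (mu j)\<bar> / lam j \<le> M" unfolding M_def
    by (rule member_le_sum[OF j]) (use l in \<open>auto intro!: divide_nonneg_nonneg intro: less_imp_le\<close>)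
  thus "\<bar>Im (mu j)\<bar> \<le> lam j * M" using l[OF j] by (simp add: pos_divide_le_eq mult.commute)
qed

lemma \<delta>: "\<delta> > 0" "\<delta> \<le> 1 / 8"
  using M(1) by (auto simp: \<delta>_def divide_simps)

lemma T0: "T0 \<ge> 1" "2 * M \<le> T0" "\<And>j. j \<in> {1..r} \<Longrightarrow> 8 / lam j \<le> T0"
proof -
  have l: "8 / lam j \<ge> 0" if "j \<in> {1..r}" for j using params(2)[OF that] by simp
  have n: "0 \<le> (\<Sum>j=1..r. 8 / lam j)" using l by (intro sum_nonneg) auto
  show "T0 \<ge> 1" "2 * M \<le> T0" using M(1) n by (auto simp: T0_def)
  fix j assume j: "j \<in> {1..r}"
  have "8 / lam j \<le> (\<Sum>j=1..r. 8 / lam j)" by (rule member_le_sum[OF j]) (use l in auto)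
  thus "8 / lam j \<le> T0" using M(1) by (simp add: T0_def)
qed

text \<open>The argument of a Gamma factor at \<open>s = 1 / 2 + \<i> * w\<close>. Taking complex
  conjugates would destroy holomorphy, so \<open>b j\<close> is its Schwarz reflection, which equals
  the conjugate of \<open>a j\<close> on the real axis.\<close>

definition a :: "nat \<Rightarrow> complex \<Rightarrow> complex" where
  "a j w = of_real (lam j) * (1 / 2 + \<i> * w) + mu j"
definition b :: "nat \<Rightarrow> complex \<Rightarrow> complex" where
  "b j w = of_real (lam j) * (1 / 2 - \<i> * w) + cnj (mu j)"

lemma b_eq: "b j w = cnj (a j (cnj w))"
  by (simp add: a_def b_def)

text \<open>A nonpositive real value needs \<open>Im w \<ge> 1 / 2\<close>, which within the cone
  forces \<open>|Re w| > M\<close>; but a vanishing imaginary part means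
  \<open>lam j * |Re w| = |Im (mu j)| \<le> lam j * M\<close>.\<close>

lemma a_not_nonpos:
  assumes j: "j \<in> {1..r}" and w: "w \<in> bowtie \<delta>"
  shows "a j w \<notin> \<real>\<^sub>\<le>\<^sub>0"
proof
  assume "a j w \<in> \<real>\<^sub>\<le>\<^sub>0"
  hence z: "Re (a j w) \<le> 0" "Im (a j w) = 0" by (auto simp: complex_nonpos_Reals_iff)
  have l: "lam j > 0" "Re (mu j) \<ge> 0" using params j by auto
  have "lam j * (1 / 2 - Im w) \<le> 0" using z(1) l by (simp add: a_def)
  hence "Im w \<ge> 1 / 2" using l by (simp add: mult_le_0_iff)
  hence "1 / 2 < \<delta> * (1 + \<bar>Re w\<bar>)" using w by (simp add: bowtie_def)
  hence "(8 + 4 * M) / 2 < 1 + \<bar>Re w\<bar>" using M(1) by (simp add: \<delta>_def field_simps)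
  hence "4 + 2 * M < 1 + \<bar>Re w\<bar>" by (simp add: add_divide_distrib)
  moreover have "M \<ge> 0" by (rule M(1))
  ultimately have "M < \<bar>Re w\<bar>" by simp
  hence "lam j * M < lam j * \<bar>Re w\<bar>" using l by simp
  moreover have "lam j * \<bar>Re w\<bar> = \<bar>Im (mu j)\<bar>"
  proof -
    have "lam j * Re w = - Im (mu j)" using z(2) by (simp add: a_def)
    hence "\<bar>lam j * Re w\<bar> = \<bar>Im (mu j)\<bar>" by simp
    thus ?thesis using l by (simp add: abs_mult)
  qed
  ultimately show False using M(2)[OF j] by simp
qed

lemma b_not_nonpos:
  assumes j: "j \<in> {1..r}" and w: "w \<in> bowtie \<delta>"
  shows "b j w \<notin> \<real>\<^sub>\<le>\<^sub>0"
  using a_not_nonpos[OF j, of "cnj w"] w unfolding b_eq complex_nonpos_Reals_iff by simp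

text \<open>Two lower bounds are averaged: the imaginary part gives
  \<open>lam j * |Re w| / 2\<close> for every \<open>n\<close>, and the real part is at least
  \<open>n - lam j * |Re w| / 4\<close> since the cone is narrow.\<close>

lemma a_lower:
  assumes j: "j \<in> {1..r}" and w: "w \<in> bowtie \<delta>" "\<bar>Re w\<bar> \<ge> T0"
  shows "(lam j * \<bar>Re w\<bar> / 4 + real n) / 2 \<le> norm (a j w + of_nat n)"
proof -
  have l: "lam j > 0" "Re (mu j) \<ge> 0" using params j by auto
  have "\<bar>Im (mu j)\<bar> \<le> lam j * (\<bar>Re w\<bar> / 2)" using M(2)[OF j] T0(2) w(2) l
    by (smt (verit) mult_left_mono field_sum_of_halves)
  moreover have "Im (a j w + of_nat n) = lam j * Re w + Im (mu j)" by (simp add: a_def)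
  moreover have "\<bar>lam j * Re w\<bar> = lam j * \<bar>Re w\<bar>" using l by (simp add: abs_mult)
  moreover have "\<bar>lam j * Re w\<bar> - \<bar>Im (mu j)\<bar> \<le> \<bar>lam j * Re w + Im (mu j)\<bar>" by linarith
  ultimately have 1: "lam j * \<bar>Re w\<bar> / 2 \<le> \<bar>Im (a j w + of_nat n)\<bar>" by simp
  have "\<delta> * (1 + \<bar>Re w\<bar>) \<le> 1 / 8 * (2 * \<bar>Re w\<bar>)" using \<delta> w(2) T0(1) by (intro mult_mono) auto
  hence "Im w \<le> \<bar>Re w\<bar> / 4" using w(1) by (simp add: bowtie_def)
  hence "lam j * Im w \<le> lam j * (\<bar>Re w\<bar> / 4)" using l by (intro mult_left_mono) auto
  moreover have "Re (a j w + of_nat n) = lam j / 2 - lam j * Im w + Re (mu j) + real n" by (simp add: a_def algebra_simps)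
  ultimately have 2: "- (lam j * \<bar>Re w\<bar> / 4) + real n \<le> Re (a j w + of_nat n)" using l by linarith
  have arith: "(v / 4 + k) / 2 \<le> N" if "v / 2 \<le> N" "- (v / 4) + k \<le> N" for v k N :: real
    using that by (simp add: field_simps)
  show ?thesis
    by (rule arith[OF order_trans[OF 1 abs_Im_le_cmod] order_trans[OF 2 complex_Re_le_cmod]])
qed

lemma b_lower:
  assumes j: "j \<in> {1..r}" and w: "w \<in> bowtie \<delta>" "\<bar>Re w\<bar> \<ge> T0"
  shows "(lam j * \<bar>Re w\<bar> / 4 + real n) / 2 \<le> norm (b j w + of_nat n)"
proof -
  have "b j w + of_nat n = cnj (a j (cnj w) + of_nat n)" by (simp add: b_eq)
  thus ?thesis using a_lower[OF j, of "cnj w" n] w by (simp only: complex_mod_cnj) simp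
qed

text \<open>Extends \<open>ln |gm (1 / 2 + \<i> * t)|\<close> from real \<open>t\<close>, up to the
  choice of a branch: half the logarithm of \<open>gm\<close> times its reflection, a product in
  which the powers of \<open>Q\<close> reduce to \<open>Q\<close> itself.\<close>

definition L :: "complex \<Rightarrow> complex" where
  "L w = of_real (ln Q) / 2 + (\<Sum>j=1..r. ln_Gamma (a j w) + ln_Gamma (b j w)) / 2"

text \<open>Minus the logarithmic derivative of \<open>amplitude\<close>: the derivative of
  \<open>L\<close> plus the contribution of \<open>(1 / 4 + w^2) ^ pm\<close>.\<close>

definition E :: "complex \<Rightarrow> complex" where
  "E w = (\<Sum>j=1..r. \<i> * of_real (lam j) * (Digamma (a j w) - Digamma (b j w))) / 2 +
     of_nat pm * (1 / (w - \<i> / 2) + 1 / (w + \<i> / 2))"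

definition dE :: "complex \<Rightarrow> complex" where
  "dE w = - (\<Sum>j=1..r. (of_real (lam j))\<^sup>2 * (Polygamma 1 (a j w) + Polygamma 1 (b j w))) / 2 -
     of_nat pm * (1 / (w - \<i> / 2)\<^sup>2 + 1 / (w + \<i> / 2)\<^sup>2)"

lemma half_i_not_in_bowtie:
  assumes "w \<in> bowtie \<delta>"
  shows "w - \<i> / 2 \<noteq> 0" "w + \<i> / 2 \<noteq> 0" "1 / 4 + w\<^sup>2 \<noteq> 0"
proof -
  have 1: "w - \<i> / 2 \<noteq> 0"
  proof
    assume "w - \<i> / 2 = 0"
    hence "w = \<i> / 2" by simp
    hence "Re w = Re (\<i> / 2)" "Im w = Im (\<i> / 2)" by (rule arg_cong)+
    hence "Re w = 0" "Im w = 1 / 2" by simp_all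
    thus False using assms \<delta> by (simp add: bowtie_def)
  qed
  have 2: "w + \<i> / 2 \<noteq> 0"
  proof
    assume "w + \<i> / 2 = 0"
    hence "w = - (\<i> / 2)" by (simp add: eq_neg_iff_add_eq_0)
    hence "Re w = Re (- (\<i> / 2))" "Im w = Im (- (\<i> / 2))" by (rule arg_cong)+
    hence "Re w = 0" "Im w = - 1 / 2" by simp_all
    thus False using assms \<delta> by (simp add: bowtie_def)
  qed
  have "1 / 4 + w\<^sup>2 = (w - \<i> / 2) * (w + \<i> / 2)" by (simp add: power2_eq_square algebra_simps)
  thus "w - \<i> / 2 \<noteq> 0" "w + \<i> / 2 \<noteq> 0" "1 / 4 + w\<^sup>2 \<noteq> 0" using 1 2 by simp_all
qed

lemma nonpos_Ints_subset: "z \<notin> \<real>\<^sub>\<le>\<^sub>0 \<Longrightarrow> z \<notin> \<int>\<^sub>\<le>\<^sub>0" for z :: complex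
  using nonpos_Ints_subset_nonpos_Reals by blast

lemma a_b_deriv: "(a j has_field_derivative \<i> * of_real (lam j)) (at w)" "(b j has_field_derivative - (\<i> * of_real (lam j))) (at w)"
  unfolding a_def [abs_def] b_def [abs_def] by (auto intro!: derivative_eq_intros)

lemma L_deriv:
  assumes w: "w \<in> bowtie \<delta>"
  shows "(L has_field_derivative (\<Sum>j=1..r. \<i> * of_real (lam j) * (Digamma (a j w) - Digamma (b j w))) / 2) (at w)"
proof -
  have "((\<lambda>w. ln_Gamma (a j w) + ln_Gamma (b j w)) has_field_derivative
      \<i> * of_real (lam j) * (Digamma (a j w) - Digamma (b j w))) (at w)" if j: "j \<in> {1..r}" for j
  proof -
    have "((\<lambda>w. ln_Gamma (a j w)) has_field_derivative Digamma (a j w) * (\<i> * of_real (lam j))) (at w)"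
      by (rule DERIV_chain2[OF has_field_derivative_ln_Gamma_complex[OF a_not_nonpos[OF j w]] a_b_deriv(1)])
    moreover have "((\<lambda>w. ln_Gamma (b j w)) has_field_derivative Digamma (b j w) * (- (\<i> * of_real (lam j)))) (at w)"
      by (rule DERIV_chain2[OF has_field_derivative_ln_Gamma_complex[OF b_not_nonpos[OF j w]] a_b_deriv(2)])
    ultimately show ?thesis by (rule DERIV_cong[OF DERIV_add]) (simp add: algebra_simps)
  qed
  hence "((\<lambda>w. \<Sum>j=1..r. ln_Gamma (a j w) + ln_Gamma (b j w)) has_field_derivative
      (\<Sum>j=1..r. \<i> * of_real (lam j) * (Digamma (a j w) - Digamma (b j w)))) (at w)" by (intro DERIV_sum)
  hence "((\<lambda>w. of_real (ln Q) / 2 + (\<Sum>j=1..r. ln_Gamma (a j w) + ln_Gamma (b j w)) / 2) has_field_derivative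
      (0 + (\<Sum>j=1..r. \<i> * of_real (lam j) * (Digamma (a j w) - Digamma (b j w))) / 2)) (at w)"
    by (intro DERIV_add DERIV_const DERIV_cdivide)
  thus ?thesis by (simp add: L_def [abs_def])
qed

lemma E_deriv:
  assumes w: "w \<in> bowtie \<delta>"
  shows "(E has_field_derivative dE w) (at w)"
proof -
  have 1: "((\<lambda>w. \<i> * of_real (lam j) * (Digamma (a j w) - Digamma (b j w))) has_field_derivative
      - ((of_real (lam j))\<^sup>2 * (Polygamma 1 (a j w) + Polygamma 1 (b j w)))) (at w)" if j: "j \<in> {1..r}" for j
  proof -
    have "((\<lambda>w. Digamma (a j w)) has_field_derivative Polygamma (Suc 0) (a j w) * (\<i> * of_real (lam j))) (at w)"
      by (rule DERIV_chain2[OF has_field_derivative_Polygamma[OF nonpos_Ints_subset[OF a_not_nonpos[OF j w]]] a_b_deriv(1)])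
    moreover have "((\<lambda>w. Digamma (b j w)) has_field_derivative Polygamma (Suc 0) (b j w) * (- (\<i> * of_real (lam j)))) (at w)"
      by (rule DERIV_chain2[OF has_field_derivative_Polygamma[OF nonpos_Ints_subset[OF b_not_nonpos[OF j w]]] a_b_deriv(2)])
    ultimately have "((\<lambda>w. \<i> * of_real (lam j) * (Digamma (a j w) - Digamma (b j w))) has_field_derivative
      \<i> * of_real (lam j) * (Polygamma (Suc 0) (a j w) * (\<i> * of_real (lam j)) - Polygamma (Suc 0) (b j w) * (- (\<i> * of_real (lam j))))) (at w)"
      by (intro DERIV_cmult DERIV_diff)
    thus ?thesis by (rule DERIV_cong) (simp add: algebra_simps power2_eq_square)
  qed
  have "((\<lambda>w. \<Sum>j=1..r. \<i> * of_real (lam j) * (Digamma (a j w) - Digamma (b j w))) has_field_derivative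
      (\<Sum>j=1..r. - ((of_real (lam j))\<^sup>2 * (Polygamma 1 (a j w) + Polygamma 1 (b j w))))) (at w)"
    by (intro DERIV_sum 1)
  moreover have "((\<lambda>w. 1 / (w - c)) has_field_derivative - (1 / (w - c)\<^sup>2)) (at w)" if "w - c \<noteq> 0" for c
    using that by (auto intro!: derivative_eq_intros simp: power2_eq_square)
  ultimately have "(E has_field_derivative (\<Sum>j=1..r. - ((of_real (lam j))\<^sup>2 * (Polygamma 1 (a j w) + Polygamma 1 (b j w)))) / 2 +
      of_nat pm * (- (1 / (w - \<i> / 2)\<^sup>2) + - (1 / (w - - (\<i> / 2))\<^sup>2))) (at w)"
    using half_i_not_in_bowtie[OF w] unfolding E_def [abs_def]
    by (intro DERIV_add DERIV_cdivide DERIV_cmult) (auto simp: diff_minus_eq_add[symmetric] simp del: diff_minus_eq_add)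
  thus ?thesis by (rule DERIV_cong) (simp only: dE_def sum_negf, simp add: algebra_simps)
qed

text \<open>The trigamma values are \<open>1 / a j w\<close> and \<open>1 / b j w\<close> up to
  \<open>O(1 / t^2)\<close>. Each of these main terms is only known to be of size
  \<open>1 / t\<close>, but \<open>a j w + b j w\<close> does not depend on \<open>w\<close>, so
  their sum is \<open>O(1 / t^2)\<close> as well.\<close>

lemma dE_bound:
  obtains K where "K \<ge> 0" "\<And>w. w \<in> bowtie \<delta> \<Longrightarrow> \<bar>Re w\<bar> \<ge> T0 \<Longrightarrow> norm (dE w) \<le> K / (Re w)\<^sup>2"
proof -
  \<comment> \<open>As \<open>u^2 = (lam j)^2 * t^2 / 16\<close>, every constant is multiplied by
    16: twice 8 from \<open>trigamma_approx\<close>, and \<open>4 * (lam j + 2 * Re (mu j))\<close>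
    from the main terms.\<close>
  define k where "k = (\<lambda>j. 256 + 64 * (lam j + 2 * Re (mu j)))"
  define K where "K = (\<Sum>j=1..r. k j) / 2 + real pm * 2"
  have k0: "k j \<ge> 0" if j: "j \<in> {1..r}" for j using params(2)[OF j] params(3)[OF j] by (simp add: k_def)
  have K0: "K \<ge> 0" unfolding K_def using k0 by (intro add_nonneg_nonneg divide_nonneg_nonneg sum_nonneg) auto
  have "norm (dE w) \<le> K / (Re w)\<^sup>2" if w: "w \<in> bowtie \<delta>" "\<bar>Re w\<bar> \<ge> T0" for w
  proof -
    define t where "t = \<bar>Re w\<bar>"
    have t: "t \<ge> 1" "t > 0" "t\<^sup>2 = (Re w)\<^sup>2" using w T0 by (auto simp: t_def)
    have tj: "norm ((of_real (lam j))\<^sup>2 * (Polygamma 1 (a j w) + Polygamma 1 (b j w))) \<le> k j / t\<^sup>2" if j: "j \<in> {1..r}" for j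
    proof -
      have l: "lam j > 0" "Re (mu j) \<ge> 0" using params j by auto
      define u where "u = lam j * t / 4"
      have "8 / lam j \<le> t" using T0(3)[OF j] w(2) by (simp add: t_def)
      hence u: "u \<ge> 2" using l by (simp add: u_def pos_divide_le_eq mult.commute)
      have A: "norm (Polygamma 1 (a j w) - 1 / a j w) \<le> 8 / u\<^sup>2"
        by (rule trigamma_approx[OF u]) (use a_lower[OF j w] in \<open>simp add: u_def t_def\<close>)
      have B: "norm (Polygamma 1 (b j w) - 1 / b j w) \<le> 8 / u\<^sup>2"
        by (rule trigamma_approx[OF u]) (use b_lower[OF j w] in \<open>simp add: u_def t_def\<close>)
      have na: "norm (a j w) \<ge> u / 2" "norm (b j w) \<ge> u / 2"
        using a_lower[OF j w, of 0] b_lower[OF j w, of 0] by (simp_all add: u_def t_def)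
      have nz: "a j w \<noteq> 0" "b j w \<noteq> 0" using na u by auto
      have sum: "a j w + b j w = of_real (lam j + 2 * Re (mu j))" by (simp add: a_def b_def complex_eq_iff algebra_simps)
      have "1 / a j w + 1 / b j w = (a j w + b j w) / (a j w * b j w)" using nz by (simp add: field_simps)
      hence "norm (1 / a j w + 1 / b j w) = (lam j + 2 * Re (mu j)) / (norm (a j w) * norm (b j w))"
        unfolding sum using l by (simp add: norm_divide norm_mult del: of_real_add of_real_mult)
      also have "\<dots> \<le> (lam j + 2 * Re (mu j)) / (u / 2 * (u / 2))"
        using na u l by (intro divide_left_mono mult_mono mult_pos_pos) auto
      also have "\<dots> = 4 * (lam j + 2 * Re (mu j)) / u\<^sup>2" by (simp add: power2_eq_square)
      finally have C: "norm (1 / a j w + 1 / b j w) \<le> 4 * (lam j + 2 * Re (mu j)) / u\<^sup>2" .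
      have "Polygamma 1 (a j w) + Polygamma 1 (b j w) = (Polygamma 1 (a j w) - 1 / a j w) + (Polygamma 1 (b j w) - 1 / b j w) + (1 / a j w + 1 / b j w)" by simp
      also have "norm \<dots> \<le> 8 / u\<^sup>2 + 8 / u\<^sup>2 + 4 * (lam j + 2 * Re (mu j)) / u\<^sup>2"
        by (intro norm_triangle_le add_mono A B C)
      also have "\<dots> = (k j / 16) / u\<^sup>2" using u by (simp add: k_def field_simps)
      also have "\<dots> = k j / ((lam j)\<^sup>2 * t\<^sup>2)" by (simp add: u_def power_mult_distrib power_divide)
      finally have "(lam j)\<^sup>2 * norm (Polygamma 1 (a j w) + Polygamma 1 (b j w)) \<le> (lam j)\<^sup>2 * (k j / ((lam j)\<^sup>2 * t\<^sup>2))"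
        by (intro mult_left_mono) auto
      thus ?thesis using l by (simp add: norm_mult norm_power)
    qed
    have "norm (\<Sum>j=1..r. (of_real (lam j))\<^sup>2 * (Polygamma 1 (a j w) + Polygamma 1 (b j w))) \<le> (\<Sum>j=1..r. k j / t\<^sup>2)"
      by (intro sum_norm_le tj)
    hence 1: "norm (- (\<Sum>j=1..r. (of_real (lam j))\<^sup>2 * (Polygamma 1 (a j w) + Polygamma 1 (b j w))) / 2) \<le> (\<Sum>j=1..r. k j) / 2 / t\<^sup>2"
      by (simp add: norm_divide sum_divide_distrib[symmetric])
    have h: "norm (1 / (w - c)\<^sup>2) \<le> 1 / t\<^sup>2" if "Re c = 0" for c
    proof -
      have "t \<le> norm (w - c)" using abs_Re_le_cmod[of "w - c"] that by (simp add: t_def)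
      hence "t\<^sup>2 \<le> (norm (w - c))\<^sup>2" using t by (intro power_mono) auto
      hence "1 / (norm (w - c))\<^sup>2 \<le> 1 / t\<^sup>2" using t by (intro divide_left_mono) (auto intro!: mult_pos_pos elim: less_le_trans[rotated])
      thus ?thesis by (simp add: norm_divide norm_power)
    qed
    have "norm (1 / (w - \<i> / 2)\<^sup>2 + 1 / (w + \<i> / 2)\<^sup>2) \<le> 1 / t\<^sup>2 + 1 / t\<^sup>2"
      using h[of "\<i> / 2"] h[of "- (\<i> / 2)"] by (intro norm_triangle_le add_mono) auto
    hence "real pm * norm (1 / (w - \<i> / 2)\<^sup>2 + 1 / (w + \<i> / 2)\<^sup>2) \<le> real pm * (1 / t\<^sup>2 + 1 / t\<^sup>2)" by (intro mult_left_mono) auto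
    hence 2: "norm (of_nat pm * (1 / (w - \<i> / 2)\<^sup>2 + 1 / (w + \<i> / 2)\<^sup>2)) \<le> real pm * 2 / t\<^sup>2" by (simp add: norm_mult)
    have "norm (dE w) \<le> (\<Sum>j=1..r. k j) / 2 / t\<^sup>2 + real pm * 2 / t\<^sup>2"
      unfolding dE_def using norm_triangle_le_diff 1 2 by (smt (verit) norm_triangle_ineq4)
    also have "\<dots> = K / t\<^sup>2" by (simp add: K_def add_divide_distrib)
    finally show ?thesis using t(3) by simp
  qed
  thus ?thesis using that K0 by blast
qed


text \<open>The factor that turns \<open>Xi\<close> into the Hardy function: it divides by the
  modulus of the gamma factor and by the polynomial part of \<open>X\<close>, as
  \<open>1 / 4 + w^2 = - s * (s - 1)\<close> at \<open>s = 1 / 2 + \<i> * w\<close>.\<close>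

definition amplitude :: "complex \<Rightarrow> complex" where "amplitude w = exp (- L w) / (1 / 4 + w\<^sup>2) ^ pm"

lemma amplitude_holo: "amplitude holomorphic_on bowtie \<delta>" and amplitude_nz: "w \<in> bowtie \<delta> \<Longrightarrow> amplitude w \<noteq> 0"
proof -
  have "L holomorphic_on bowtie \<delta>"
    unfolding holomorphic_on_def field_differentiable_def using L_deriv has_field_derivative_at_within by blast
  thus "amplitude holomorphic_on bowtie \<delta>" unfolding amplitude_def [abs_def]
    using half_i_not_in_bowtie(3) by (intro holomorphic_intros) auto
  show "amplitude w \<noteq> 0" if "w \<in> bowtie \<delta>" using half_i_not_in_bowtie(3)[OF that] by (simp add: amplitude_def)
qed

lemma amplitude_deriv:
  assumes w: "w \<in> bowtie \<delta>"
  shows "(amplitude has_field_derivative - (amplitude w * E w)) (at w)"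
proof -
  note nz = half_i_not_in_bowtie[OF w]
  define D where "D = (\<Sum>j=1..r. \<i> * of_real (lam j) * (Digamma (a j w) - Digamma (b j w))) / 2"
  have 1: "((\<lambda>w. exp (- L w)) has_field_derivative exp (- L w) * (- D)) (at w)"
    by (rule DERIV_fun_exp[OF DERIV_minus]) (unfold D_def, rule L_deriv[OF w])
  define p where "p = (\<lambda>w::complex. (1 / 4 + w\<^sup>2) ^ pm)"
  define ld where "ld = of_nat pm * (1 / (w - \<i> / 2) + 1 / (w + \<i> / 2))"
  have p_eq: "p = (\<lambda>w. \<Prod>x\<in>{\<i> / 2, - (\<i> / 2)}. (w - x) ^ pm)"
  proof
    fix w :: complex
    have "1 / 4 + w\<^sup>2 = (w - \<i> / 2) * (w - - (\<i> / 2))" by (simp add: power2_eq_square algebra_simps)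
    moreover have "\<i> / 2 \<noteq> - (\<i> / 2)" by (simp add: complex_eq_iff)
    ultimately show "p w = (\<Prod>x\<in>{\<i> / 2, - (\<i> / 2)}. (w - x) ^ pm)" by (simp add: p_def power_mult_distrib)
  qed
  have ne: "\<i> / 2 \<noteq> - (\<i> / 2)" by (simp add: complex_eq_iff)
  have "(p has_field_derivative p w * (\<Sum>x\<in>{\<i> / 2, - (\<i> / 2)}. of_nat pm / (w - x))) (at w)"
    unfolding p_eq by (rule has_field_derivative_prod_power) (use nz in \<open>auto simp: eq_neg_iff_add_eq_0\<close>)
  moreover have "(\<Sum>x\<in>{\<i> / 2, - (\<i> / 2)}. of_nat pm / (w - x)) = ld"
    using ne by (simp add: ld_def distrib_left)
  ultimately have 2: "(p has_field_derivative p w * ld) (at w)" by simp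
  have pnz: "p w \<noteq> 0" using nz by (simp add: p_def)
  have "((\<lambda>w. exp (- L w) / p w) has_field_derivative ((exp (- L w) * (- D)) * p w - exp (- L w) * (p w * ld)) / (p w * p w)) (at w)"
    by (rule DERIV_divide[OF 1 2 pnz])
  moreover have "((exp (- L w) * (- D)) * p w - exp (- L w) * (p w * ld)) / (p w * p w) = - (exp (- L w) / p w * (D + ld))"
    using pnz by (simp add: field_simps)
  moreover have "E w = D + ld" by (simp add: E_def D_def ld_def)
  moreover have "amplitude = (\<lambda>w. exp (- L w) / p w)" by (simp add: amplitude_def [abs_def] p_def)
  ultimately show ?thesis by simp
qed

lemma exp_2L:
  "exp (2 * L (of_real t)) = gm (Complex (1 / 2) t) * cnj (gm (Complex (1 / 2) t))"
proof -
  define s where "s = Complex (1 / 2) t"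
  have s: "s = 1 / 2 + \<i> * of_real t" by (simp add: s_def complex_eq_iff)
  have tO: "of_real t \<in> bowtie \<delta>" using \<delta> by simp
  have aj: "a j (of_real t) = of_real (lam j) * s + mu j" "b j (of_real t) = cnj (a j (of_real t))" for j
    by (simp_all add: a_def s b_eq)
  have g: "exp (ln_Gamma (a j (of_real t)) + ln_Gamma (b j (of_real t))) = Gamma (a j (of_real t)) * cnj (Gamma (a j (of_real t)))" if j: "j \<in> {1..r}" for j
  proof -
    have "exp (ln_Gamma (a j (of_real t))) = Gamma (a j (of_real t))" "exp (ln_Gamma (b j (of_real t))) = Gamma (b j (of_real t))"
      using nonpos_Ints_subset[OF a_not_nonpos[OF j tO]] nonpos_Ints_subset[OF b_not_nonpos[OF j tO]] by (simp_all add: Gamma_complex_altdef)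
    thus ?thesis by (simp add: exp_add aj(2) cnj_Gamma)
  qed
  have "exp (2 * L (of_real t)) = exp (of_real (ln Q)) * exp (\<Sum>j=1..r. ln_Gamma (a j (of_real t)) + ln_Gamma (b j (of_real t)))"
    by (simp add: L_def distrib_left flip: exp_add)
  also have "exp (\<Sum>j=1..r. ln_Gamma (a j (of_real t)) + ln_Gamma (b j (of_real t))) =
      (\<Prod>j=1..r. Gamma (a j (of_real t)) * cnj (Gamma (a j (of_real t))))"
    by (subst exp_sum) (auto intro!: prod.cong g)
  also have "exp (of_real (ln Q)) = of_real Q powr s * cnj (of_real Q powr s)"
  proof -
    have "of_real Q powr s * cnj (of_real Q powr s) = of_real ((norm (of_real Q powr s))\<^sup>2)" by (rule complex_norm_square[symmetric])
    also have "norm (of_real Q powr s) = Q powr (1 / 2)" using params(1) by (simp add: norm_powr_real_powr s_def)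
    also have "(Q powr (1 / 2))\<^sup>2 = Q" using params(1) by (simp add: powr_half_sqrt)
    also have "complex_of_real Q = exp (of_real (ln Q))" using params(1) by (metis exp_ln exp_of_real)
    finally show ?thesis by simp
  qed
  finally show ?thesis
    unfolding s_def[symmetric] gamma_factor_def by (simp add: aj prod.distrib mult_ac)
qed

text \<open>
  \<open>exp (L (of_real t))\<close> is \<open>\<bar>gm (1 / 2 + \<i> * t)\<bar>\<close> up to sign, so the quotient of the two sides has square
  \<open>1\<close> and is constant by continuity.
\<close>

lemma Hardy_sign:
  obtains \<epsilon> :: complex where "\<epsilon> = 1 \<or> \<epsilon> = - 1"
    "\<And>t. exp (\<i> * of_real (\<theta> t)) * exp (L (of_real t)) = \<epsilon> * (\<kappa> * gm (Complex (1 / 2) t))"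
proof -
  define g where "g = (\<lambda>t. gm (Complex (1 / 2) t))"
  define u where "u = (\<lambda>t. exp (\<i> * of_real (\<theta> t)) * exp (L (of_real t)) / (\<kappa> * g t))"
  have gnz: "g t \<noteq> 0" for t using gm_nz[of "Complex (1 / 2) t"] by (simp add: g_def)
  have u2: "(u t)\<^sup>2 = 1" for t
  proof -
    have "H_factor r Q lam mu \<omega> (Complex (1 / 2) t) = \<omega> * cnj (g t) / g t"
    proof -
      have "1 - cnj (Complex (1 / 2) t) = Complex (1 / 2) t" by (simp add: complex_eq_iff)
      thus ?thesis by (simp add: H_factor_def g_def)
    qed
    hence "exp (- (2 * \<i> * of_real (\<theta> t))) = \<omega> * cnj (g t) / g t" using phase by (simp add: Hardy_phase_def)
    hence "inverse (exp (2 * \<i> * of_real (\<theta> t))) = \<omega> * cnj (g t) / g t" by (simp add: exp_minus)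
    hence e: "exp (2 * \<i> * of_real (\<theta> t)) = g t / (\<omega> * cnj (g t))" by (metis inverse_divide inverse_inverse_eq)
    have e2: "(exp (\<i> * of_real (\<theta> t)))\<^sup>2 = exp (2 * \<i> * of_real (\<theta> t))" by (simp add: mult.assoc flip: exp_double)
    have l2: "(exp (L (of_real t)))\<^sup>2 = g t * cnj (g t)" using exp_2L[of t] by (simp add: g_def flip: exp_double)
    have w0: "\<omega> \<noteq> 0" using params(4) by auto
    have "(u t)\<^sup>2 = (exp (\<i> * of_real (\<theta> t)))\<^sup>2 * (exp (L (of_real t)))\<^sup>2 / (\<kappa>\<^sup>2 * (g t)\<^sup>2)"
      by (simp add: u_def power_divide power_mult_distrib)
    also have "\<dots> = g t / (\<omega> * cnj (g t)) * (g t * cnj (g t)) / (\<kappa>\<^sup>2 * (g t)\<^sup>2)" unfolding e2 e l2 ..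
    also have "\<dots> = 1 / (\<kappa>\<^sup>2 * \<omega>)" using gnz[of t] w0 \<kappa>(3) by (simp add: power2_eq_square field_simps)
    finally show ?thesis by (simp add: \<kappa>(1))
  qed
  have cont: "continuous_on UNIV u"
  proof -
    have th: "continuous_on UNIV \<theta>"
    proof -
      have "\<theta> differentiable (at t)" for t
        using phase unfolding Hardy_phase_def smooth_def by (metis funpow_0)
      thus ?thesis by (auto intro!: continuous_at_imp_continuous_on differentiable_imp_continuous_within)
    qed
    have Lc: "continuous_on (bowtie \<delta>) L"
      using L_deriv by (auto intro!: continuous_at_imp_continuous_on DERIV_isCont)
    have 1: "continuous_on UNIV (\<lambda>t. L (of_real t))"
      by (rule continuous_on_compose2[OF Lc]) (use \<delta> in \<open>auto intro!: continuous_intros\<close>)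
    have 2: "continuous_on UNIV g"
      unfolding g_def
    proof (rule continuous_on_compose2[OF holomorphic_on_imp_continuous_on[OF gm_holo]])
      have "continuous_on UNIV (\<lambda>t. 1 / 2 + \<i> * of_real t)" by (intro continuous_intros)
      moreover have "(\<lambda>t. 1 / 2 + \<i> * of_real t) = Complex (1 / 2)" by (auto simp: complex_eq_iff)
      ultimately show "continuous_on UNIV (Complex (1 / 2))" by (simp only:)
    qed auto
    show ?thesis unfolding u_def by (intro continuous_intros th 1 2) (use \<kappa>(3) gnz in auto)
  qed
  have "u ` UNIV \<subseteq> {1, - 1}" using u2 by (auto simp: power2_eq_1_iff)
  hence fin: "finite (u ` UNIV)" by (rule finite_subset) auto
  have "u constant_on UNIV"
    by (rule continuous_finite_range_constant[OF _ cont fin]) auto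
  then obtain \<epsilon> where \<epsilon>: "\<And>t. u t = \<epsilon>" by (auto simp: constant_on_def)
  have "\<epsilon> = 1 \<or> \<epsilon> = - 1" using u2[of 0] \<epsilon>[of 0] by (simp add: power2_eq_1_iff)
  moreover have "exp (\<i> * of_real (\<theta> t)) * exp (L (of_real t)) = \<epsilon> * (\<kappa> * gm (Complex (1 / 2) t))" for t
    using \<epsilon>[of t] gnz[of t] \<kappa>(3) unfolding u_def g_def by (simp add: field_simps)
  ultimately show ?thesis using that by blast
qed

lemma Hardy_Z_extension:
  obtains \<epsilon> :: complex where "\<epsilon> \<noteq> 0" "\<And>t. \<epsilon> * (Xi (of_real t) * amplitude (of_real t)) = of_real (Hardy_Z F \<theta> t)"
proof -
  obtain \<epsilon> :: complex where \<epsilon>: "\<epsilon> = 1 \<or> \<epsilon> = - 1"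
    "\<And>t. exp (\<i> * of_real (\<theta> t)) * exp (L (of_real t)) = \<epsilon> * (\<kappa> * gm (Complex (1 / 2) t))" using Hardy_sign by blast
  have "(\<epsilon> * (- 1) ^ pm) * (Xi (of_real t) * amplitude (of_real t)) = of_real (Hardy_Z F \<theta> t)" for t
  proof -
    define s where "s = Complex (1 / 2) t"
    have s: "s = 1 / 2 + \<i> * of_real t" "Re s > 0" "s \<noteq> 1" by (auto simp: s_def complex_eq_iff)
    have "s * (s - 1) = - (1 / 4 + (of_real t)\<^sup>2)" by (simp add: s(1) complex_eq_iff power2_eq_square)
    hence sp: "s ^ pm * (s - 1) ^ pm = (- 1) ^ pm * (1 / 4 + (of_real t)\<^sup>2) ^ pm"
      by (metis power_mult_distrib mult_minus1)
    define q where "q = (1 / 4 + (complex_of_real t)\<^sup>2) ^ pm"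
    have qnz: "q \<noteq> 0" using half_i_not_in_bowtie(3)[of "of_real t"] \<delta> by (simp add: q_def)
    have X: "X s = (- 1) ^ pm * q * F s * gm s" using X_eq[OF s(2)] G(2)[OF s(3)] sp by (simp add: q_def mult_ac)
    have "(\<epsilon> * (- 1) ^ pm) * (Xi (of_real t) * amplitude (of_real t)) = (\<epsilon> * (- 1) ^ pm) * (\<kappa> * X s * (exp (- L (of_real t)) / q))"
      by (simp add: Xi_def amplitude_def q_def s(1))
    also have "\<dots> = ((- 1) ^ pm * (- 1) ^ pm) * (\<epsilon> * (\<kappa> * gm s)) * exp (- L (of_real t)) * F s"
      unfolding X using qnz by (simp add: mult_ac)
    also have "(- 1) ^ pm * (- 1) ^ pm = (1 :: complex)" by (simp flip: power_mult_distrib)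
    also have "\<epsilon> * (\<kappa> * gm s) = exp (\<i> * of_real (\<theta> t)) * exp (L (of_real t))" using \<epsilon>(2)[of t] by (simp add: s_def)
    also have "1 * (exp (\<i> * of_real (\<theta> t)) * exp (L (of_real t))) * exp (- L (of_real t)) * F s = exp (\<i> * of_real (\<theta> t)) * F s"
      by (simp add: exp_minus)
    also have "\<dots> = of_real (Hardy_Z F \<theta> t)" unfolding s_def by (rule of_real_Hardy_Z[OF F fe phase, symmetric])
    finally show ?thesis .
  qed
  moreover have "\<epsilon> * (- 1) ^ pm \<noteq> 0" using \<epsilon>(1) by auto
  ultimately show ?thesis using that by blast
qed

theorem near_real_rooted_Hardy:
  assumes rQ: "r \<ge> 1 \<or> Q > 1"
  shows "\<exists>g c T A C. near_real_rooted \<delta> g c T A C \<and> (\<forall>t. g (of_real t) = of_real (Hardy_Z F \<theta> t))"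
proof -
  obtain \<epsilon> :: complex where \<epsilon>: "\<epsilon> \<noteq> 0" "\<And>t. \<epsilon> * (Xi (of_real t) * amplitude (of_real t)) = of_real (Hardy_Z F \<theta> t)"
    using Hardy_Z_extension by blast
  define g where "g = (\<lambda>w. \<epsilon> * (Xi w * amplitude w))"
  have g_real: "g (of_real t) = of_real (Hardy_Z F \<theta> t)" for t using \<epsilon>(2) by (simp add: g_def)
  have gh: "g holomorphic_on bowtie \<delta>" unfolding g_def by (intro holomorphic_intros Xi_holo amplitude_holo)
  have gsym: "g (cnj w) = cnj (g w)" if "w \<in> bowtie \<delta>" for w
    by (rule real_on_reals_imp_sym[OF gh \<delta>(1) _ that]) (simp add: g_real)
  have Xi_i: "Xi \<i> \<noteq> 0" using Xi_zeros[of \<i>] by auto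
  have mult: "zmult g (of_real x) = zmult Xi (of_real x)" for x
  proof -
    obtain h where h: "h holomorphic_on UNIV" "h (of_real x) \<noteq> 0" "\<And>w. w \<in> UNIV \<Longrightarrow> Xi w = (w - of_real x) ^ zmult Xi (of_real x) * h w"
      using zmult_factor[OF Xi_holo open_UNIV connected_UNIV _ _ Xi_i, of "of_real x"] by auto
    show ?thesis
    proof (rule zmult_eqI[OF open_bowtie, where g = "\<lambda>w. \<epsilon> * (h w * amplitude w)"])
      show "of_real x \<in> bowtie \<delta>" using \<delta> by simp
      show "(\<lambda>w. \<epsilon> * (h w * amplitude w)) holomorphic_on bowtie \<delta>"
        by (intro holomorphic_intros amplitude_holo holomorphic_on_subset[OF h(1)]) auto
      show "\<epsilon> * (h (of_real x) * amplitude (of_real x)) \<noteq> 0" using \<epsilon>(1) h(2) amplitude_nz[of "of_real x"] \<delta> by simp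
      show "g w = (w - of_real x) ^ zmult Xi (of_real x) * (\<epsilon> * (h w * amplitude w))" for w
        unfolding g_def h(3)[OF UNIV_I, of w] by (simp add: mult_ac)
    qed
  qed
  have zs: "zsum g t y = zsum Xi t y" for t y by (simp add: zsum_def mult)
  have ld: "deriv g w / g w = deriv Xi w / Xi w - E w" if w: "w \<in> bowtie \<delta>" "Im w \<noteq> 0" for w
  proof -
    have nz: "Xi w \<noteq> 0" "amplitude w \<noteq> 0" using Xi_zeros[of w] w amplitude_nz by auto
    have "(Xi has_field_derivative deriv Xi w) (at w)" by (rule holomorphic_derivI[OF Xi_holo open_UNIV]) simp
    from DERIV_cmult[OF DERIV_mult[OF this amplitude_deriv[OF w(1)]], of \<epsilon>]
    have "deriv g w = \<epsilon> * (deriv Xi w * amplitude w + - (amplitude w * E w) * Xi w)" unfolding g_def by (rule DERIV_imp_deriv)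
    thus ?thesis using nz \<epsilon>(1) by (simp add: g_def field_simps)
  qed
  have Esym: "E (cnj w) = cnj (E w)" if w: "w \<in> bowtie \<delta>" "Im w \<noteq> 0" for w
  proof -
    have 1: "deriv g (cnj w) = cnj (deriv g w)" by (rule deriv_cnj[OF open_bowtie w(1) gh]) (auto simp: gsym)
    have 2: "deriv Xi (cnj w) = cnj (deriv Xi w)" by (rule deriv_cnj[OF open_UNIV UNIV_I Xi_holo]) (auto simp: Xi_cnj)
    have "E w = deriv Xi w / Xi w - deriv g w / g w" using ld[OF w] by simp
    moreover have "E (cnj w) = deriv Xi (cnj w) / Xi (cnj w) - deriv g (cnj w) / g (cnj w)" using ld[of "cnj w"] w by simp
    ultimately show ?thesis using w by (simp add: 1 2 Xi_cnj gsym)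
  qed
  obtain K where K: "K \<ge> 0" "\<And>w. w \<in> bowtie \<delta> \<Longrightarrow> \<bar>Re w\<bar> \<ge> T0 \<Longrightarrow> norm (dE w) \<le> K / (Re w)\<^sup>2" using dE_bound by blast
  obtain A T where A: "A > 0" "T \<ge> 1" "\<And>t. \<bar>t\<bar> \<ge> T \<Longrightarrow> A / \<bar>t\<bar> \<le> zsum Xi t \<bar>t\<bar>" using Xi_zsum_ge[OF rQ] by blast
  have "near_real_rooted \<delta> g \<delta> (max T T0) A K"
  proof
    show "\<delta> > 0" "\<delta> \<le> \<delta>" "\<delta> \<le> 1" "max T T0 \<ge> 1" "A > 0" "K \<ge> 0" using \<delta> A K by auto
    show "g holomorphic_on bowtie \<delta>" by (rule gh)
    show "\<And>w. w \<in> bowtie \<delta> \<Longrightarrow> g (cnj w) = cnj (g w)" by (rule gsym)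
    show "(\<lambda>x. real (zmult g (of_real x)) / (1 + x\<^sup>2)) summable_on UNIV"
      using Xi_has_sum[of 1 0] unfolding mult by (auto simp: summable_on_def add.commute)
    show "A / \<bar>t\<bar> \<le> zsum g t (\<delta> * \<bar>t\<bar>)" if t: "\<bar>t\<bar> \<ge> max T T0" for t
    proof -
      have t0: "\<bar>t\<bar> > 0" using t A by linarith
      have "zsum Xi t \<bar>t\<bar> \<le> zsum Xi t (\<delta> * \<bar>t\<bar>)"
        unfolding zsum_def
      proof (rule infsum_mono)
        show "(\<lambda>x. real (zmult Xi (of_real x)) / ((t - x)\<^sup>2 + \<bar>t\<bar>\<^sup>2)) summable_on UNIV"
          using Xi_has_sum[of "\<bar>t\<bar>" t] t0 by (auto simp: summable_on_def)
        have dt: "\<delta> * \<bar>t\<bar> > 0" using \<delta> t0 by simp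
        thus "(\<lambda>x. real (zmult Xi (of_real x)) / ((t - x)\<^sup>2 + (\<delta> * \<bar>t\<bar>)\<^sup>2)) summable_on UNIV"
          by (intro has_sum_imp_summable[OF Xi_has_sum]) (metis less_irrefl)
        fix x
        have "\<delta> * \<bar>t\<bar> \<le> 1 * \<bar>t\<bar>" using \<delta> by (intro mult_right_mono) auto
        thus "real (zmult Xi (of_real x)) / ((t - x)\<^sup>2 + \<bar>t\<bar>\<^sup>2) \<le> real (zmult Xi (of_real x)) / ((t - x)\<^sup>2 + (\<delta> * \<bar>t\<bar>)\<^sup>2)"
          using dt t0 by (intro divide_left_mono add_left_mono power_mono mult_pos_pos add_nonneg_pos) auto
      qed
      thus ?thesis using A(3)[of t] t unfolding zs by linarith
    qed
    show "\<bar>Im (deriv g (Complex t y) / g (Complex t y)) + y * zsum g t y\<bar> \<le> K * y / t\<^sup>2"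
      if t: "\<bar>t\<bar> \<ge> max T T0" and y: "0 < y" "y \<le> \<delta> * \<bar>t\<bar>" for t y
    proof -
      define w where "w = Complex t y"
      have inO: "z \<in> bowtie \<delta>" if "Re z = t" "\<bar>Im z\<bar> \<le> y" for z using that y \<delta> by (auto simp: bowtie_def algebra_simps)
      have w: "w \<in> bowtie \<delta>" "Im w \<noteq> 0" "Im w = y" "Re w = t" using inO[of w] y by (auto simp: w_def)
      define S where "S = {z. Re z = t \<and> - y \<le> Im z \<and> Im z \<le> y}"
      have "S = cbox (Complex t (- y)) (Complex t y)" by (auto simp: S_def in_cbox_complex_iff)
      hence cS: "convex S" by simp
      have "\<bar>Im (E w)\<bar> \<le> K / t\<^sup>2 * \<bar>Im w\<bar>"
      proof (rule Im_le_deriv_bound[OF cS])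
        show "w \<in> S" "cnj w \<in> S" using w y by (auto simp: S_def)
        show "E (cnj w) = cnj (E w)" by (rule Esym[OF w(1,2)])
        fix z assume z: "z \<in> S"
        hence zO: "z \<in> bowtie \<delta>" "Re z = t" using inO[of z] by (auto simp: S_def abs_le_iff)
        show "(E has_field_derivative dE z) (at z)" by (rule E_deriv[OF zO(1)])
        show "norm (dE z) \<le> K / t\<^sup>2" using K(2)[OF zO(1)] zO(2) t by simp
      qed
      hence Eb: "\<bar>Im (E w)\<bar> \<le> K * y / t\<^sup>2" using w(3) y by simp
      have "y * zsum Xi t y = - Im (deriv Xi w / Xi w)" using Xi_zsum[of y t] y by (simp add: w_def)
      hence "Im (deriv g w / g w) + y * zsum g t y = - Im (E w)" unfolding ld[OF w(1,2)] zs by simp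
      thus ?thesis using Eb unfolding w_def[symmetric] by simp
    qed
  qed
  thus ?thesis using g_real by blast
qed


lemma Hardy_Z_constant:
  assumes "r = 0" "Q \<le> 1"
  shows "\<exists>c. Hardy_Z F \<theta> = (\<lambda>_. c)"
proof -
  have F1: "F (Complex (1 / 2) t) = 1" for t
    using F_eq_1_of_trivial_gamma_factor[OF assms] by (auto simp: complex_eq_iff)
  have Z: "complex_of_real (Hardy_Z F \<theta> t) = exp (\<i> * of_real (\<theta> t))" for t
    using of_real_Hardy_Z[OF F fe phase, of t] F1[of t] by simp
  have "norm (complex_of_real (Hardy_Z F \<theta> t)) = 1" for t unfolding Z by simp
  hence Z1: "\<bar>Hardy_Z F \<theta> t\<bar> = 1" for t by simp
  have Zv: "Hardy_Z F \<theta> = (\<lambda>t. Re (exp (\<i> * of_real (\<theta> t))))" using Z by (metis Re_complex_of_real)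
  have "\<theta> differentiable (at t)" for t
    using phase unfolding Hardy_phase_def smooth_def by (metis funpow_0)
  hence th: "continuous_on UNIV \<theta>"
    by (auto intro!: continuous_at_imp_continuous_on differentiable_imp_continuous_within)
  have cont: "continuous_on UNIV (Hardy_Z F \<theta>)" unfolding Zv by (intro continuous_intros th)
  have "Hardy_Z F \<theta> t = 1 \<or> Hardy_Z F \<theta> t = - 1" for t using Z1[of t] by linarith
  hence "range (Hardy_Z F \<theta>) \<subseteq> {1, - 1}" by auto
  hence fin: "finite (range (Hardy_Z F \<theta>))" by (rule finite_subset) auto
  have "Hardy_Z F \<theta> constant_on UNIV"
    by (rule continuous_finite_range_constant[OF _ cont fin]) auto
  thus ?thesis by (auto simp: constant_on_def)
qed

end

theorem theorem1p4:
  fixes F :: "complex \<Rightarrow> complex" and \<theta> :: "real \<Rightarrow> real" and k r :: nat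
    and Q :: real and lam :: "nat \<Rightarrow> real" and mu :: "nat \<Rightarrow> complex" and \<omega> :: complex
  defines "Z \<equiv> \<lambda>n. (deriv ^^ n) (Hardy_Z F \<theta>)"
  assumes "F \<in> extended_Selberg_class"
    and "functional_equation r Q lam mu \<omega> F"
    and "Hardy_phase r Q lam mu \<omega> \<theta>"
    and "Riemann_Hypothesis r Q lam mu F"
  shows "\<exists>R :: real \<Rightarrow> real. R \<in> O[at_top](\<lambda>t. 1 / t) \<and>
    (\<forall>t. Z k t \<noteq> 0 \<longrightarrow>
      (\<lambda>x. real (zero_mult (Z k) x) / (t - x)\<^sup>2) summable_on {x. Z k x = 0} \<and>
      ((\<lambda>u. Z (k + 1) u / Z k u) has_real_derivative
         (- (\<Sum>\<^sub>\<infinity>x\<in>{x. Z k x = 0}. real (zero_mult (Z k) x) / (t - x)\<^sup>2) + R t)) (at t))"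
proof -
  interpret selberg_RH F r Q lam mu \<omega> \<theta> by unfold_locales fact+
  show ?thesis
  proof (cases "r \<ge> 1 \<or> Q > 1")
    case True
    then obtain g c T A C where g: "near_real_rooted \<delta> g c T A C" "\<And>t. g (of_real t) = of_real (Hardy_Z F \<theta> t)"
      using near_real_rooted_Hardy by blast
    show ?thesis unfolding Z_def by (rule near_real_rooted_logderiv_asymptotics[OF g])
  next
    case False
    then obtain c where c: "Hardy_Z F \<theta> = (\<lambda>_. c)" using Hardy_Z_constant by auto
    have Z_Suc: "Z (Suc n) = (\<lambda>_. 0)" for n
      by (induction n) (simp_all add: Z_def c)
    show ?thesis
    proof (intro exI[of _ "\<lambda>_. 0"] conjI allI impI)
      fix t assume t: "Z k t \<noteq> 0"
      hence k: "k = 0" using Z_Suc by (cases k) auto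
      have Z0: "Z k = (\<lambda>_. c)" by (simp add: k Z_def c)
      have Z1: "Z (k + 1) = (\<lambda>_. 0)" using Z_Suc[of 0] k by simp
      have empty: "{x. Z k x = 0} = {}" using t Z0 by auto
      show "(\<lambda>x. real (zero_mult (Z k) x) / (t - x)\<^sup>2) summable_on {x. Z k x = 0}" unfolding empty by simp
      show "((\<lambda>u. Z (k + 1) u / Z k u) has_real_derivative
         (- (\<Sum>\<^sub>\<infinity>x\<in>{x. Z k x = 0}. real (zero_mult (Z k) x) / (t - x)\<^sup>2) + 0)) (at t)"
        unfolding empty Z1 by simp
    qed simp
  qed
qed

end
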